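(* (Second Calderón formula) Let $d\ge1$ be an integer and $\alpha>-1/2$. Let $\varphi\in L^2_\alpha(\mathbb{R}^{d+1}_+)$, let $m\in L^2_\alpha(\mathbb{R}^{d+1}_+)\cap L^\infty_\alpha(\mathbb{R}^{d+1}_+)$ satisfy the admissibility condition $$\int_0^\infty |m(\sigma x)|^2\,\frac{d\sigma}{\sigma}=1,\qquad x\in\mathbb{R}^{d+1}_+,$$ and let $0<\gamma<\delta<\infty$. Then the function $$\varphi_{\gamma,\delta}(x)=\int_\gamma^\delta\Big(\mathcal{T}_{w,m,\sigma}\varphi*_W\mathcal{F}^{-1}_{W,\alpha}(\overline{m_\sigma})\Big)(x)\,\frac{d\sigma}{\sigma},\qquad x\in\mathbb{R}^{d+1}_+,$$ belongs to $L^2_\alpha(\mathbb{R}^{d+1}_+)$ and satisfies $$\lim_{(\gamma,\delta)\to(0,\infty)}\|\varphi_{\gamma,\delta}-\varphi\|_{\alpha,2}=0.$$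
   Context: Notation: $\mathbb{R}^{d+1}_+=\mathbb{R}^d\times(0,\infty)$; $x=(x',x_{d+1})$; $-x$ denotes $(-x',x_{d+1})$ (only the first $d$ coordinates change sign). Functions are complex-valued. $L^p_\alpha(\mathbb{R}^{d+1}_+)$ is the $L^p$ space, with norm $\|\cdot\|_{\alpha,p}$, of the measure $$d\mu_\alpha(x)=\frac{x_{d+1}^{2\alpha+1}}{(2\pi)^{d/2}2^{\alpha}\Gamma(\alpha+1)}\,dx\quad\text{on }\mathbb{R}^{d+1}_+.$$ The Weinstein kernel is $\Lambda^d_\alpha(\lambda,x)=e^{-i\langle x',\lambda'\rangle}j_\alpha(x_{d+1}\lambda_{d+1})$, where $j_\alpha(t)=\Gamma(\alpha+1)\sum_{k\ge0}\frac{(-1)^k t^{2k}}{2^{2k}k!\,\Gamma(\alpha+k+1)}$ is the normalized Bessel function. The Weinstein transform is $\mathcal{F}_{W,\alpha}(\varphi)(\lambda)=\int_{\mathbb{R}^{d+1}_+}\varphi(x)\Lambda^d_\alpha(\lambda,x)\,d\mu_\alpha(x)$ for $\varphi\in L^1_\alpha(\mathbb{R}^{d+1}_+)$. It extends uniquely from $L^1_\alpha\cap L^2_\alpha$ to an isometric isomorphism of $L^2_\alpha(\mathbb{R}^{d+1}_+)$ onto itself (Plancherel theorem), still denoted $\mathcal{F}_{W,\alpha}$. Its inverse is $\mathcal{F}^{-1}_{W,\alpha}g(\lambda)=\mathcal{F}_{W,\alpha}g(-\lambda)$. Multiplier operators: for $\sigma>0$, $m_\sigma(x)=m(\sigma x)$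 and $\mathcal{T}_{w,m,\sigma}\varphi=\mathcal{F}^{-1}_{W,\alpha}\big(m_\sigma\,\mathcal{F}_{W,\alpha}(\varphi)\big)$, which is in $L^2_\alpha$ for $\varphi\in L^2_\alpha$ and $m\in L^\infty_\alpha$. Translation: for $\varphi$ continuous and even in the last variable and $x,y\in\mathbb{R}^{d+1}_+$, $$\tau^\alpha_x\varphi(y)=\frac{\Gamma(\alpha+1)}{\sqrt\pi\,\Gamma(\alpha+1/2)}\int_0^\pi\varphi\Big(x'+y',\sqrt{x_{d+1}^2+y_{d+1}^2+2x_{d+1}y_{d+1}\cos\theta}\Big)(\sin\theta)^{2\alpha}\,d\theta;$$ it extends to a contraction of $L^p_\alpha(\mathbb{R}^{d+1}_+)$, in particular of $L^2_\alpha$. Convolution: $(\varphi*_W\psi)(x)=\int_{\mathbb{R}^{d+1}_+}\tau^\alpha_x\varphi(-y)\,\psi(y)\,d\mu_\alpha(y)$, defined for every $x$ when $\varphi,\psi\in L^2_\alpha$. *)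

theory Defs
  imports "HOL-Analysis.Analysis"
begin

text \<open>
  A point of \<open>\<real>^(d+1)\<close> is a pair \<open>(x', t)\<close> of type \<^typ>\<open>(real ^ 'd) \<times> real\<close>, with
  \<open>d = CARD('d) \<ge> 1\<close>. Elements of the \<open>L^p\<close> spaces are represented by Borel functions on that type;
  only their values on the half-space matter.
\<close>

definition half_space :: "((real ^ 'd::finite) \<times> real) set" where
  "half_space = {x. snd x > 0}"

definition reflect :: "(real ^ 'd::finite) \<times> real \<Rightarrow> (real ^ 'd) \<times> real" where
  "reflect x = (- fst x, snd x)"

definition weinstein_measure :: "real \<Rightarrow> ((real ^ 'd::finite) \<times> real) measure" where
  "weinstein_measure \<alpha> =
     density (restrict_space lborel half_space)
       (\<lambda>x. ennreal (snd x powr (2 * \<alpha> + 1) /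
              ((2 * pi) powr (real CARD('d) / 2) * 2 powr \<alpha> * Gamma (\<alpha> + 1))))"

definition L2 :: "real \<Rightarrow> ((real ^ 'd::finite) \<times> real \<Rightarrow> complex) set" where
  "L2 \<alpha> = {f \<in> borel_measurable (weinstein_measure \<alpha>).
            integrable (weinstein_measure \<alpha>) (\<lambda>x. (cmod (f x))\<^sup>2)}"

definition Linf :: "real \<Rightarrow> ((real ^ 'd::finite) \<times> real \<Rightarrow> complex) set" where
  "Linf \<alpha> = {f \<in> borel_measurable (weinstein_measure \<alpha>).
              \<exists>C. AE x in weinstein_measure \<alpha>. cmod (f x) \<le> C}"

definition L2_norm :: "real \<Rightarrow> ((real ^ 'd::finite) \<times> real \<Rightarrow> complex) \<Rightarrow> real" where
  "L2_norm \<alpha> f = sqrt (LINT x|weinstein_measure \<alpha>. (cmod (f x))\<^sup>2)"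

text \<open>
  Membership in \<open>L2\<close> is part of the notion of convergence, because the Bochner integral inside
  \<open>L2_norm\<close> is 0 for functions that are not square integrable.
\<close>

definition L2_tendsto ::
  "real \<Rightarrow> (nat \<Rightarrow> (real ^ 'd::finite) \<times> real \<Rightarrow> complex) \<Rightarrow>
     ((real ^ 'd) \<times> real \<Rightarrow> complex) \<Rightarrow> bool" where
  "L2_tendsto \<alpha> s f \<longleftrightarrow>
     f \<in> L2 \<alpha> \<and> (\<forall>n. s n \<in> L2 \<alpha>) \<and> (\<lambda>n. L2_norm \<alpha> (\<lambda>x. s n x - f x)) \<longlonglongrightarrow> 0"

text \<open>
  Extension by continuity to \<open>L2\<close> of an operator \<open>T\<close> given on a dense subset \<open>D\<close>. The choice operator
  picks a representative of the limit, which for an \<open>L2\<close>-bounded linear \<open>T\<close> is unique almost everywhere.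
\<close>

definition L2_extension ::
  "real \<Rightarrow> ((real ^ 'd::finite) \<times> real \<Rightarrow> complex) set \<Rightarrow>
     (((real ^ 'd) \<times> real \<Rightarrow> complex) \<Rightarrow> (real ^ 'd) \<times> real \<Rightarrow> complex) \<Rightarrow>
     ((real ^ 'd) \<times> real \<Rightarrow> complex) \<Rightarrow> (real ^ 'd) \<times> real \<Rightarrow> complex" where
  "L2_extension \<alpha> D T f =
     (SOME g. \<exists>s. (\<forall>n. s n \<in> D) \<and> L2_tendsto \<alpha> s f \<and> L2_tendsto \<alpha> (\<lambda>n. T (s n)) g)"

definition normalized_bessel :: "real \<Rightarrow> real \<Rightarrow> real" where
  "normalized_bessel \<alpha> t =
     Gamma (\<alpha> + 1) *
       (\<Sum>k. (-1) ^ k * t ^ (2 * k) / (2 ^ (2 * k) * fact k * Gamma (\<alpha> + real k + 1)))"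

definition weinstein_kernel ::
  "real \<Rightarrow> (real ^ 'd::finite) \<times> real \<Rightarrow> (real ^ 'd) \<times> real \<Rightarrow> complex" where
  "weinstein_kernel \<alpha> \<xi> x =
     exp (- \<i> * complex_of_real (fst x \<bullet> fst \<xi>)) *
       complex_of_real (normalized_bessel \<alpha> (snd x * snd \<xi>))"

definition weinstein_L1 ::
  "real \<Rightarrow> ((real ^ 'd::finite) \<times> real \<Rightarrow> complex) \<Rightarrow> (real ^ 'd) \<times> real \<Rightarrow> complex" where
  "weinstein_L1 \<alpha> f \<xi> = (LINT x|weinstein_measure \<alpha>. f x * weinstein_kernel \<alpha> \<xi> x)"

definition weinstein ::
  "real \<Rightarrow> ((real ^ 'd::finite) \<times> real \<Rightarrow> complex) \<Rightarrow> (real ^ 'd) \<times> real \<Rightarrow> complex" where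
  "weinstein \<alpha> = L2_extension \<alpha> {f \<in> L2 \<alpha>. integrable (weinstein_measure \<alpha>) f} (weinstein_L1 \<alpha>)"

definition weinstein_inv ::
  "real \<Rightarrow> ((real ^ 'd::finite) \<times> real \<Rightarrow> complex) \<Rightarrow> (real ^ 'd) \<times> real \<Rightarrow> complex" where
  "weinstein_inv \<alpha> g \<xi> = weinstein \<alpha> g (reflect \<xi>)"

definition dilate ::
  "((real ^ 'd::finite) \<times> real \<Rightarrow> complex) \<Rightarrow> real \<Rightarrow> (real ^ 'd) \<times> real \<Rightarrow> complex" where
  "dilate m \<sigma> x = m (\<sigma> *\<^sub>R x)"

definition weinstein_multiplier ::
  "real \<Rightarrow> ((real ^ 'd::finite) \<times> real \<Rightarrow> complex) \<Rightarrow> real \<Rightarrow>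
     ((real ^ 'd) \<times> real \<Rightarrow> complex) \<Rightarrow> (real ^ 'd) \<times> real \<Rightarrow> complex" where
  "weinstein_multiplier \<alpha> m \<sigma> f = weinstein_inv \<alpha> (\<lambda>\<xi>. dilate m \<sigma> \<xi> * weinstein \<alpha> f \<xi>)"

definition translation_cont ::
  "real \<Rightarrow> (real ^ 'd::finite) \<times> real \<Rightarrow> ((real ^ 'd) \<times> real \<Rightarrow> complex) \<Rightarrow>
     (real ^ 'd) \<times> real \<Rightarrow> complex" where
  "translation_cont \<alpha> x f y =
     complex_of_real (Gamma (\<alpha> + 1) / (sqrt pi * Gamma (\<alpha> + 1 / 2))) *
       (LINT \<theta>:{0..pi}|lborel.
          f (fst x + fst y, sqrt ((snd x)\<^sup>2 + (snd y)\<^sup>2 + 2 * snd x * snd y * cos \<theta>)) *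
            complex_of_real (sin \<theta> powr (2 * \<alpha>)))"

definition translation ::
  "real \<Rightarrow> (real ^ 'd::finite) \<times> real \<Rightarrow> ((real ^ 'd) \<times> real \<Rightarrow> complex) \<Rightarrow>
     (real ^ 'd) \<times> real \<Rightarrow> complex" where
  "translation \<alpha> x =
     L2_extension \<alpha> {f \<in> L2 \<alpha>. continuous_on UNIV f \<and> (\<forall>y t. f (y, - t) = f (y, t))}
       (translation_cont \<alpha> x)"

definition weinstein_conv ::
  "real \<Rightarrow> ((real ^ 'd::finite) \<times> real \<Rightarrow> complex) \<Rightarrow>
     ((real ^ 'd) \<times> real \<Rightarrow> complex) \<Rightarrow> (real ^ 'd) \<times> real \<Rightarrow> complex" where
  "weinstein_conv \<alpha> f g x =
     (LINT y|weinstein_measure \<alpha>. translation \<alpha> x f (reflect y) * g y)"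

definition calderon_integrand ::
  "real \<Rightarrow> ((real ^ 'd::finite) \<times> real \<Rightarrow> complex) \<Rightarrow> ((real ^ 'd) \<times> real \<Rightarrow> complex) \<Rightarrow>
     (real ^ 'd) \<times> real \<Rightarrow> real \<Rightarrow> complex" where
  "calderon_integrand \<alpha> m f x \<sigma> =
     weinstein_conv \<alpha> (weinstein_multiplier \<alpha> m \<sigma> f)
       (weinstein_inv \<alpha> (\<lambda>\<xi>. cnj (dilate m \<sigma> \<xi>))) x / complex_of_real \<sigma>"

definition calderon ::
  "real \<Rightarrow> ((real ^ 'd::finite) \<times> real \<Rightarrow> complex) \<Rightarrow> ((real ^ 'd) \<times> real \<Rightarrow> complex) \<Rightarrow>
     real \<Rightarrow> real \<Rightarrow> (real ^ 'd) \<times> real \<Rightarrow> complex" where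
  "calderon \<alpha> m f \<gamma> \<delta> x = (LINT \<sigma>:{\<gamma>..\<delta>}|lborel. calderon_integrand \<alpha> m f x \<sigma>)"

end

theory Submission
  imports Defs "HOL-Probability.Characteristic_Functions"
begin

text \<open>
  The angular average defining the translation is a shift of the half plane with weight \<open>v powr (2
      * \<alpha>)\<close>
  in polar coordinates. Hence translations are symmetric for the Weinstein measure,
      and with the product
  formula for the Bessel kernel a translated Gaussian is the Weinstein transform of a Gaussian
      times a
  character. As such Gaussians are positive kernels of mass one, Schur's test
      shows that the transform is
  bounded on \<open>L2\<close>, and letting their width tend to zero gives the inversion formula. On \<open>L2\<close>,
  translation is therefore multiplication by a character on the transform side. The integrand of the
  Calderon formula at scale \<open>\<sigma>\<close> becomes the inverse transform of \<open>\<bar>m\<^sub>\<sigma>\<bar>\<^sup>2\<close> times the transform of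
      \<open>\<phi>\<close>;
  integrating over \<open>\<sigma>\<close> produces a multiplier between 0 and 1 that tends to 1 by admissibility.
\<close>

subsection \<open>One-dimensional integrals\<close>

text \<open>\<open>weinstein\<close> and \<open>translation\<close> choose representatives with
  \<open>SOME\<close>, so they are known only up to null sets, whereas the convolution is wanted at
  every point \<open>x\<close>. These demands are compatible because \<open>x\<close> enters only as
  the parameter of the translation, while the translated function is integrated over its argument.
  Every fact about the two operators is therefore an almost everywhere identity obtained by limits,
  and \<open>weinstein_conv_eq\<close> is still exact at each \<open>x\<close> of the half space.

  The half plane comes from the case where 2\<alpha> + 2 is an integer n: then
  \<open>t powr (2 * \<alpha> + 1)\<close> is the radial density of n-space, u is the coordinate
  along an axis and v the distance from it. Computing in these two coordinates keeps the identities
  for real \<alpha>.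

  Boundedness has to precede inversion: without it the choice in \<open>L2_extension\<close> would
  have no witness. It is therefore proved first on functions that are both integrable and square
  integrable, where the transform is a genuine integral.\<close>

lemma nn_integral_substitution_exhaustion:
  fixes f :: "real \<Rightarrow> ennreal" and a b :: "nat \<Rightarrow> real"
  assumes f: "f \<in> borel_measurable borel"
    and deriv: "\<And>x. x \<in> (\<Union>n. {a n..b n}) \<Longrightarrow> (g has_real_derivative g' x) (at x)"
    and cont: "\<And>n. continuous_on {a n..b n} g'"
    and nonneg: "\<And>x. x \<in> (\<Union>n. {a n..b n}) \<Longrightarrow> 0 \<le> g' x"
    and ab: "\<And>n. a n < b n" and "decseq a" "incseq b"
    and meas: "g \<in> borel_measurable borel" "g' \<in> borel_measurable borel"
  shows "(\<integral>\<^sup>+x. f x * indicator (\<Union>n. {g (a n)..g (b n)}) x \<partial>lborel) =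
         (\<integral>\<^sup>+x. f (g x) * ennreal (g' x) * indicator (\<Union>n. {a n..b n}) x \<partial>lborel)"
proof -
  have inc: "incseq (\<lambda>n. {a n..b n})"
    using \<open>decseq a\<close> \<open>incseq b\<close> by (force simp: incseq_def decseq_def intro: order_trans)
  have mono: "g x \<le> g y" if "x \<in> {a n..b n}" "y \<in> {a n..b n}" "x \<le> y" for x y n
  proof (rule DERIV_nonneg_imp_nondecreasing[OF that(3)])
    fix z assume "x \<le> z" "z \<le> y"
    then have "z \<in> {a n..b n}" using that by auto
    then have "z \<in> (\<Union>n. {a n..b n})" by blast
    then show "\<exists>d. (g has_real_derivative d) (at z) \<and> 0 \<le> d" using deriv nonneg by blast
  qed
  have inc': "incseq (\<lambda>n. {g (a n)..g (b n)})"
  proof (rule incseq_SucI)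
    fix n
    have "a (Suc n) \<le> a n" "b n \<le> b (Suc n)" "a n < b n"
      using \<open>decseq a\<close> \<open>incseq b\<close> ab by (auto simp: incseq_Suc_iff decseq_Suc_iff)
    then have "g (a (Suc n)) \<le> g (a n)" "g (b n) \<le> g (b (Suc n))"
      by (auto intro!: mono[of _ "Suc n"])
    then show "{g (a n)..g (b n)} \<subseteq> {g (a (Suc n))..g (b (Suc n))}" by auto
  qed
  have UN: "c * indicator (\<Union>n. A n) x = (SUP n. c * indicator (A n) x)"
    for c :: ennreal and A :: "nat \<Rightarrow> real set" and x
  proof (cases "\<exists>n. x \<in> A n")
    case True
    then obtain n where n: "x \<in> A n" by blast
    have "(SUP n. c * indicator (A n) x) = c"
      using n by (intro antisym SUP_least SUP_upper2[of n]) (auto simp: indicator_def)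
    then show ?thesis using True by simp
  qed simp
  have ind_mono: "(indicator A x :: ennreal) \<le> indicator B x" if "A \<subseteq> B" for A B :: "real set" and x
    using that by (auto split: split_indicator)
  \<comment> \<open>\<open>nn_integral_substitution_aux\<close> treats one compact interval.
    Monotone convergence on both sides carries it to the union, which may be open or
    unbounded.\<close>
  have "(\<integral>\<^sup>+x. f x * indicator (\<Union>n. {g (a n)..g (b n)}) x \<partial>lborel)
      = (SUP n. \<integral>\<^sup>+x. f x * indicator {g (a n)..g (b n)} x \<partial>lborel)"
    unfolding UN
    by (intro nn_integral_monotone_convergence_SUP incseq_SucI le_funI mult_left_mono ind_mono
          incseq_SucD[OF inc']) (use f in simp_all)
  also have "\<dots> = (SUP n. \<integral>\<^sup>+x. f (g x) * ennreal (g' x) * indicator {a n..b n} x \<partial>lborel)"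
  proof (intro SUP_cong refl nn_integral_substitution_aux f cont ab)
    fix n x assume "x \<in> {a n..b n}"
    then have x: "x \<in> (\<Union>n. {a n..b n})" by blast
    show "(g has_real_derivative g' x) (at x)" "0 \<le> g' x" using deriv[OF x] nonneg[OF x] .
  qed simp
  also have "\<dots> = (\<integral>\<^sup>+x. f (g x) * ennreal (g' x) * indicator (\<Union>n. {a n..b n}) x \<partial>lborel)"
    unfolding UN
    by (intro nn_integral_monotone_convergence_SUP[symmetric] incseq_SucI le_funI mult_left_mono
          ind_mono incseq_SucD[OF inc]) (use f meas in simp_all)
  finally show ?thesis .
qed

lemma UN_Icc_nat: "(\<Union>n. {0..real (Suc n)}) = {0..}"
proof -
  have "\<exists>n. x \<le> real (Suc n)" for x
    using real_arch_simple[of x] by (metis le_Suc_eq nle_le of_nat_le_iff order_trans)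
  then show ?thesis by (auto simp del: of_nat_Suc)
qed

text \<open>Along a fixed height v the points of the half plane are u = v cot \<theta>, so this is
  the angular half of polar coordinates. The cotangent decreases; the substitution is made with its
  negative after reflecting the line.\<close>

lemma nn_integral_cot:
  fixes f :: "real \<Rightarrow> ennreal"
  assumes [measurable]: "f \<in> borel_measurable borel"
  shows "(\<integral>\<^sup>+x. f x \<partial>lborel) =
         (\<integral>\<^sup>+\<theta>. f (cot \<theta>) * ennreal (1 / (sin \<theta>)\<^sup>2) * indicator {0<..<pi} \<theta> \<partial>lborel)"
proof -
  let ?a = "\<lambda>n. 1 / real (n + 2)" and ?b = "\<lambda>n. pi - 1 / real (n + 2)"
  have U: "(\<Union>n. {?a n..?b n}) = {0<..<pi}"
  proof (intro equalityI subsetI)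
    fix x assume x: "x \<in> {0<..<pi}"
    have lim: "?a \<longlonglongrightarrow> 0"
      using LIMSEQ_ignore_initial_segment[OF lim_inverse_n, of 2] by (simp add: inverse_eq_divide)
    have "eventually (\<lambda>n. ?a n < min x (pi - x)) sequentially"
      using x by (intro order_tendstoD(2)[OF lim]) auto
    then obtain n where "?a n < min x (pi - x)" by (auto simp: eventually_sequentially)
    then show "x \<in> (\<Union>n. {?a n..?b n})" by (auto intro!: exI[of _ n] less_imp_le)
  next
    fix x assume "x \<in> (\<Union>n. {?a n..?b n})"
    then obtain n where n: "?a n \<le> x" "x \<le> ?b n" by auto
    have "0 < ?a n" by simp
    with n have "0 < x \<and> x < pi" by linarith
    then show "x \<in> {0<..<pi}" by simp
  qed
  have sin_pos: "0 < sin x" if "x \<in> {0<..<pi}" for x using that by (simp add: sin_gt_zero)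
  have surj: "(\<Union>n. {- cot (?a n)..- cot (?b n)}) = UNIV"
  proof (intro equalityI subsetI UNIV_I)
    fix s :: real
    \<comment> \<open>Negative cotangent at pi/2 + arctan s is tan (arctan s) = s, so each real
      number is attained at an explicit angle of the exhausted interval.\<close>
    define \<theta> where "\<theta> = pi / 2 + arctan s"
    have \<theta>: "\<theta> \<in> {0<..<pi}"
      using arctan_bounded[of s] by (simp add: \<theta>_def field_simps)
    have s: "- cot \<theta> = s"
    proof -
      have "cos \<theta> = - sin (arctan s)" "sin \<theta> = cos (arctan s)"
        by (simp_all add: \<theta>_def cos_add sin_add)
      then have "- cot \<theta> = tan (arctan s)" by (simp add: cot_def tan_def)
      then show ?thesis by (simp add: tan_arctan)
    qed
    have "\<theta> \<in> (\<Union>n. {?a n..?b n})" unfolding U by (rule \<theta>)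
    then obtain n where n: "?a n \<le> \<theta>" "\<theta> \<le> ?b n" by auto
    have m: "- cot x \<le> - cot y" if "x \<in> {0<..<pi}" "y \<in> {0<..<pi}" "x \<le> y" for x y
    proof -
      have "sin (y - x) \<ge> 0" using that by (intro sin_ge_zero) auto
      then show ?thesis using sin_pos[OF that(1)] sin_pos[OF that(2)]
        by (simp add: cot_def field_simps sin_diff)
    qed
    have "?a n \<in> {0<..<pi}" "?b n \<in> {0<..<pi}"
      unfolding U[symmetric] using n by (auto intro!: exI[of _ n])
    then show "s \<in> (\<Union>n. {- cot (?a n)..- cot (?b n)})"
      using m[OF _ \<theta> n(1)] m[OF \<theta> _ n(2)] by (auto simp: s intro!: exI[of _ n])
  qed
  have "(\<integral>\<^sup>+x. f x \<partial>lborel) = (\<integral>\<^sup>+x. f (- x) \<partial>lborel)"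
    using nn_integral_real_affine[of f "-1" 0] by simp
  also have "\<dots> = (\<integral>\<^sup>+x. f (- x) * indicator (\<Union>n. {- cot (?a n)..- cot (?b n)}) x \<partial>lborel)"
    unfolding surj by simp
  also have "\<dots> = (\<integral>\<^sup>+\<theta>. f (- (- cot \<theta>)) * ennreal (1 / (sin \<theta>)\<^sup>2)
      * indicator (\<Union>n. {?a n..?b n}) \<theta> \<partial>lborel)"
  proof (rule nn_integral_substitution_exhaustion)
    fix x assume "x \<in> (\<Union>n. {?a n..?b n})"
    then have "x \<in> {0<..<pi}" unfolding U .
    then have "sin x \<noteq> 0" using sin_pos[of x] by simp
    then show "((\<lambda>x. - cot x) has_real_derivative 1 / (sin x)\<^sup>2) (at x)"
      using DERIV_minus[OF DERIV_cot[of x]] by (simp add: inverse_eq_divide)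
  next
    fix n
    have "sin x \<noteq> 0" if "x \<in> {?a n..?b n}" for x
    proof -
      have "x \<in> (\<Union>n. {?a n..?b n})" using that by blast
      then show ?thesis unfolding U using sin_pos[of x] by simp
    qed
    then show "continuous_on {?a n..?b n} (\<lambda>x. 1 / (sin x)\<^sup>2)"
      by (intro continuous_intros) auto
    have "?a n \<le> 1 / 2" by (simp add: field_simps)
    then show "?a n < ?b n" using pi_gt3 by linarith
  next
    show "decseq ?a" "incseq ?b"
      by (auto simp: decseq_def incseq_def field_simps)
  next
    fix x assume "x \<in> (\<Union>n. {?a n..?b n})"
    show "0 \<le> 1 / (sin x)\<^sup>2" by simp
  next
    show "(\<lambda>x::real. - cot x) \<in> borel_measurable borel" unfolding cot_def by measurable
  qed measurable
  finally show ?thesis unfolding U by simp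
qed

text \<open>Polar coordinates, by the substitutions \<open>u = v * cot \<theta>\<close> for fixed \<open>v\<close> and \<open>v = r * sin \<theta>\<close>
    for fixed \<open>\<theta>\<close>.\<close>

lemma nn_integral_half_plane_polar:
  fixes g :: "real \<times> real \<Rightarrow> ennreal"
  assumes [measurable]: "g \<in> borel_measurable borel"
  shows "(\<integral>\<^sup>+v. \<integral>\<^sup>+u. g (u, v) * indicator {0<..} v \<partial>lborel \<partial>lborel) =
         (\<integral>\<^sup>+r. \<integral>\<^sup>+\<theta>. g (r * cos \<theta>, r * sin \<theta>) * ennreal r * indicator {0<..} r
            * indicator {0<..<pi} \<theta> \<partial>lborel \<partial>lborel)"
proof -
  have "(\<integral>\<^sup>+v. \<integral>\<^sup>+u. g (u, v) * indicator {0<..} v \<partial>lborel \<partial>lborel)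
      = (\<integral>\<^sup>+v. \<integral>\<^sup>+\<theta>. (g (v * cot \<theta>, v) * ennreal (v / (sin \<theta>)\<^sup>2) * indicator {0<..} v)
           * indicator {0<..<pi} \<theta> \<partial>lborel \<partial>lborel)"
  proof (rule nn_integral_cong)
    fix v :: real
    show "(\<integral>\<^sup>+u. g (u, v) * indicator {0<..} v \<partial>lborel) =
        (\<integral>\<^sup>+\<theta>. (g (v * cot \<theta>, v) * ennreal (v / (sin \<theta>)\<^sup>2) * indicator {0<..} v)
           * indicator {0<..<pi} \<theta> \<partial>lborel)"
    proof (cases "0 < v")
      case True
      have "(\<integral>\<^sup>+u. g (u, v) \<partial>lborel) = (\<integral>\<^sup>+u. ennreal v * g (v * u, v) \<partial>lborel)"
        using nn_integral_real_affine[of "\<lambda>u. g (u, v)" v 0] True by (simp add: nn_integral_cmult)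
      also have "\<dots> = (\<integral>\<^sup>+\<theta>. ennreal v * g (v * cot \<theta>, v) * ennreal (1 / (sin \<theta>)\<^sup>2)
          * indicator {0<..<pi} \<theta> \<partial>lborel)"
        by (rule nn_integral_cot) measurable
      also have "\<dots> = (\<integral>\<^sup>+\<theta>. (g (v * cot \<theta>, v) * ennreal (v / (sin \<theta>)\<^sup>2) * indicator {0<..} v)
           * indicator {0<..<pi} \<theta> \<partial>lborel)"
      proof (rule nn_integral_cong)
        fix \<theta> :: real
        have "ennreal (v / (sin \<theta>)\<^sup>2) = ennreal v * ennreal (1 / (sin \<theta>)\<^sup>2)"
          using True by (simp add: ennreal_mult[symmetric])
        then show "ennreal v * g (v * cot \<theta>, v) * ennreal (1 / (sin \<theta>)\<^sup>2) * indicator {0<..<pi} \<theta>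
          = (g (v * cot \<theta>, v) * ennreal (v / (sin \<theta>)\<^sup>2) * indicator {0<..} v)
              * indicator {0<..<pi} \<theta>"
          using True by (simp add: mult_ac)
      qed
      finally show ?thesis using True by simp
    qed simp
  qed
  also have "\<dots> = (\<integral>\<^sup>+\<theta>. \<integral>\<^sup>+v. (g (v * cot \<theta>, v) * ennreal (v / (sin \<theta>)\<^sup>2) * indicator {0<..} v)
           * indicator {0<..<pi} \<theta> \<partial>lborel \<partial>lborel)"
    unfolding cot_def by (rule lborel_pair.Fubini') measurable
  also have "\<dots> = (\<integral>\<^sup>+\<theta>. \<integral>\<^sup>+r. g (r * cos \<theta>, r * sin \<theta>) * ennreal r * indicator {0<..} r
            * indicator {0<..<pi} \<theta> \<partial>lborel \<partial>lborel)"
  proof (rule nn_integral_cong)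
    fix \<theta> :: real
    show "(\<integral>\<^sup>+v. (g (v * cot \<theta>, v) * ennreal (v / (sin \<theta>)\<^sup>2) * indicator {0<..} v)
           * indicator {0<..<pi} \<theta> \<partial>lborel)
               = (\<integral>\<^sup>+r. g (r * cos \<theta>, r * sin \<theta>) * ennreal r * indicator {0<..} r
            * indicator {0<..<pi} \<theta> \<partial>lborel)"
    proof (cases "\<theta> \<in> {0<..<pi}")
      case True
      then have s: "0 < sin \<theta>" by (simp add: sin_gt_zero)
      have "(\<integral>\<^sup>+v. g (v * cot \<theta>, v) * ennreal (v / (sin \<theta>)\<^sup>2) * indicator {0<..} v \<partial>lborel)
          = (\<integral>\<^sup>+r. ennreal (sin \<theta>) * (g (sin \<theta> * r * cot \<theta>, sin \<theta> * r)
              * ennreal (sin \<theta> * r / (sin \<theta>)\<^sup>2) * indicator {0<..} (sin \<theta> * r)) \<partial>lborel)"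
        using nn_integral_real_affine[of "\<lambda>v. g (v * cot \<theta>, v) * ennreal (v / (sin \<theta>)\<^sup>2)
            * indicator {0<..} v" "sin \<theta>" 0] s
        by (simp add: nn_integral_cmult)
      also have "\<dots> = (\<integral>\<^sup>+r. g (r * cos \<theta>, r * sin \<theta>) * ennreal r * indicator {0<..} r \<partial>lborel)"
      proof (rule nn_integral_cong)
        fix r :: real
        have "ennreal (sin \<theta>) * (G * ennreal (sin \<theta> * r / (sin \<theta>)\<^sup>2) * 1) = G * ennreal r * 1"
          if "0 < r" for G
        proof -
          have "ennreal (sin \<theta>) * ennreal (sin \<theta> * r / (sin \<theta>)\<^sup>2) = ennreal r"
            using s that by (simp add: ennreal_mult[symmetric] power2_eq_square)
          then show ?thesis by (metis mult.commute mult.left_commute mult_1_right)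
        qed
        moreover have "sin \<theta> * r * cot \<theta> = r * cos \<theta>" using s by (simp add: cot_def)
        moreover have "sin \<theta> * r = r * sin \<theta>" by simp
        moreover have "(indicator {0<..} (sin \<theta> * r) :: ennreal) = indicator {0<..} r"
          using s by (simp add: indicator_def zero_less_mult_iff)
        ultimately show "ennreal (sin \<theta>) * (g (sin \<theta> * r * cot \<theta>, sin \<theta> * r)
              * ennreal (sin \<theta> * r / (sin \<theta>)\<^sup>2) * indicator {0<..} (sin \<theta> * r))
            = g (r * cos \<theta>, r * sin \<theta>) * ennreal r * indicator {0<..} r"
          by (cases "0
              < r") (simp_all only: greaterThan_iff indicator_simps mult_zero_right simp_thms)
      qed
      finally show ?thesis using True by simp
    qed simp
  qed
  also have "\<dots> = (\<integral>\<^sup>+r. \<integral>\<^sup>+\<theta>. g (r * cos \<theta>, r * sin \<theta>) * ennreal r * indicator {0<..} r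
            * indicator {0<..<pi} \<theta> \<partial>lborel \<partial>lborel)"
    by (rule lborel_pair.Fubini') measurable
  finally show ?thesis .
qed

text \<open>The substitution u = \<epsilon> t^2 / 2 in Euler's integral for Gamma at (s + 1) / 2. It
  is the source of the radial constants, both in the moments of the angle and in the transform of a
  Gaussian.\<close>

lemma nn_integral_powr_gaussian:
  fixes s \<epsilon> :: real
  assumes s: "-1 < s" and \<epsilon>: "0 < \<epsilon>"
  shows "(\<integral>\<^sup>+t. ennreal (t powr s * exp (- \<epsilon> * t\<^sup>2 / 2)) * indicator {0<..} t \<partial>lborel)
    = ennreal (2 powr ((s - 1) / 2) * Gamma ((s + 1) / 2) / \<epsilon> powr ((s + 1) / 2))"
proof -
  define a where "a = (s + 1) / 2"
  have a: "0 < a" using s by (simp add: a_def)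
  have "ennreal (Gamma a) = (\<integral>\<^sup>+u. ennreal (u powr (a - 1) / exp u) * indicator (\<Union>n. {\<epsilon>
      * 0\<^sup>2 / 2..\<epsilon> * (real (Suc n))\<^sup>2 / 2}) u \<partial>lborel)"
  proof -
    have "(\<Union>n. {\<epsilon> * 0\<^sup>2 / 2..\<epsilon> * (real (Suc n))\<^sup>2 / 2}) = {0..}"
    proof (intro equalityI subsetI)
      fix x :: real assume "x \<in> {0..}"
      obtain n where n: "max 1 (2 * x / \<epsilon>) \<le> real n" using real_arch_simple by blast
      have "real n * 1 \<le> real n * real n" using n by (intro mult_left_mono) auto
      moreover have "2 * x / \<epsilon> \<le> real n" using n by simp
      moreover have "real n * real n \<le> real (Suc n) * real (Suc n)" by (intro mult_mono) auto
      ultimately have "2 * x / \<epsilon> \<le> real (Suc n) * real (Suc n)" by linarith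
      then have "x \<le> \<epsilon> * (real (Suc n))\<^sup>2 / 2" using \<epsilon> by (simp add: field_simps power2_eq_square)
      then show "x \<in> (\<Union>n. {\<epsilon> * 0\<^sup>2 / 2..\<epsilon> * (real (Suc n))\<^sup>2 / 2})" using \<open>x \<in> {0..}\<close>
          by (auto simp del: of_nat_Suc)
    qed auto
    then show ?thesis
      unfolding Gamma_conv_nn_integral_real[OF a]
      by (auto intro!: nn_integral_cong split: split_indicator)
  qed
  also have "\<dots> = (\<integral>\<^sup>+t. ennreal ((\<epsilon> * t\<^sup>2 / 2) powr (a - 1) / exp (\<epsilon> * t\<^sup>2 / 2)) * ennreal (\<epsilon> * t)
      * indicator (\<Union>n. {0..real (Suc n)}) t \<partial>lborel)"
    using \<epsilon>
    by (intro nn_integral_substitution_exhaustion)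
       (auto intro!: derivative_eq_intros continuous_intros simp: UN_Icc_nat incseq_def decseq_def
           simp del: of_nat_Suc)
  also have "\<dots> = (\<integral>\<^sup>+t. ennreal (\<epsilon> powr a / 2 powr (a - 1)) *
      (ennreal (t powr s * exp (- \<epsilon> * t\<^sup>2 / 2)) * indicator {0<..} t) \<partial>lborel)"
  proof (rule nn_integral_cong)
    fix t :: real
    show "ennreal ((\<epsilon> * t\<^sup>2 / 2) powr (a - 1) / exp (\<epsilon> * t\<^sup>2 / 2)) * ennreal (\<epsilon> * t)
      * indicator (\<Union>n. {0..real (Suc n)}) t = ennreal (\<epsilon> powr a / 2 powr (a - 1)) *
      (ennreal (t powr s * exp (- \<epsilon> * t\<^sup>2 / 2)) * indicator {0<..} t)"
    proof (cases "0 < t")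
      case True
      have "(t\<^sup>2) powr (a - 1) = t powr (s - 1)"
      proof -
        have "t\<^sup>2 = t powr 2" using True by simp
        then have "(t\<^sup>2) powr (a - 1) = t powr (2 * (a - 1))" by (simp only: powr_powr)
        also have "2 * (a - 1) = s - 1" by (simp add: a_def field_simps)
        finally show ?thesis .
      qed
      then have "(\<epsilon> * t\<^sup>2 / 2) powr (a - 1) * (\<epsilon> * t) = \<epsilon> powr a / 2 powr (a - 1) * t powr s"
        using True \<epsilon> by (simp add: powr_divide powr_mult powr_diff[of \<epsilon> a 1] powr_diff[of t s 1])
      then have "(\<epsilon> * t\<^sup>2 / 2) powr (a - 1) / exp (\<epsilon> * t\<^sup>2 / 2) * (\<epsilon> * t)
          = \<epsilon> powr a / 2 powr (a - 1) * (t powr s * exp (- \<epsilon> * t\<^sup>2 / 2))"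
        by (simp add: exp_minus field_simps)
      then have "ennreal ((\<epsilon> * t\<^sup>2 / 2) powr (a - 1) / exp (\<epsilon> * t\<^sup>2 / 2)) * ennreal (\<epsilon> * t)
          = ennreal (\<epsilon> powr a / 2 powr (a - 1)) * ennreal (t powr s * exp (- \<epsilon> * t\<^sup>2 / 2))"
        using True \<epsilon> by (simp add: ennreal_mult[symmetric])
      then show ?thesis using True unfolding UN_Icc_nat by simp
    next
      case False
      then show ?thesis unfolding UN_Icc_nat by (cases "t = 0") auto
    qed
  qed
  also have "\<dots> = ennreal (\<epsilon> powr a / 2 powr (a - 1)) * (\<integral>\<^sup>+t. ennreal (t powr s * exp (- \<epsilon>
      * t\<^sup>2 / 2)) * indicator {0<..} t \<partial>lborel)"
    by (rule nn_integral_cmult) measurable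
  finally have *: "ennreal (Gamma a)
      = ennreal (\<epsilon> powr a / 2 powr (a - 1)) * (\<integral>\<^sup>+t. ennreal (t powr s * exp (- \<epsilon> * t\<^sup>2 / 2))
          * indicator {0<..} t \<partial>lborel)" .
  \<comment> \<open>The integral may still be infinite at this point; the constant is moved to the
    other side by multiplying with its finite reciprocal.\<close>
  have "ennreal (2 powr (a - 1) / \<epsilon> powr a) * ennreal (Gamma a)
    = (ennreal (2 powr (a - 1) / \<epsilon> powr a) * ennreal (\<epsilon> powr a / 2 powr (a - 1)))
       * (\<integral>\<^sup>+t. ennreal (t powr s * exp (- \<epsilon> * t\<^sup>2 / 2)) * indicator {0<..} t \<partial>lborel)"
    by (subst *) (simp only: mult.assoc)
  also have "ennreal (2 powr (a - 1) / \<epsilon> powr a) * ennreal (\<epsilon> powr a / 2 powr (a - 1)) = 1"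
    using \<epsilon> by (simp add: ennreal_mult[symmetric])
  finally have "ennreal (2 powr (a - 1) / \<epsilon> powr a) * ennreal (Gamma a) =
     (\<integral>\<^sup>+t. ennreal (t powr s * exp (- \<epsilon> * t\<^sup>2 / 2)) * indicator {0<..} t \<partial>lborel)" by simp
  moreover have "a - 1 = (s - 1) / 2" by (simp add: a_def field_simps)
  ultimately have "(\<integral>\<^sup>+t. ennreal (t powr s * exp (- \<epsilon> * t\<^sup>2 / 2)) * indicator {0<..} t \<partial>lborel)
      = ennreal (2 powr ((s - 1) / 2) / \<epsilon> powr a) * ennreal (Gamma a)" by simp
  also have "\<dots> = ennreal (2 powr ((s - 1) / 2) * Gamma a / \<epsilon> powr a)"
    using a \<epsilon> by (simp add: ennreal_mult[symmetric] Gamma_real_pos less_imp_le)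
  finally show ?thesis unfolding a_def .
qed

subsection \<open>The angular measure and the Bessel function\<close>

locale weinstein_order =
  fixes \<alpha> :: real
  assumes order_gt: "- 1 / 2 < \<alpha>"
begin

lemma Gamma_pos [simp]: "0 < Gamma (\<alpha> + 1)" "0 < Gamma (\<alpha> + 1 / 2)" "0 < Gamma (\<alpha> + real k + 1)"
  using order_gt by (auto intro!: Gamma_real_pos)

definition angle_const :: real where
  "angle_const = Gamma (\<alpha> + 1) / (sqrt pi * Gamma (\<alpha> + 1 / 2))"

text \<open>The law of the angle between a fixed axis and a uniform random point on the unit sphere
  of dimension 2\<alpha> + 1, read off for real \<alpha>. As a measure it turns the average in
  \<open>translation_cont\<close> into an expectation.\<close>

definition angle_measure :: "real measure" where
  "angle_measure = density lborel
     (\<lambda>\<theta>. ennreal (indicator {0..pi} \<theta> * angle_const * sin \<theta> powr (2 * \<alpha>)))"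

lemma angle_const_pos: "0 < angle_const"
  by (simp add: angle_const_def)

lemma sets_angle_measure [simp, measurable_cong]: "sets angle_measure = sets borel"
  and space_angle_measure [simp]: "space angle_measure = UNIV"
  by (simp_all add: angle_measure_def)

lemma nn_integral_angle:
  assumes [measurable]: "f \<in> borel_measurable borel"
  shows "(\<integral>\<^sup>+\<theta>. f \<theta> \<partial>angle_measure) =
    ennreal angle_const * (\<integral>\<^sup>+\<theta>. f \<theta> * ennreal (sin \<theta> powr (2 * \<alpha>))
        * indicator {0<..<pi} \<theta> \<partial>lborel)"
proof -
  have "(\<integral>\<^sup>+\<theta>. f \<theta> \<partial>angle_measure) =
     (\<integral>\<^sup>+\<theta>. ennreal (indicator {0..pi} \<theta> * angle_const * sin \<theta> powr (2 * \<alpha>)) * f \<theta> \<partial>lborel)"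
    unfolding angle_measure_def by (intro nn_integral_density) measurable
  also have "\<dots> = (\<integral>\<^sup>+\<theta>. ennreal angle_const * (f \<theta> * ennreal (sin \<theta> powr (2 * \<alpha>))
      * indicator {0<..<pi} \<theta>) \<partial>lborel)"
  proof (rule nn_integral_cong)
    fix \<theta> :: real
    \<comment> \<open>At both end points the sine vanishes and \<open>0 powr p\<close> is 0, so the
      closed interval of the definition and the open interval of the polar coordinates carry the
      same integral.\<close>
    consider "\<theta> = 0" | "\<theta> = pi" | "\<theta> \<in> {0<..<pi}" | "\<theta> \<notin> {0..pi}" by fastforce
    then show "ennreal (indicator {0..pi} \<theta> * angle_const * sin \<theta> powr (2 * \<alpha>)) * f \<theta> =
       ennreal angle_const * (f \<theta> * ennreal (sin \<theta> powr (2 * \<alpha>)) * indicator {0<..<pi} \<theta>)"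
      by cases (use angle_const_pos in \<open>auto simp: ennreal_mult mult_ac\<close>)
  qed
  also have "\<dots> = ennreal angle_const * (\<integral>\<^sup>+\<theta>. f \<theta> * ennreal (sin \<theta> powr (2 * \<alpha>))
      * indicator {0<..<pi} \<theta> \<partial>lborel)"
    by (rule nn_integral_cmult) measurable
  finally show ?thesis .
qed

text \<open>The function u^(2p) v^(2\<alpha>) exp (-(u^2 + v^2) / 2) is integrated over the half
  plane in two ways. In cartesian coordinates this gives a normal moment \<open>?B\<close> times a
  Gamma integral \<open>?A\<close>, in polar coordinates the wanted moment times the radial integral
  \<open>?C\<close>. The case p = 0 says that the angle has total mass one.\<close>

lemma nn_integral_angle_even_moment:
  "(\<integral>\<^sup>+\<theta>. ennreal (cos \<theta> ^ (2 * p)) \<partial>angle_measure) =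
     ennreal (fact (2 * p) * Gamma (\<alpha> + 1) / (4 ^ p * fact p * Gamma (\<alpha> + real p + 1)))"
proof -
  define I where "I = (\<integral>\<^sup>+\<theta>. ennreal (cos \<theta> ^ (2 * p)) * ennreal (sin \<theta> powr (2 * \<alpha>))
      * indicator {0<..<pi} \<theta> \<partial>lborel)"
  let ?g = "\<lambda>(u, v). ennreal (u ^ (2 * p) * exp (- u\<^sup>2 / 2)) * ennreal (v powr (2 * \<alpha>) * exp (- 1
      * v\<^sup>2 / 2))"
  let ?A = "2 powr (\<alpha> - 1 / 2) * Gamma (\<alpha> + 1 / 2)"
  let ?B = "sqrt (2 * pi) * (fact (2 * p) / (2 ^ p * fact p))"
  let ?C = "2 powr (real p + \<alpha>) * Gamma (\<alpha> + real p + 1)"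
  have normal: "(\<integral>\<^sup>+u. ennreal (u ^ (2 * p) * exp (- u\<^sup>2 / 2)) \<partial>lborel) = ennreal ?B"
  proof -
    have "has_bochner_integral lborel (\<lambda>x. sqrt (2 * pi) * (std_normal_density x * x ^ (2 * p))) ?B"
      by (intro has_bochner_integral_mult_right std_normal_moment_even)
    moreover have "sqrt (2 * pi) * (std_normal_density x * x ^ (2 * p))
        = x ^ (2 * p) * exp (- x\<^sup>2 / 2)" for x :: real
      by (simp add: normal_density_def)
    ultimately have "has_bochner_integral lborel (\<lambda>x. x ^ (2 * p) * exp (- x\<^sup>2 / 2)) ?B" by simp
    then show ?thesis
      by (subst nn_integral_eq_integral) (auto simp: has_bochner_integral_iff)
  qed
  have "(\<integral>\<^sup>+v. \<integral>\<^sup>+u. ?g (u, v) * indicator {0<..} v \<partial>lborel \<partial>lborel)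
     = (\<integral>\<^sup>+v. ennreal ?B * (ennreal (v powr (2 * \<alpha>) * exp (- 1 * v\<^sup>2 / 2))
         * indicator {0<..} v) \<partial>lborel)"
  proof (rule nn_integral_cong)
    fix v :: real
    have "(\<integral>\<^sup>+u. ?g (u, v) * indicator {0<..} v \<partial>lborel) =
      (\<integral>\<^sup>+u. ennreal (u ^ (2 * p) * exp (- u\<^sup>2 / 2)) * (ennreal (v powr (2 * \<alpha>) * exp (- 1
          * v\<^sup>2 / 2)) * indicator {0<..} v) \<partial>lborel)"
      by (simp add: mult.assoc)
    also have "\<dots> = (\<integral>\<^sup>+u. ennreal (u ^ (2 * p) * exp (- u\<^sup>2 / 2)) \<partial>lborel) * (ennreal (v powr (2
        * \<alpha>) * exp (- 1 * v\<^sup>2 / 2)) * indicator {0<..} v)"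
      by (rule nn_integral_multc) measurable
    finally show "(\<integral>\<^sup>+u. ?g (u, v) * indicator {0<..} v \<partial>lborel) =
      ennreal ?B * (ennreal (v powr (2 * \<alpha>) * exp (- 1 * v\<^sup>2 / 2)) * indicator {0<..} v)"
          unfolding normal .
  qed
  also have "\<dots> = ennreal ?B * (\<integral>\<^sup>+v. ennreal (v powr (2 * \<alpha>) * exp (- 1 * v\<^sup>2 / 2))
      * indicator {0<..} v \<partial>lborel)"
    by (rule nn_integral_cmult) measurable
  also have "\<dots> = ennreal ?B * ennreal ?A"
    using order_gt by (subst nn_integral_powr_gaussian) (auto simp: field_simps)
  finally have lhs: "(\<integral>\<^sup>+v. \<integral>\<^sup>+u. ?g (u, v) * indicator {0<..} v \<partial>lborel \<partial>lborel)
      = ennreal ?B * ennreal ?A" .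
  have "(\<integral>\<^sup>+r. \<integral>\<^sup>+\<theta>. ?g (r * cos \<theta>, r * sin \<theta>) * ennreal r * indicator {0<..} r
            * indicator {0<..<pi} \<theta> \<partial>lborel \<partial>lborel)
     = (\<integral>\<^sup>+r. I * (ennreal (r powr (2 * real p + 2 * \<alpha> + 1) * exp (- 1 * r\<^sup>2 / 2))
         * indicator {0<..} r) \<partial>lborel)"
  proof (rule nn_integral_cong)
    fix r :: real
    let ?R = "ennreal (r powr (2 * real p + 2 * \<alpha> + 1) * exp (- 1 * r\<^sup>2 / 2)) * indicator {0<..} r"
    have "(\<integral>\<^sup>+\<theta>. ?g (r * cos \<theta>, r * sin \<theta>) * ennreal r * indicator {0<..} r
        * indicator {0<..<pi} \<theta> \<partial>lborel)
      = (\<integral>\<^sup>+\<theta>. (ennreal (cos \<theta> ^ (2 * p)) * ennreal (sin \<theta> powr (2 * \<alpha>)) * indicator {0<..<pi} \<theta>)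
          * ?R \<partial>lborel)"
    proof (rule nn_integral_cong)
      fix \<theta> :: real
      show "?g (r * cos \<theta>, r * sin \<theta>) * ennreal r * indicator {0<..} r * indicator {0<..<pi} \<theta> =
        (ennreal (cos \<theta> ^ (2 * p)) * ennreal (sin \<theta> powr (2 * \<alpha>)) * indicator {0<..<pi} \<theta>) * ?R"
      proof (cases "0 < r \<and> \<theta> \<in> {0<..<pi}")
        case True
        then have s: "0 < sin \<theta>" by (simp add: sin_gt_zero)
        have e: "exp (- (r * cos \<theta>)\<^sup>2 / 2) * exp (- 1 * (r * sin \<theta>)\<^sup>2 / 2) = exp (- 1 * r\<^sup>2 / 2)"
        proof -
          have "r\<^sup>2 * (cos \<theta>)\<^sup>2 + r\<^sup>2 * (sin \<theta>)\<^sup>2 = r\<^sup>2"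
            by (simp flip: distrib_left)
          then have "- (r * cos \<theta>)\<^sup>2 / 2 + - 1 * (r * sin \<theta>)\<^sup>2 / 2 = - 1 * r\<^sup>2 / 2"
            by (simp add: power_mult_distrib)
          then show ?thesis by (simp only: exp_add[symmetric])
        qed
        have r: "r ^ (2 * p) * r powr (2 * \<alpha>) * r = r powr (2 * real p + 2 * \<alpha> + 1)"
          using True by (simp add: powr_add powr_realpow[symmetric])
        have "(r * cos \<theta>) ^ (2 * p) * exp (- (r * cos \<theta>)\<^sup>2 / 2) *
           ((r * sin \<theta>) powr (2 * \<alpha>) * exp (- 1 * (r * sin \<theta>)\<^sup>2 / 2)) * r
          = cos \<theta> ^ (2 * p) * sin \<theta> powr (2 * \<alpha>) * ((r ^ (2 * p) * r powr (2 * \<alpha>) * r)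
             * (exp (- (r * cos \<theta>)\<^sup>2 / 2) * exp (- 1 * (r * sin \<theta>)\<^sup>2 / 2)))"
          using True s by (simp add: power_mult_distrib powr_mult)
        also have "\<dots> = cos \<theta> ^ (2 * p) * sin \<theta> powr (2 * \<alpha>) * (r powr (2 * real p + 2 * \<alpha> + 1)
            * exp (- 1 * r\<^sup>2 / 2))"
          unfolding e r ..
        finally show ?thesis using True
          by (simp add: ennreal_mult[symmetric])
      qed auto
    qed
    also have "\<dots> = I * ?R" unfolding I_def by (rule nn_integral_multc) measurable
    finally show "(\<integral>\<^sup>+\<theta>. ?g (r * cos \<theta>, r * sin \<theta>) * ennreal r * indicator {0<..} r
        * indicator {0<..<pi} \<theta> \<partial>lborel) = I * ?R" .
  qed
  also have "\<dots> = I * (\<integral>\<^sup>+r. ennreal (r powr (2 * real p + 2 * \<alpha> + 1) * exp (- 1 * r\<^sup>2 / 2))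
      * indicator {0<..} r \<partial>lborel)"
    by (rule nn_integral_cmult) measurable
  also have "\<dots> = I * ennreal ?C"
  proof -
    have "(2 * real p + 2 * \<alpha> + 1 - 1) / 2 = real p + \<alpha>" "(2 * real p + 2 * \<alpha> + 1 + 1) / 2
        = \<alpha> + real p + 1"
      by (simp_all add: field_simps)
    moreover have "- 1 < 2 * real p + 2 * \<alpha> + 1" using order_gt by (simp add: field_simps)
    ultimately show ?thesis using nn_integral_powr_gaussian[of "2 * real p + 2 * \<alpha> + 1" 1]
        by (simp only:) simp
  qed
  finally have "ennreal ?B * ennreal ?A = I * ennreal ?C"
  proof -
    have "?g \<in> borel_measurable borel" unfolding borel_prod[symmetric] by measurable
    from nn_integral_half_plane_polar[OF this] lhs show "ennreal ?B * ennreal ?A = I * ennreal ?C"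
      if "(\<integral>\<^sup>+r. \<integral>\<^sup>+\<theta>. ?g (r * cos \<theta>, r * sin \<theta>) * ennreal r * indicator {0<..} r
            * indicator {0<..<pi} \<theta> \<partial>lborel \<partial>lborel) = I * ennreal ?C"
      using that by simp
  qed
  then have "I * (ennreal ?C * ennreal (1 / ?C)) = ennreal ?B * ennreal ?A * ennreal (1 / ?C)"
    by (simp add: mult.assoc)
  also have "ennreal ?C * ennreal (1 / ?C) = 1"
    using Gamma_pos(3)[of p]
        by (subst ennreal_mult[symmetric]) (auto simp: less_imp_le less_imp_neq[symmetric])
  finally have I: "I * 1 = ennreal ?B * ennreal ?A * ennreal (1 / ?C)" .
  have "0 \<le> ?B" "0 \<le> ?A" "0 \<le> 1 / ?C"
    using Gamma_pos(2) Gamma_pos(3)[of p] by (simp_all add: less_imp_le)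
  then have "ennreal ?B * ennreal ?A * ennreal (1 / ?C) = ennreal (?B * ?A * (1 / ?C))"
    by (simp only: ennreal_mult mult_nonneg_nonneg)
  with I have I: "I = ennreal (?B * ?A * (1 / ?C))" by (simp only: mult_1_right)
  have "(\<integral>\<^sup>+\<theta>. ennreal (cos \<theta> ^ (2 * p)) \<partial>angle_measure) = ennreal angle_const * I"
    unfolding I_def by (rule nn_integral_angle) measurable
  also have "\<dots> = ennreal (angle_const * (?B * ?A * (1 / ?C)))"
    unfolding I using angle_const_pos by (intro ennreal_mult'[symmetric]) simp
  also have "angle_const * (?B * ?A * (1 / ?C))
      = fact (2 * p) * Gamma (\<alpha> + 1) / (4 ^ p * fact p * Gamma (\<alpha> + real p + 1))"
  proof -
    have 1: "2 powr (\<alpha> - 1 / 2) = 2 powr \<alpha> / sqrt 2" by (simp add: powr_diff powr_half_sqrt)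
    have 2: "2 powr (real p + \<alpha>) = 2 ^ p * 2 powr \<alpha>" by (simp add: powr_add powr_realpow)
    have 3: "(4::real) ^ p = 2 ^ p * 2 ^ p" by (simp add: power_mult_distrib[symmetric])
    show ?thesis unfolding angle_const_def 1 2 3 real_sqrt_mult
      using Gamma_pos(2) Gamma_pos(3)[of p] by (simp add: field_simps)
  qed
  finally show ?thesis .
qed

sublocale angle: prob_space angle_measure
proof
  show "emeasure angle_measure (space angle_measure) = 1"
    using nn_integral_angle_even_moment[of 0] Gamma_pos(1) by (simp add: less_imp_neq[symmetric])
qed

lemma integral_angle:
  fixes f :: "real \<Rightarrow> complex"
  assumes [measurable]: "f \<in> borel_measurable borel"
  shows "(LINT \<theta>|angle_measure. f \<theta>) =
    complex_of_real angle_const * (LINT \<theta>:{0..pi}|lborel. f \<theta> * complex_of_real (sin \<theta> powr (2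
        * \<alpha>)))"
proof -
  have "(LINT \<theta>|angle_measure. f \<theta>) =
     (LINT \<theta>|lborel. (indicator {0..pi} \<theta> * angle_const * sin \<theta> powr (2 * \<alpha>)) *\<^sub>R f \<theta>)"
    unfolding angle_measure_def using angle_const_pos by (intro integral_density) auto
  also have "\<dots> = (LINT \<theta>|lborel. complex_of_real angle_const * (indicator {0..pi} \<theta> *\<^sub>R (f \<theta>
      * complex_of_real (sin \<theta> powr (2 * \<alpha>)))))"
    by (intro Bochner_Integration.integral_cong refl) (simp add: scaleR_conv_of_real mult_ac)
  also have "\<dots> = complex_of_real angle_const * (LINT \<theta>|lborel. indicator {0..pi} \<theta> *\<^sub>R (f \<theta>
      * complex_of_real (sin \<theta> powr (2 * \<alpha>))))"
    by (rule integral_mult_right_zero)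
  finally show ?thesis by (simp only: set_lebesgue_integral_def)
qed

text \<open>The sine is even about pi/2 and the cosine odd, so this symmetry of the weight is what
  removes the odd moments of the cosine.\<close>

lemma nn_integral_angle_reflect:
  assumes [measurable]: "f \<in> borel_measurable borel"
  shows "(\<integral>\<^sup>+\<theta>. f (pi - \<theta>) \<partial>angle_measure) = (\<integral>\<^sup>+\<theta>. f \<theta> \<partial>angle_measure)"
proof -
  have "(\<integral>\<^sup>+\<theta>. f \<theta> * ennreal (sin \<theta> powr (2 * \<alpha>)) * indicator {0<..<pi} \<theta> \<partial>lborel) =
    (\<integral>\<^sup>+\<theta>. f (pi + (-1) * \<theta>) * ennreal (sin (pi + (-1) * \<theta>) powr (2 * \<alpha>)) * indicator {0<..<pi}
        (pi + (-1) * \<theta>) \<partial>lborel)"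
    by (subst nn_integral_real_affine[where c = "-1" and t = pi]) auto
  also have "\<dots> = (\<integral>\<^sup>+\<theta>. f (pi - \<theta>) * ennreal (sin \<theta> powr (2 * \<alpha>)) * indicator {0<..<pi} \<theta> \<partial>lborel)"
    by (intro nn_integral_cong) (auto simp: indicator_def)
  finally show ?thesis by (simp add: nn_integral_angle)
qed

lemma distr_angle_reflect: "distr angle_measure borel (\<lambda>\<theta>. pi - \<theta>) = angle_measure"
proof (rule measure_eqI)
  fix A assume "A \<in> sets (distr angle_measure borel (\<lambda>\<theta>. pi - \<theta>))"
  then have [measurable]: "A \<in> sets borel" by simp
  have "emeasure (distr angle_measure borel (\<lambda>\<theta>. pi - \<theta>)) A
      = (\<integral>\<^sup>+\<theta>. indicator A \<theta> \<partial>distr angle_measure borel (\<lambda>\<theta>. pi - \<theta>))"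
    by simp
  also have "\<dots> = (\<integral>\<^sup>+\<theta>. indicator A (pi - \<theta>) \<partial>angle_measure)"
    by (rule nn_integral_distr) measurable
  also have "\<dots> = emeasure angle_measure A"
    by (subst nn_integral_angle_reflect) auto
  finally show "emeasure (distr angle_measure borel (\<lambda>\<theta>. pi - \<theta>)) A = emeasure angle_measure A" .
qed simp

lemma angle_integrable_bounded:
  fixes f :: "real \<Rightarrow> 'b::{banach, second_countable_topology}"
  assumes "f \<in> borel_measurable borel" "\<And>\<theta>. norm (f \<theta>) \<le> B"
  shows "integrable angle_measure f"
  by (rule angle.integrable_const_bound[of _ B]) (use assms in auto)

lemma angle_even_moment:
  "(LINT \<theta>|angle_measure. cos \<theta> ^ (2 * p)) =
     fact (2 * p) * Gamma (\<alpha> + 1) / (4 ^ p * fact p * Gamma (\<alpha> + real p + 1))"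
  using nn_integral_angle_even_moment[of p] Gamma_pos
  by (subst integral_eq_nn_integral) (auto simp: less_imp_le)

lemma angle_odd_moment:
  assumes "odd l"
  shows "(LINT \<theta>|angle_measure. cos \<theta> ^ l) = 0"
proof -
  have "(LINT \<theta>|angle_measure. cos \<theta> ^ l)
      = (LINT \<theta>|distr angle_measure borel (\<lambda>\<theta>. pi - \<theta>). cos \<theta> ^ l)"
    by (simp only: distr_angle_reflect)
  also have "\<dots> = (LINT \<theta>|angle_measure. cos (pi - \<theta>) ^ l)"
    by (rule integral_distr) measurable
  also have "\<dots> = - (LINT \<theta>|angle_measure. cos \<theta> ^ l)"
    using assms by (simp add: power_minus_odd)
  finally show ?thesis by simp
qed

section \<open>The power series of the Bessel function and Poisson's integral\<close>

definition bessel_coeff :: "nat \<Rightarrow> real" where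
  "bessel_coeff k = (- 1) ^ k * Gamma (\<alpha> + 1) / (4 ^ k * fact k * Gamma (\<alpha> + real k + 1))"

text \<open>The cosine series, read as a power series in t^2, converges at (|t| + 1)^2 and hence
  absolutely at t^2. This series dominates the Bessel series and the interchanges of sum and angular
  integral.\<close>

lemma summable_abs_cos_series: "summable (\<lambda>k. \<bar>t\<bar> ^ (2 * k) / fact (2 * k))" for t :: real
proof -
  have "summable (\<lambda>k. (- 1) ^ k / fact (2 * k) * ((\<bar>t\<bar> + 1)\<^sup>2) ^ k :: real)"
    using cos_paired[of "\<bar>t\<bar> + 1"] by (simp add: sums_iff power_mult)
  then have "summable (\<lambda>k. norm ((- 1) ^ k / fact (2 * k) * (t\<^sup>2) ^ k :: real))"
  proof (rule powser_insidea)
    have "\<bar>t\<bar>\<^sup>2 < (\<bar>t\<bar> + 1)\<^sup>2" by (intro power_strict_mono) auto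
    then show "norm (t\<^sup>2) < norm ((\<bar>t\<bar> + 1)\<^sup>2)" by simp
  qed
  then show ?thesis by (simp add: power_mult norm_mult norm_power power_abs abs_mult)
qed

text \<open>The factorial of 2k in the even moment cancels the denominator of the cosine series.
  This is Poisson's integral on the level of coefficients.\<close>

lemma bessel_coeff_conv_moment:
  "(- 1) ^ k / fact (2 * k) * (LINT \<theta>|angle_measure. cos \<theta> ^ (2 * k)) = bessel_coeff k"
  unfolding angle_even_moment bessel_coeff_def by (simp add: field_simps)

lemma abs_bessel_coeff_le: "\<bar>bessel_coeff k\<bar> \<le> 1 / fact (2 * k)"
proof -
  have "\<bar>LINT \<theta>|angle_measure. cos \<theta> ^ (2 * k)\<bar> \<le> (LINT \<theta>|angle_measure. 1)"
    by (rule order_trans[OF integral_abs_bound], rule integral_mono)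
       (auto simp: power_abs intro!: power_le_one angle_integrable_bounded[of _ 1])
  also have "\<dots> = 1" using angle.prob_space by simp
  finally have "\<bar>LINT \<theta>|angle_measure. cos \<theta> ^ (2 * k)\<bar> \<le> 1" .
  then show ?thesis
    unfolding bessel_coeff_conv_moment[symmetric] abs_mult by (simp add: divide_simps)
qed

lemma summable_abs_bessel_series: "summable (\<lambda>k. \<bar>bessel_coeff k * t ^ (2 * k)\<bar>)"
proof (rule summable_comparison_test'[OF summable_abs_cos_series[of t]])
  fix k
  show "norm \<bar>bessel_coeff k * t ^ (2 * k)\<bar> \<le> \<bar>t\<bar> ^ (2 * k) / fact (2 * k)"
    using mult_right_mono[OF abs_bessel_coeff_le[of k], of "\<bar>t\<bar> ^ (2 * k)"]
    by (simp add: abs_mult power_abs)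
qed

text \<open>The cosine series of cos (t cos \<theta>) is integrated term by term; since |cos
  \<theta>| is at most 1 and the angle has mass one, the series of
  \<open>summable_abs_cos_series\<close> dominates.\<close>

lemma bessel_sums_angle:
  "(\<lambda>k. bessel_coeff k * t ^ (2 * k)) sums (LINT \<theta>|angle_measure. cos (t * cos \<theta>))"
proof -
  let ?f = "\<lambda>k \<theta>. (- 1) ^ k / fact (2 * k) * (t * cos \<theta>) ^ (2 * k) :: real"
  have int: "integrable angle_measure (?f k)" for k
    by (rule angle_integrable_bounded[of _ "\<bar>t\<bar> ^ (2 * k) / fact (2 * k)"])
       (auto simp: abs_mult power_abs power_mult_distrib divide_simps intro!: mult_left_le
           power_le_one)
  have le: "norm (?f k \<theta>) \<le> \<bar>t\<bar> ^ (2 * k) / fact (2 * k)" for k \<theta>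
    by (auto simp: abs_mult power_abs power_mult_distrib divide_simps intro!: mult_left_le
        power_le_one)
  have "(\<lambda>k. integral\<^sup>L angle_measure (?f k)) sums (LINT \<theta>|angle_measure. (\<Sum>k. ?f k \<theta>))"
  proof (rule sums_integral[OF int])
    show "AE \<theta> in angle_measure. summable (\<lambda>k. norm (?f k \<theta>))"
      using le by (intro AE_I2 summable_comparison_test'[OF summable_abs_cos_series[of t]]) auto
    show "summable (\<lambda>k. LINT \<theta>|angle_measure. norm (?f k \<theta>))"
    proof (rule summable_comparison_test'[OF summable_abs_cos_series[of t]])
      fix k
      have "(LINT \<theta>|angle_measure. norm (?f k \<theta>))
          \<le> (LINT \<theta>|angle_measure. \<bar>t\<bar> ^ (2 * k) / fact (2 * k))"
        by (intro integral_mono le integrable_norm int integrable_const)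
            (simp_all add: angle.emeasure_space_1)
      also have "\<dots> = \<bar>t\<bar> ^ (2 * k) / fact (2 * k)" using angle.prob_space by simp
      finally show "norm (LINT \<theta>|angle_measure. norm (?f k \<theta>)) \<le> \<bar>t\<bar> ^ (2 * k) / fact (2 * k)"
          by simp
    qed
  qed
  moreover have "(\<Sum>k. ?f k \<theta>) = cos (t * cos \<theta>)" for \<theta>
    using cos_paired[of "t * cos \<theta>"] by (simp add: sums_iff)
  moreover have "integral\<^sup>L angle_measure (?f k) = bessel_coeff k * t ^ (2 * k)" for k
  proof -
    have "integral\<^sup>L angle_measure (?f k)
        = (LINT \<theta>|angle_measure. ((- 1) ^ k / fact (2 * k) * t ^ (2 * k)) * cos \<theta> ^ (2 * k))"
      by (intro Bochner_Integration.integral_cong) (simp_all add: power_mult_distrib)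
    also have "\<dots> = ((- 1) ^ k / fact (2 * k) * (LINT \<theta>|angle_measure. cos \<theta> ^ (2 * k))) * t ^ (2
        * k)"
      by simp
    finally show ?thesis unfolding bessel_coeff_conv_moment .
  qed
  ultimately show ?thesis by simp
qed

text \<open>Moving \<open>Gamma (\<alpha> + 1)\<close> under the infinite sum requires summability,
  since \<open>suminf\<close> has no meaning otherwise. It is supplied by the convergence just shown
  against the angular integral.\<close>

lemma normalized_bessel_suminf: "normalized_bessel \<alpha> t = (\<Sum>k. bessel_coeff k * t ^ (2 * k))"
proof -
  let ?f = "\<lambda>k. (- 1) ^ k * t ^ (2 * k) / (2 ^ (2 * k) * fact k * Gamma (\<alpha> + real k + 1))"
  have eq: "bessel_coeff k * t ^ (2 * k) = Gamma (\<alpha> + 1) * ?f k" for k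
    by (simp add: bessel_coeff_def power_mult)
  have "summable (\<lambda>k. Gamma (\<alpha> + 1) * ?f k)"
    using bessel_sums_angle[of t] unfolding eq by (simp add: sums_iff)
  then have "summable ?f" using Gamma_pos(1) by (subst (asm) summable_cmult_iff) auto
  then show ?thesis unfolding normalized_bessel_def eq by (rule suminf_mult[symmetric])
qed

text \<open>Poisson's integral. The bound 1, the evenness and the continuity of the Bessel function
  are read off from it, none of them being visible on the series.\<close>

lemma normalized_bessel_eq: "normalized_bessel \<alpha> t = (LINT \<theta>|angle_measure. cos (t * cos \<theta>))"
  using bessel_sums_angle[of t] by (simp add: normalized_bessel_suminf sums_iff)

lemma bessel_sums: "(\<lambda>k. bessel_coeff k * t ^ (2 * k)) sums normalized_bessel \<alpha> t"
  using bessel_sums_angle[of t] by (simp add: normalized_bessel_eq)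

lemma abs_normalized_bessel_le: "\<bar>normalized_bessel \<alpha> t\<bar> \<le> 1"
proof -
  have "\<bar>normalized_bessel \<alpha> t\<bar> \<le> (LINT \<theta>|angle_measure. 1)"
    unfolding normalized_bessel_eq
    by (rule order_trans[OF integral_abs_bound], rule integral_mono)
       (auto intro!: angle_integrable_bounded[of _ 1])
  then show ?thesis using angle.prob_space by simp
qed

lemma normalized_bessel_minus [simp]: "normalized_bessel \<alpha> (- t) = normalized_bessel \<alpha> t"
  by (simp add: normalized_bessel_eq)

lemma isCont_normalized_bessel: "isCont (normalized_bessel \<alpha>) t"
proof -
  have "(\<lambda>n. LINT \<theta>|angle_measure. cos (s n * cos \<theta>)) \<longlonglongrightarrow> (LINT \<theta>|angle_measure. cos (t * cos \<theta>))"
    if "s \<longlonglongrightarrow> t" for s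
    by (rule integral_dominated_convergence[where w = "\<lambda>_. 1"]) (auto intro!: tendsto_intros that)
  then show ?thesis
    by (auto simp: continuous_at_sequentially comp_def normalized_bessel_eq)
qed

lemma continuous_on_normalized_bessel [continuous_intros]:
  "continuous_on A f \<Longrightarrow> continuous_on A (\<lambda>x. normalized_bessel \<alpha> (f x))"
  using continuous_on_compose2[of UNIV "normalized_bessel \<alpha>" A f]
  by (auto intro: continuous_at_imp_continuous_on isCont_normalized_bessel)

lemma borel_measurable_normalized_bessel [measurable]: "normalized_bessel \<alpha> \<in> borel_measurable
    borel"
  by (intro borel_measurable_continuous_onI continuous_intros)

section \<open>The product formula for the Bessel function\<close>

lemma Gamma_ratio_convolution:
  "(\<Sum>p\<in>{0..min i j}. 1 / (fact (i - p) * fact (j - p) * fact p * Gamma (\<alpha> + real p + 1))) =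
     Gamma (\<alpha> + real (i + j) + 1) / (fact i * fact j * Gamma (\<alpha> + real i + 1) * Gamma (\<alpha> + real j
         + 1))"
proof -
  have nonpos: "\<alpha> + real k + 1 \<notin> \<int>\<^sub>\<le>\<^sub>0" for k
    using order_gt by (auto elim!: nonpos_Ints_cases)
  let ?G = "\<lambda>k::nat. Gamma (\<alpha> + real k + 1)"
  \<comment> \<open>Chu-Vandermonde with one real upper index. Written with Gamma functions, its
    terms are those of the claim up to the factor
    \<open>fact i * Gamma (\<alpha> + real j + 1)\<close>; the terms with p > i vanish.\<close>
  have "(\<Sum>p\<in>{0..j}. (real i gchoose p) * ((\<alpha> + real j) gchoose (j - p)))
      = (real i + (\<alpha> + real j)) gchoose j"
    by (rule gbinomial_Vandermonde)
  also have "\<dots> = ?G (i + j) / (fact j * ?G i)"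
    using gbinomial_Gamma[of "\<alpha> + real (i + j)" j] nonpos[of "i + j"] by (simp add: algebra_simps)
  also have "(\<Sum>p\<in>{0..j}. (real i gchoose p) * ((\<alpha> + real j) gchoose (j - p)))
      = (\<Sum>p\<in>{0..min i j}. (real i gchoose p) * ((\<alpha> + real j) gchoose (j - p)))"
    by (rule sum.mono_neutral_right) (auto simp: binomial_gbinomial[symmetric])
  also have "\<dots> = (\<Sum>p\<in>{0..min i j}. (fact i * ?G j) * (1 / (fact (i - p) * fact (j - p) * fact p
      * ?G p)))"
  proof (rule sum.cong[OF refl])
    fix p assume p: "p \<in> {0..min i j}"
    have 1: "(real i gchoose p) = fact i / (fact p * fact (i - p))"
      using p by (simp add: binomial_gbinomial[symmetric] binomial_fact)
    have 2: "((\<alpha> + real j) gchoose (j - p)) = ?G j / (fact (j - p) * ?G p)"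
      using gbinomial_Gamma[of "\<alpha> + real j" "j - p"] nonpos[of j] p
          by (simp add: of_nat_diff algebra_simps)
    show "(real i gchoose p) * ((\<alpha> + real j) gchoose (j - p)) =
        (fact i * ?G j) * (1 / (fact (i - p) * fact (j - p) * fact p * ?G p))"
      unfolding 1 2 by simp
  qed
  also have "\<dots> = (fact i * ?G j) * (\<Sum>p\<in>{0..min i j}. 1 / (fact (i - p) * fact (j - p) * fact p
      * ?G p))"
    by (rule sum_distrib_left[symmetric])
  finally show ?thesis
    using Gamma_pos(3)[of i] Gamma_pos(3)[of j] by (simp add: field_simps)
qed

text \<open>The part of degree 2k of the product formula, whose right side is a term of the Cauchy
  product of two Bessel series. Expanding in powers of the cosine leaves only even moments;
  collecting the coefficient of x^(2i) y^(2(k-i)) leaves a sum over p which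
  \<open>Gamma_ratio_convolution\<close> evaluates.\<close>

lemma bessel_coeff_angle_power:
  fixes x y :: real
  shows "bessel_coeff k * (LINT \<theta>|angle_measure. (x\<^sup>2 + y\<^sup>2 + 2 * x * y * cos \<theta>) ^ k) =
    (\<Sum>i\<le>k. bessel_coeff i * x ^ (2 * i) * (bessel_coeff (k - i) * y ^ (2 * (k - i))))"
proof -
  let ?G = "\<lambda>k::nat. Gamma (\<alpha> + real k + 1)" and ?H = "Gamma (\<alpha> + 1)"
  let ?P = "{p. 2 * p \<le> k}"
  have fin: "finite ?P" by (rule finite_subset[of _ "{..k}"]) auto
  have "(LINT \<theta>|angle_measure. (x\<^sup>2 + y\<^sup>2 + 2 * x * y * cos \<theta>) ^ k) =
     (LINT \<theta>|angle_measure. (\<Sum>l\<le>k. (real (k choose l) * (2 * x * y) ^ l * (x\<^sup>2 + y\<^sup>2) ^ (k - l))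
         * cos \<theta> ^ l))"
    by (intro Bochner_Integration.integral_cong refl)
       (subst add.commute, subst binomial_ring, simp add: power_mult_distrib mult_ac)
  also have "\<dots> = (\<Sum>l\<le>k. (LINT \<theta>|angle_measure. (real (k choose l) * (2 * x * y) ^ l * (x\<^sup>2
      + y\<^sup>2) ^ (k - l)) * cos \<theta> ^ l))"
    by (intro Bochner_Integration.integral_sum integrable_mult_right angle_integrable_bounded[of _
        1])
       (auto simp: power_abs intro!: power_le_one)
  \<comment> \<open>Odd powers of the cosine integrate to zero, so only l = 2p contributes.\<close>
  also have "\<dots> = (\<Sum>l\<in>(*) 2 ` ?P. (LINT \<theta>|angle_measure. (real (k choose l) * (2 * x * y) ^ l
      * (x\<^sup>2 + y\<^sup>2) ^ (k - l)) * cos \<theta> ^ l))"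
  proof (rule sum.mono_neutral_right)
    have "even l \<Longrightarrow> l \<le> k \<Longrightarrow> l \<in> (*) 2 ` ?P" for l by (auto elim!: evenE)
    then show "\<forall>l\<in>{..k} - (*) 2 ` ?P. (LINT \<theta>|angle_measure. (real (k choose l) * (2 * x * y) ^ l
        * (x\<^sup>2 + y\<^sup>2) ^ (k - l)) * cos \<theta> ^ l) = 0"
      using angle_odd_moment
          by (intro ballI) (metis DiffD1 DiffD2 atMost_iff integral_mult_right_zero mult_zero_right)
  qed auto
  also have "\<dots> = (\<Sum>p\<in>?P. (real (k choose (2 * p)) * (2 * x * y) ^ (2 * p) * (x\<^sup>2 + y\<^sup>2) ^ (k - 2
      * p)) *
      (fact (2 * p) * ?H / (4 ^ p * fact p * ?G p)))"
    by (subst sum.reindex) (auto simp: inj_on_def angle_even_moment)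
  also have "\<dots> = (\<Sum>p\<in>?P. fact k * ?H * (\<Sum>r\<le>k - 2 * p. x ^ (2 * (r + p)) * y ^ (2 * (k - (r + p))) *
     (1 / (fact r * fact (k - 2 * p - r) * fact p * ?G p))))"
  proof (rule sum.cong[OF refl])
    fix p assume p: "p \<in> ?P"
    have c: "real (k choose (2 * p)) = fact k / (fact (2 * p) * fact (k - 2 * p))"
      using p by (simp add: binomial_fact)
    have b: "(2 * x * y) ^ (2 * p) = 4 ^ p * x ^ (2 * p) * y ^ (2 * p)"
      by (simp add: power_mult_distrib power_mult)
    have s: "(x\<^sup>2 + y\<^sup>2) ^ (k - 2 * p) = fact (k - 2 * p) * (\<Sum>r\<le>k - 2 * p. x ^ (2 * r) * y ^ (2
        * (k - 2 * p - r)) *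
        (1 / (fact r * fact (k - 2 * p - r))))"
      unfolding binomial_ring sum_distrib_left
      by (intro sum.cong) (auto simp: binomial_fact power_mult[symmetric])
    have "(real (k choose (2 * p)) * (2 * x * y) ^ (2 * p) * (x\<^sup>2 + y\<^sup>2) ^ (k - 2 * p)) *
      (fact (2 * p) * ?H / (4 ^ p * fact p * ?G p))
      = fact k * ?H * ((1 / (fact p * ?G p) * x ^ (2 * p) * y ^ (2 * p)) * (\<Sum>r\<le>k - 2 * p. x ^ (2
          * r) * y ^ (2 * (k - 2 * p - r)) *
        (1 / (fact r * fact (k - 2 * p - r)))))"
      unfolding c b s by simp
    also have "\<dots> = fact k * ?H * (\<Sum>r\<le>k - 2 * p. x ^ (2 * (r + p)) * y ^ (2 * (k - (r + p))) *
     (1 / (fact r * fact (k - 2 * p - r) * fact p * ?G p)))"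
    proof (subst sum_distrib_left, rule arg_cong[of _ _ "\<lambda>s. fact k * ?H
        * s"], rule sum.cong[OF refl])
      fix r assume r: "r \<in> {..k - 2 * p}"
      have e: "2 * (k - (r + p)) = 2 * p + 2 * (k - 2 * p - r)" using r p by auto
      show "1 / (fact p * ?G p) * x ^ (2 * p) * y ^ (2 * p) * (x ^ (2 * r) * y ^ (2 * (k - 2 * p
          - r)) *
        (1 / (fact r * fact (k - 2 * p - r)))) = x ^ (2 * (r + p)) * y ^ (2 * (k - (r + p))) *
         (1 / (fact r * fact (k - 2 * p - r) * fact p * ?G p))"
        unfolding e by (simp add: power_add distrib_left mult_ac)
    qed
    finally show "(real (k choose (2 * p)) * (2 * x * y) ^ (2 * p) * (x\<^sup>2 + y\<^sup>2) ^ (k - 2 * p)) *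
      (fact (2 * p) * ?H / (4 ^ p * fact p * ?G p))
          = fact k * ?H * (\<Sum>r\<le>k - 2 * p. x ^ (2 * (r + p)) * y ^ (2 * (k - (r + p))) *
     (1 / (fact r * fact (k - 2 * p - r) * fact p * ?G p)))" .
  qed
  also have "\<dots> = fact k * ?H * (\<Sum>p\<in>?P. \<Sum>r\<le>k - 2 * p. x ^ (2 * (r + p)) * y ^ (2 * (k - (r + p))) *
     (1 / (fact r * fact (k - 2 * p - r) * fact p * ?G p)))"
    by (rule sum_distrib_left[symmetric])
  also have "(\<Sum>p\<in>?P. \<Sum>r\<le>k - 2 * p. x ^ (2 * (r + p)) * y ^ (2 * (k - (r + p))) *
     (1 / (fact r * fact (k - 2 * p - r) * fact p * ?G p)))
     = (\<Sum>(p, r)\<in>Sigma ?P (\<lambda>p. {..k - 2 * p}). x ^ (2 * (r + p)) * y ^ (2 * (k - (r + p))) *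
     (1 / (fact r * fact (k - 2 * p - r) * fact p * ?G p)))"
    by (rule sum.Sigma) (use fin in auto)
  \<comment> \<open>Here r counts the factors x^2 taken from (x^2 + y^2)^(k - 2p), and the cross
    term adds p further ones. So i = r + p is half the degree in x, and p ranges up to the smaller
    of i and k - i.\<close>
  also have "\<dots> = (\<Sum>(i, p)\<in>Sigma {..k} (\<lambda>i. {0..min i (k - i)}). x ^ (2 * i) * y ^ (2 * (k - i)) *
     (1 / (fact (i - p) * fact ((k - i) - p) * fact p * ?G p)))"
    by (rule sum.reindex_bij_witness[where j = "\<lambda>(p, r). (r + p, p)" and i = "\<lambda>(i, p). (p, i - p)"])
       (auto simp: algebra_simps numeral_2_eq_2 intro!: arg_cong[of _ _ fact])
  also have "\<dots> = (\<Sum>i\<le>k. \<Sum>p\<in>{0..min i (k - i)}. x ^ (2 * i) * y ^ (2 * (k - i)) *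
     (1 / (fact (i - p) * fact ((k - i) - p) * fact p * ?G p)))"
    by (rule sum.Sigma[symmetric]) auto
  also have "\<dots> = (\<Sum>i\<le>k. x ^ (2 * i) * y ^ (2 * (k - i)) *
     (?G k / (fact i * fact (k - i) * ?G i * ?G (k - i))))"
  proof (rule sum.cong[OF refl])
    fix i assume "i \<in> {..k}"
    then have "i + (k - i) = k" by simp
    with Gamma_ratio_convolution[of i "k - i"]
    show "(\<Sum>p\<in>{0..min i (k - i)}. x ^ (2 * i) * y ^ (2 * (k - i)) *
     (1 / (fact (i - p) * fact ((k - i) - p) * fact p * ?G p))) = x ^ (2 * i) * y ^ (2 * (k - i)) *
     (?G k / (fact i * fact (k - i) * ?G i * ?G (k - i)))"
      by (simp only: sum_distrib_left[symmetric])
  qed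
  finally have "bessel_coeff k * (LINT \<theta>|angle_measure. (x\<^sup>2 + y\<^sup>2 + 2 * x * y * cos \<theta>) ^ k)
    = (\<Sum>i\<le>k. bessel_coeff k * (fact k * ?H) * (x ^ (2 * i) * y ^ (2 * (k - i)) *
     (?G k / (fact i * fact (k - i) * ?G i * ?G (k - i)))))"
    by (simp only: sum_distrib_left mult.assoc)
  also have "\<dots> = (\<Sum>i\<le>k. bessel_coeff i * x ^ (2 * i) * (bessel_coeff (k - i) * y ^ (2 * (k - i))))"
  proof (rule sum.cong[OF refl])
    fix i assume "i \<in> {..k}"
    then obtain j where k: "k = i + j" by (auto simp: le_iff_add)
    show "bessel_coeff k * (fact k * ?H) * (x ^ (2 * i) * y ^ (2 * (k - i)) *
     (?G k / (fact i * fact (k - i) * ?G i * ?G (k - i))))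
         = bessel_coeff i * x ^ (2 * i) * (bessel_coeff (k - i) * y ^ (2 * (k - i)))"
      using Gamma_pos(3)[of "i + j"] unfolding bessel_coeff_def k
          by (simp add: power_add divide_simps)
  qed
  finally show ?thesis .
qed

text \<open>Gegenbauer's product formula. The radicand lies between 0 and (x + y)^2, so the Bessel
  series at x + y dominates and permits integration term by term; each term is an entry of the
  Cauchy product.\<close>

theorem bessel_product:
  assumes "0 \<le> x" "0 \<le> y"
  shows "normalized_bessel \<alpha> x * normalized_bessel \<alpha> y =
    (LINT \<theta>|angle_measure. normalized_bessel \<alpha> (sqrt (x\<^sup>2 + y\<^sup>2 + 2 * x * y * cos \<theta>)))"
proof -
  let ?S = "\<lambda>\<theta>. x\<^sup>2 + y\<^sup>2 + 2 * x * y * cos \<theta>"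
  \<comment> \<open>By the law of cosines this is the squared length of the plane vector (x + y cos
    \<theta>, y sin \<theta>).\<close>
  have S0: "0 \<le> ?S \<theta>" for \<theta>
  proof -
    have "0 \<le> (x + y * cos \<theta>)\<^sup>2 + (y * sin \<theta>)\<^sup>2" by simp
    also have "\<dots> = x\<^sup>2 + y\<^sup>2 * ((cos \<theta>)\<^sup>2 + (sin \<theta>)\<^sup>2) + 2 * x * y * cos \<theta>"
      by (simp only: power2_eq_square algebra_simps)
    finally show ?thesis by simp
  qed
  have S1: "?S \<theta> \<le> (x + y)\<^sup>2" for \<theta>
    using assms mult_left_mono[OF cos_le_one[of \<theta>], of "2 * x * y"] by (simp add: power2_sum)
  have le: "norm (bessel_coeff k * ?S \<theta> ^ k) \<le> \<bar>bessel_coeff k * (x + y) ^ (2 * k)\<bar>" for k \<theta>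
    using S0[of \<theta>] power_mono[OF S1[of \<theta>] S0[of \<theta>], of k]
        by (auto simp: abs_mult power_mult intro!: mult_left_mono)
  have int: "integrable angle_measure (\<lambda>\<theta>. bessel_coeff k * ?S \<theta> ^ k)" for k
    by (rule angle_integrable_bounded[OF _ le]) measurable
  have "(\<lambda>k. LINT \<theta>|angle_measure. bessel_coeff k * ?S \<theta> ^ k) sums (LINT \<theta>|angle_measure.
      (\<Sum>k. bessel_coeff k * ?S \<theta> ^ k))"
  proof (rule sums_integral[OF int])
    show "AE \<theta> in angle_measure. summable (\<lambda>k. norm (bessel_coeff k * ?S \<theta> ^ k))"
      using le by (intro AE_I2 summable_comparison_test'[OF summable_abs_bessel_series[of "x
          + y"]]) auto
    show "summable (\<lambda>k. LINT \<theta>|angle_measure. norm (bessel_coeff k * ?S \<theta> ^ k))"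
    proof (rule summable_comparison_test'[OF summable_abs_bessel_series[of "x + y"]])
      fix k
      have "(LINT \<theta>|angle_measure. norm (bessel_coeff k * ?S \<theta> ^ k))
          \<le> (LINT \<theta>|angle_measure. \<bar>bessel_coeff k * (x + y) ^ (2 * k)\<bar>)"
        using le by (intro integral_mono integrable_norm int) auto
      also have "\<dots> = \<bar>bessel_coeff k * (x + y) ^ (2 * k)\<bar>" using angle.prob_space by simp
      finally show "norm (LINT \<theta>|angle_measure. norm (bessel_coeff k * ?S \<theta> ^ k))
          \<le> \<bar>bessel_coeff k * (x + y) ^ (2 * k)\<bar>" by simp
    qed
  qed
  moreover have "(\<Sum>k. bessel_coeff k * ?S \<theta> ^ k) = normalized_bessel \<alpha> (sqrt (?S \<theta>))" for \<theta>
    using S0[of \<theta>] by (simp add: normalized_bessel_suminf power_mult)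
  moreover have "(LINT \<theta>|angle_measure. bessel_coeff k * ?S \<theta> ^ k) =
     (\<Sum>i\<le>k. bessel_coeff i * x ^ (2 * i) * (bessel_coeff (k - i) * y ^ (2 * (k - i))))" for k
    by (simp add: bessel_coeff_angle_power)
  moreover have "(\<lambda>k. \<Sum>i\<le>k. bessel_coeff i * x ^ (2 * i) * (bessel_coeff (k - i) * y ^ (2 * (k
      - i)))) sums
      (normalized_bessel \<alpha> x * normalized_bessel \<alpha> y)"
    unfolding normalized_bessel_suminf
    by (rule Cauchy_product_sums) (simp_all only: real_norm_def summable_abs_bessel_series)
  ultimately show ?thesis by (simp add: sums_iff)
qed

end

subsection \<open>The Weinstein measure\<close>

lemma borel_measurable_fst_prod [measurable (raw)]:
  fixes f :: "'c \<Rightarrow> 'a::second_countable_topology \<times> 'b::second_countable_topology"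
  assumes "f \<in> borel_measurable M"
  shows "(\<lambda>x. fst (f x)) \<in> borel_measurable M"
  by (rule measurable_compose[OF assms borel_measurable_continuous_onI]) (intro continuous_intros)

lemma borel_measurable_snd_prod [measurable (raw)]:
  fixes f :: "'c \<Rightarrow> 'a::second_countable_topology \<times> 'b::second_countable_topology"
  assumes "f \<in> borel_measurable M"
  shows "(\<lambda>x. snd (f x)) \<in> borel_measurable M"
  by (rule measurable_compose[OF assms borel_measurable_continuous_onI]) (intro continuous_intros)

lemma half_space_borel [measurable]: "half_space \<in> sets borel"
proof -
  have "half_space = {x :: (real ^ 'd) \<times> real. snd x > 0}" by (simp add: half_space_def)
  also have "\<dots> \<in> sets borel" by (intro borel_open open_Collect_less continuous_intros)
  finally show ?thesis .
qed

lemma mem_half_space_iff [simp]: "(b, t) \<in> half_space \<longleftrightarrow> 0 < t"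
  by (simp add: half_space_def)

lemma reflect_reflect [simp]: "reflect (reflect x) = x"
  and fst_reflect [simp]: "fst (reflect x) = - fst x"
  and snd_reflect [simp]: "snd (reflect x) = snd x"
  and norm_reflect [simp]: "norm (reflect x) = norm x"
  and reflect_half_space [simp]: "reflect x \<in> half_space \<longleftrightarrow> x \<in> half_space"
  by (simp_all add: reflect_def half_space_def norm_prod_def)

lemma continuous_on_reflect [continuous_intros]:
  "continuous_on A f \<Longrightarrow> continuous_on A (\<lambda>x. reflect (f x))"
  unfolding reflect_def by (intro continuous_intros)

lemma reflect_borel [measurable]: "reflect \<in> borel_measurable borel"
  by (intro borel_measurable_continuous_onI continuous_intros)

lemma nn_integral_lborel_plus:
  fixes f :: "'a::euclidean_space \<Rightarrow> ennreal"
  assumes [measurable]: "f \<in> borel_measurable borel"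
  shows "(\<integral>\<^sup>+x. f (c + x) \<partial>lborel) = (\<integral>\<^sup>+x. f x \<partial>lborel)"
  using nn_integral_distr[of "(+) c" lborel borel f] by (simp add: lborel_distr_plus)

lemma nn_integral_lborel_scaleR:
  fixes f :: "'a::euclidean_space \<Rightarrow> ennreal"
  assumes [measurable]: "f \<in> borel_measurable borel" and "c \<noteq> 0"
  shows "(\<integral>\<^sup>+x. f x \<partial>lborel) = ennreal (\<bar>c\<bar> ^ DIM('a)) * (\<integral>\<^sup>+x. f (c *\<^sub>R x) \<partial>lborel)"
  by (subst lborel_affine[OF \<open>c \<noteq> 0\<close>, of 0])
     (simp add: nn_integral_density nn_integral_distr nn_integral_cmult)

context weinstein_order
begin

abbreviation weinstein_space :: "((real ^ 'd::finite) \<times> real) measure" ("\<mu>") where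
  "\<mu> \<equiv> weinstein_measure \<alpha>"

text \<open>The type argument supplies d, on which only the normalising constant depends.\<close>

definition weinstein_weight :: "'d::finite itself \<Rightarrow> real \<Rightarrow> real" where
  "weinstein_weight _ t = t powr (2 * \<alpha> + 1) / ((2 * pi) powr (real CARD('d) / 2) * 2 powr \<alpha>
      * Gamma (\<alpha> + 1))"

lemma weinstein_weight_nonneg [simp]: "0 \<le> weinstein_weight TYPE('d::finite) t"
  using Gamma_pos(1) by (simp add: weinstein_weight_def less_imp_le)

lemma weinstein_weight_measurable [measurable]:
  "weinstein_weight TYPE('d::finite) \<in> borel_measurable borel"
  unfolding weinstein_weight_def by measurable

lemma space_weinstein [simp]: "space \<mu> = half_space"
  by (simp add: weinstein_measure_def space_restrict_space)

lemma sets_weinstein: "sets \<mu> = sets (restrict_space borel half_space)"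
  by (simp add: weinstein_measure_def sets_restrict_space)

lemma measurable_id_weinstein: "(\<lambda>x. x) \<in> measurable \<mu> borel"
  by (simp add: weinstein_measure_def measurable_restrict_space1)

text \<open>The measure lives on the trace of the Borel sets on the half space. Functions that are
  Borel on the whole space become measurable by composition with the inclusion.\<close>

lemma borel_measurable_weinsteinI:
  "f \<in> measurable borel N \<Longrightarrow> f \<in> measurable \<mu> N"
  by (rule measurable_compose[OF measurable_id_weinstein])

lemma measurable_weinstein_iff:
  fixes f :: "'a \<Rightarrow> (real ^ 'd::finite) \<times> real"
  shows "f \<in> measurable N \<mu> \<longleftrightarrow> f \<in> measurable N borel \<and> f \<in> space N \<rightarrow> half_space"
proof -
  have "measurable N (\<mu> :: ((real ^ 'd) \<times> real) measure)
      = measurable N (restrict_space borel half_space)"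
    by (rule measurable_cong_sets) (simp_all add: sets_weinstein)
  then show ?thesis by (simp add: measurable_restrict_space2_iff)
qed

lemma sets_weinstein_borel: "A \<in> sets \<mu> \<Longrightarrow> A \<in> sets borel"
  by (auto simp: sets_weinstein sets_restrict_space)

lemma weinstein_eq_density:
  "(\<mu> :: ((real ^ 'd::finite) \<times> real) measure)
     = density (restrict_space lborel half_space) (\<lambda>x. ennreal (weinstein_weight TYPE('d) (snd x)))"
  by (simp add: weinstein_measure_def weinstein_weight_def)

lemma nn_integral_weinstein':
  fixes f :: "(real ^ 'd::finite) \<times> real \<Rightarrow> ennreal"
  assumes [measurable]: "f \<in> borel_measurable borel"
  shows "(\<integral>\<^sup>+x. f x \<partial>\<mu>) = (\<integral>\<^sup>+x. f x * ennreal (weinstein_weight TYPE('d) (snd x))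
      * indicator {0<..} (snd x) \<partial>lborel)"
proof -
  have "(\<integral>\<^sup>+x. f x \<partial>\<mu>)
      = (\<integral>\<^sup>+x. ennreal (weinstein_weight TYPE('d) (snd x)) * f x \<partial>restrict_space lborel half_space)"
    unfolding weinstein_eq_density
    by (intro nn_integral_density measurable_restrict_space1) measurable
  also have "\<dots> = (\<integral>\<^sup>+x. ennreal (weinstein_weight TYPE('d) (snd x)) * f x * indicator half_space x
      \<partial>lborel)"
    by (intro nn_integral_restrict_space) simp
  also have "\<dots> = (\<integral>\<^sup>+x. f x * ennreal (weinstein_weight TYPE('d) (snd x)) * indicator {0<..}
      (snd x) \<partial>lborel)"
    by (intro nn_integral_cong) (auto simp: half_space_def indicator_def mult_ac)
  finally show ?thesis .
qed

lemma nn_integral_weinstein: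
  fixes f :: "(real ^ 'd::finite) \<times> real \<Rightarrow> ennreal"
  assumes [measurable]: "f \<in> borel_measurable borel"
  shows "(\<integral>\<^sup>+x. f x \<partial>\<mu>) = (\<integral>\<^sup>+b. \<integral>\<^sup>+t. f (b, t) * ennreal (weinstein_weight TYPE('d) t)
      * indicator {0<..} t \<partial>lborel \<partial>lborel)"
proof -
  let ?g = "\<lambda>x. f x * ennreal (weinstein_weight TYPE('d) (snd x)) * indicator {0<..} (snd x)"
  have "?g \<in> borel_measurable (lborel \<Otimes>\<^sub>M lborel)" unfolding lborel_prod by measurable
  from lborel.nn_integral_fst[OF this] show ?thesis
    by (simp add: nn_integral_weinstein' lborel_prod)
qed

lemma sigma_finite_weinstein: "sigma_finite_measure \<mu>"
proof -
  interpret r: sigma_finite_measure "restrict_space lborel (half_space :: ((real ^ 'd) \<times> real) set)"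
    by (intro sigma_finite_measure_restrict_space lborel.sigma_finite_measure_axioms) simp
  show ?thesis
    unfolding weinstein_eq_density
    by (subst r.sigma_finite_iff_density_finite) (auto intro!: measurable_restrict_space1)
qed

sublocale weinstein: sigma_finite_measure "\<mu> :: ((real ^ 'd::finite) \<times> real) measure"
  by (rule sigma_finite_weinstein)

text \<open>Borel test functions suffice because a measurable subset of the half space is Borel in
  the whole space. Dilation and reflection are both instances, with different constants c.\<close>

lemma weinstein_measure_eqI:
  fixes N :: "((real ^ 'd::finite) \<times> real) measure"
  assumes sets: "sets N = sets \<mu>"
    and eq: "\<And>f. f \<in> borel_measurable borel \<Longrightarrow> (\<integral>\<^sup>+x. f x \<partial>N) = ennreal c * (\<integral>\<^sup>+x. f x \<partial>\<mu>)"
  shows "N = density \<mu> (\<lambda>_. ennreal c)"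
proof (rule measure_eqI)
  fix A assume A: "A \<in> sets N"
  then have A': "A \<in> sets \<mu>" by (simp add: sets)
  then have [measurable]: "A \<in> sets borel" by (rule sets_weinstein_borel)
  have "emeasure N A = ennreal c * emeasure \<mu> A"
    using eq[of "indicator A"] A A' by simp
  then show "emeasure N A = emeasure (density \<mu> (\<lambda>_. ennreal c)) A"
    using A' by (simp add: emeasure_density nn_integral_cmult)
qed (simp add: sets)

text \<open>The homogeneous dimension: d + 1 from Lebesgue measure and 2\<alpha> + 1 from the
  weight. It governs the behaviour of the measure under dilations.\<close>

definition hom_dim :: "'d::finite itself \<Rightarrow> real" where
  "hom_dim _ = 2 * \<alpha> + 2 + real CARD('d)"

lemma nn_integral_weinstein_scale:
  fixes f :: "(real ^ 'd::finite) \<times> real \<Rightarrow> ennreal"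
  assumes [measurable]: "f \<in> borel_measurable borel" and \<sigma>: "0 < \<sigma>"
  shows "(\<integral>\<^sup>+x. f (\<sigma> *\<^sub>R x) \<partial>\<mu>) = ennreal (\<sigma> powr (- hom_dim TYPE('d))) * (\<integral>\<^sup>+x. f x \<partial>\<mu>)"
proof -
  let ?w = "weinstein_weight TYPE('d)" and ?Q = "hom_dim TYPE('d)"
  have w: "ennreal (?w (\<sigma> * t)) = ennreal (\<sigma> powr (2 * \<alpha> + 1)) * ennreal (?w t)" if "0 < t" for t
    using \<sigma> that Gamma_pos(1)
        by (simp add: weinstein_weight_def powr_mult ennreal_mult[symmetric] less_imp_le)
  have c: "ennreal (\<bar>\<sigma>\<bar> ^ DIM((real ^ 'd) \<times> real)) * ennreal (\<sigma> powr (2 * \<alpha> + 1))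
      = ennreal (\<sigma> powr ?Q)"
    using \<sigma> by (simp add: ennreal_mult[symmetric] powr_realpow[symmetric] powr_add[symmetric]
        hom_dim_def)
       (simp add: algebra_simps powr_add powr_realpow power2_eq_square)
  have "(\<integral>\<^sup>+x. f x \<partial>\<mu>) = ennreal (\<bar>\<sigma>\<bar> ^ DIM((real ^ 'd) \<times> real)) *
     (\<integral>\<^sup>+x. f (\<sigma> *\<^sub>R x) * ennreal (?w (snd (\<sigma> *\<^sub>R x))) * indicator {0<..} (snd (\<sigma> *\<^sub>R x)) \<partial>lborel)"
    unfolding nn_integral_weinstein'[OF assms(1)]
    by (rule nn_integral_lborel_scaleR) (use \<sigma> in auto)
  also have "\<dots> = ennreal (\<bar>\<sigma>\<bar> ^ DIM((real ^ 'd) \<times> real)) *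
     (\<integral>\<^sup>+x. ennreal (\<sigma> powr (2 * \<alpha> + 1)) * (f (\<sigma> *\<^sub>R x) * ennreal (?w (snd x)) * indicator {0<..}
         (snd x)) \<partial>lborel)"
  proof (rule arg_cong2[of _ _ _ _ "(*)", OF refl], rule nn_integral_cong)
    fix x :: "(real ^ 'd) \<times> real"
    have "ennreal (?w (snd (\<sigma> *\<^sub>R x))) * indicator {0<..} (snd (\<sigma> *\<^sub>R x))
        = ennreal (\<sigma> powr (2 * \<alpha> + 1)) * (ennreal (?w (snd x)) * indicator {0<..} (snd x))"
      using \<sigma> by (cases "0 < snd x") (auto simp: w zero_less_mult_iff)
    then show "f (\<sigma> *\<^sub>R x) * ennreal (?w (snd (\<sigma> *\<^sub>R x))) * indicator {0<..} (snd (\<sigma> *\<^sub>R x))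
      = ennreal (\<sigma> powr (2 * \<alpha> + 1)) * (f (\<sigma> *\<^sub>R x) * ennreal (?w (snd x)) * indicator {0<..}
          (snd x))"
      by (simp only: mult.assoc) (simp only: mult.left_commute)
  qed
  also have "\<dots> = ennreal (\<sigma> powr ?Q) * (\<integral>\<^sup>+x. f (\<sigma> *\<^sub>R x) \<partial>\<mu>)"
  proof -
    have "(\<integral>\<^sup>+x. f (\<sigma> *\<^sub>R x) \<partial>\<mu>)
        = (\<integral>\<^sup>+x. f (\<sigma> *\<^sub>R x) * ennreal (?w (snd x)) * indicator {0<..} (snd x) \<partial>lborel)"
      by (rule nn_integral_weinstein') measurable
    then show ?thesis by (subst nn_integral_cmult) (measurable, simp only: c mult.assoc[symmetric])
  qed
  finally have "ennreal (\<sigma> powr (- ?Q)) * (\<integral>\<^sup>+x. f x \<partial>\<mu>)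
      = (ennreal (\<sigma> powr (- ?Q)) * ennreal (\<sigma> powr ?Q)) * (\<integral>\<^sup>+x. f (\<sigma> *\<^sub>R x) \<partial>\<mu>)"
    by (simp add: mult.assoc)
  also have "ennreal (\<sigma> powr (- ?Q)) * ennreal (\<sigma> powr ?Q) = 1"
    using \<sigma> by (simp add: ennreal_mult[symmetric] powr_add[symmetric])
  finally show ?thesis by simp
qed

lemma measurable_scale_weinstein [measurable]:
  "0 < \<sigma> \<Longrightarrow> (\<lambda>x. \<sigma> *\<^sub>R x) \<in> measurable \<mu> \<mu>"
  by (auto simp: measurable_weinstein_iff half_space_def intro: borel_measurable_weinsteinI)

lemma distr_weinstein_scale:
  assumes \<sigma>: "0 < \<sigma>"
  shows "distr \<mu> (\<mu> :: ((real ^ 'd::finite) \<times> real) measure) (\<lambda>x. \<sigma> *\<^sub>R x)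
    = density \<mu> (\<lambda>_. ennreal (\<sigma> powr (- hom_dim TYPE('d))))"
  using \<sigma> by (intro weinstein_measure_eqI)
    (auto simp: nn_integral_distr borel_measurable_weinsteinI nn_integral_weinstein_scale)

lemma nn_integral_weinstein_reflect:
  fixes f :: "(real ^ 'd::finite) \<times> real \<Rightarrow> ennreal"
  assumes [measurable]: "f \<in> borel_measurable borel"
  shows "(\<integral>\<^sup>+x. f (reflect x) \<partial>\<mu>) = (\<integral>\<^sup>+x. f x \<partial>\<mu>)"
proof -
  have [measurable]: "f \<in> borel_measurable (borel \<Otimes>\<^sub>M borel)" by (simp add: borel_prod)
  show ?thesis
    by (simp add: nn_integral_weinstein reflect_def)
       (subst (2) nn_integral_lborel_scaleR[where c = "-1"], auto)
qed

lemma measurable_reflect_weinstein [measurable]: "reflect \<in> measurable \<mu> \<mu>"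
  by (auto simp: measurable_weinstein_iff intro: borel_measurable_weinsteinI)

lemma distr_weinstein_reflect: "distr \<mu> \<mu> reflect = \<mu>"
proof -
  have "distr \<mu> \<mu> reflect = density \<mu> (\<lambda>_. ennreal 1)"
    by (intro weinstein_measure_eqI)
      (auto simp: nn_integral_distr borel_measurable_weinsteinI nn_integral_weinstein_reflect)
  then show ?thesis by (simp add: density_1)
qed

subsection \<open>Translations\<close>

text \<open>The last coordinate is the third side of a triangle with sides \<open>snd x\<close> and
  \<open>snd y\<close>. The translation by \<open>x\<close> averages a function over these
  points.\<close>

definition shift_point :: "(real ^ 'd::finite) \<times> real \<Rightarrow> (real ^ 'd) \<times> real \<Rightarrow> real \<Rightarrow>
    (real ^ 'd) \<times> real" where
  "shift_point x y \<theta> = (fst x + fst y, sqrt ((snd x)\<^sup>2 + (snd y)\<^sup>2 + 2 * snd x * snd y * cos \<theta>))"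

lemma shift_point_commute: "shift_point x y \<theta> = shift_point y x \<theta>"
  by (simp add: shift_point_def algebra_simps)

lemma shift_point_reflect: "shift_point (reflect x) (reflect y) \<theta> = reflect (shift_point x y \<theta>)"
  by (simp add: shift_point_def reflect_def)

lemma shift_point_measurable [measurable (raw)]:
  assumes [measurable]: "f \<in> borel_measurable N" "g \<in> borel_measurable N" "h \<in> borel_measurable N"
  shows "(\<lambda>x. shift_point (f x) (g x) (h x)) \<in> borel_measurable N"
  unfolding shift_point_def by measurable

text \<open>With u = t cos \<theta> and v = t sin \<theta>, the arguments of \<open>G\<close> are
  the distances of (u, v) from (-s, 0) and from the origin. The weights match because
  t^(2\<alpha>+1) sin^(2\<alpha>) \<theta> is v^(2\<alpha>) times the Jacobian t.\<close>

lemma nn_integral_angle_half_plane: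
  fixes G :: "real \<times> real \<Rightarrow> ennreal"
  assumes G [measurable]: "G \<in> borel_measurable borel"
  shows "(\<integral>\<^sup>+t. \<integral>\<^sup>+\<theta>. G (sqrt (s\<^sup>2 + t\<^sup>2 + 2 * s * t * cos \<theta>), t) * (ennreal (t powr (2 * \<alpha> + 1))
      * indicator {0<..} t) \<partial>angle_measure \<partial>lborel) =
      ennreal angle_const * (\<integral>\<^sup>+v. \<integral>\<^sup>+u. G (sqrt ((u + s)\<^sup>2 + v\<^sup>2), sqrt (u\<^sup>2 + v\<^sup>2)) * ennreal
          (v powr (2 * \<alpha>)) * indicator {0<..} v \<partial>lborel \<partial>lborel)"
proof -
  define g where "g = (\<lambda>(u, v). G (sqrt ((u + s)\<^sup>2 + v\<^sup>2), sqrt (u\<^sup>2 + v\<^sup>2)) * ennreal (v powr (2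
      * \<alpha>)))"
  have gm: "g \<in> borel_measurable borel" unfolding g_def borel_prod[symmetric] by measurable
  have "(\<integral>\<^sup>+v. \<integral>\<^sup>+u. g (u, v) * indicator {0<..} v \<partial>lborel \<partial>lborel) =
     (\<integral>\<^sup>+r. \<integral>\<^sup>+\<theta>. g (r * cos \<theta>, r * sin \<theta>) * ennreal r * indicator {0<..} r
         * indicator {0<..<pi} \<theta> \<partial>lborel \<partial>lborel)"
    by (rule nn_integral_half_plane_polar[OF gm])
  then have "ennreal angle_const * (\<integral>\<^sup>+v. \<integral>\<^sup>+u. g (u, v) * indicator {0<..} v \<partial>lborel \<partial>lborel) =
      ennreal angle_const * (\<integral>\<^sup>+r. \<integral>\<^sup>+\<theta>. g (r * cos \<theta>, r * sin \<theta>) * ennreal r * indicator {0<..} r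
          * indicator {0<..<pi} \<theta> \<partial>lborel \<partial>lborel)"
    by (rule arg_cong)
  also have "\<dots> = (\<integral>\<^sup>+r. ennreal angle_const * (\<integral>\<^sup>+\<theta>. g (r * cos \<theta>, r * sin \<theta>) * ennreal r
      * indicator {0<..} r * indicator {0<..<pi} \<theta> \<partial>lborel) \<partial>lborel)"
  proof (rule nn_integral_cmult[symmetric])
    note gm [measurable]
    show "(\<lambda>r. \<integral>\<^sup>+\<theta>. g (r * cos \<theta>, r * sin \<theta>) * ennreal r * indicator {0<..} r
        * indicator {0<..<pi} \<theta> \<partial>lborel) \<in> borel_measurable lborel"
      by measurable
  qed
  also have "\<dots> = (\<integral>\<^sup>+t. \<integral>\<^sup>+\<theta>. G (sqrt (s\<^sup>2 + t\<^sup>2 + 2 * s * t * cos \<theta>), t) * (ennreal (t powr (2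
      * \<alpha> + 1)) * indicator {0<..} t) \<partial>angle_measure \<partial>lborel)"
  proof (rule nn_integral_cong)
    fix t :: real
    have "(\<integral>\<^sup>+\<theta>. G (sqrt (s\<^sup>2 + t\<^sup>2 + 2 * s * t * cos \<theta>), t) * (ennreal (t powr (2 * \<alpha> + 1))
        * indicator {0<..} t) \<partial>angle_measure)
      = ennreal angle_const * (\<integral>\<^sup>+\<theta>. G (sqrt (s\<^sup>2 + t\<^sup>2 + 2 * s * t * cos \<theta>), t) * (ennreal
          (t powr (2 * \<alpha> + 1)) * indicator {0<..} t) * ennreal (sin \<theta> powr (2 * \<alpha>))
              * indicator {0<..<pi} \<theta> \<partial>lborel)"
      by (rule nn_integral_angle) measurable
    also have "(\<integral>\<^sup>+\<theta>. G (sqrt (s\<^sup>2 + t\<^sup>2 + 2 * s * t * cos \<theta>), t) * (ennreal (t powr (2 * \<alpha> + 1))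
        * indicator {0<..} t) * ennreal (sin \<theta> powr (2 * \<alpha>)) * indicator {0<..<pi} \<theta> \<partial>lborel)
       = (\<integral>\<^sup>+\<theta>. g (t * cos \<theta>, t * sin \<theta>) * ennreal t * indicator {0<..} t
           * indicator {0<..<pi} \<theta> \<partial>lborel)"
    proof (rule nn_integral_cong)
      fix \<theta> :: real
      show "G (sqrt (s\<^sup>2 + t\<^sup>2 + 2 * s * t * cos \<theta>), t) * (ennreal (t powr (2 * \<alpha> + 1))
          * indicator {0<..} t) * ennreal (sin \<theta> powr (2 * \<alpha>)) * indicator {0<..<pi} \<theta>
        = g (t * cos \<theta>, t * sin \<theta>) * ennreal t * indicator {0<..} t * indicator {0<..<pi} \<theta>"
      proof (cases "0 < t \<and> \<theta> \<in> {0<..<pi}")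
        case True
        then have pos: "0 < sin \<theta>" by (simp add: sin_gt_zero)
        have sc: "t\<^sup>2 * (cos \<theta>)\<^sup>2 + t\<^sup>2 * (sin \<theta>)\<^sup>2 = t\<^sup>2" by (simp flip: distrib_left)
        have 1: "(t * cos \<theta> + s)\<^sup>2 + (t * sin \<theta>)\<^sup>2 = s\<^sup>2 + t\<^sup>2 + 2 * s * t * cos \<theta>"
          using sc by (simp add: power2_sum power_mult_distrib algebra_simps)
        have 2: "sqrt ((t * cos \<theta>)\<^sup>2 + (t * sin \<theta>)\<^sup>2) = t"
          using sc True by (simp add: power_mult_distrib)
        have 3: "ennreal (t powr (2 * \<alpha> + 1)) * ennreal (sin \<theta> powr (2 * \<alpha>))
            = ennreal ((t * sin \<theta>) powr (2 * \<alpha>)) * ennreal t"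
          using True pos by (simp add: ennreal_mult[symmetric] powr_add powr_mult mult_ac)
        show ?thesis using True 3 by (simp add: g_def 1 2 mult.assoc)
      qed auto
    qed
    finally show "ennreal angle_const * (\<integral>\<^sup>+\<theta>. g (t * cos \<theta>, t * sin \<theta>) * ennreal t
        * indicator {0<..} t * indicator {0<..<pi} \<theta> \<partial>lborel)
      = (\<integral>\<^sup>+\<theta>. G (sqrt (s\<^sup>2 + t\<^sup>2 + 2 * s * t * cos \<theta>), t) * (ennreal (t powr (2 * \<alpha> + 1))
          * indicator {0<..} t) \<partial>angle_measure)"
      by (rule sym)
  qed
  finally show ?thesis by (simp add: g_def)
qed

text \<open>The reflection of u to -s - u fixes v and exchanges the points (-s, 0) and the origin,
  hence the two distances.\<close>

lemma nn_integral_angle_swap: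
  fixes G :: "real \<times> real \<Rightarrow> ennreal"
  assumes [measurable]: "G \<in> borel_measurable borel"
  shows "(\<integral>\<^sup>+t. \<integral>\<^sup>+\<theta>. G (sqrt (s\<^sup>2 + t\<^sup>2 + 2 * s * t * cos \<theta>), t) * (ennreal (t powr (2 * \<alpha> + 1))
      * indicator {0<..} t) \<partial>angle_measure \<partial>lborel) =
         (\<integral>\<^sup>+t. \<integral>\<^sup>+\<theta>. G (t, sqrt (s\<^sup>2 + t\<^sup>2 + 2 * s * t * cos \<theta>)) * (ennreal (t powr (2 * \<alpha> + 1))
             * indicator {0<..} t) \<partial>angle_measure \<partial>lborel)"
proof -
  let ?H = "\<lambda>(r, t). G (t, r)"
  have "(\<integral>\<^sup>+v. \<integral>\<^sup>+u. G (sqrt ((u + s)\<^sup>2 + v\<^sup>2), sqrt (u\<^sup>2 + v\<^sup>2)) * ennreal (v powr (2 * \<alpha>))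
      * indicator {0<..} v \<partial>lborel \<partial>lborel)
      = (\<integral>\<^sup>+v. \<integral>\<^sup>+u. ?H (sqrt ((u + s)\<^sup>2 + v\<^sup>2), sqrt (u\<^sup>2 + v\<^sup>2)) * ennreal (v powr (2 * \<alpha>))
          * indicator {0<..} v \<partial>lborel \<partial>lborel)"
  proof (rule nn_integral_cong)
    fix v :: real
    have "(\<integral>\<^sup>+u. G (sqrt ((u + s)\<^sup>2 + v\<^sup>2), sqrt (u\<^sup>2 + v\<^sup>2)) * ennreal (v powr (2 * \<alpha>))
        * indicator {0<..} v \<partial>lborel) =
        (\<integral>\<^sup>+u. G (sqrt ((- s + - 1 * u + s)\<^sup>2 + v\<^sup>2), sqrt ((- s + - 1 * u)\<^sup>2 + v\<^sup>2)) * ennreal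
            (v powr (2 * \<alpha>)) * indicator {0<..} v \<partial>lborel)"
      by (subst nn_integral_real_affine[where c = "-1" and t = "-s"]) auto
    moreover have "(- s + - 1 * u)\<^sup>2 = (u + s)\<^sup>2" "(- s + - 1 * u + s)\<^sup>2 = u\<^sup>2" for u
      by (simp_all add: power2_eq_square algebra_simps)
    ultimately show "(\<integral>\<^sup>+u. G (sqrt ((u + s)\<^sup>2 + v\<^sup>2), sqrt (u\<^sup>2 + v\<^sup>2)) * ennreal (v powr (2
        * \<alpha>)) * indicator {0<..} v \<partial>lborel) =
        (\<integral>\<^sup>+u. ?H (sqrt ((u + s)\<^sup>2 + v\<^sup>2), sqrt (u\<^sup>2 + v\<^sup>2)) * ennreal (v powr (2 * \<alpha>))
            * indicator {0<..} v \<partial>lborel)" by simp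
  qed
  moreover have "?H \<in> borel_measurable borel"
    unfolding borel_prod[symmetric] by measurable
  ultimately show ?thesis
    using nn_integral_angle_half_plane[of G s] nn_integral_angle_half_plane[of ?H s] assms by simp
qed

text \<open>The translation by \<open>x\<close> has the translation by \<open>reflect x\<close> as
  its transpose. With \<open>F\<close> depending on its first argument alone, this says that
  translations preserve mass; with a product for \<open>F\<close>, it moves the shift from one
  factor to the other.\<close>

theorem nn_integral_shift_swap:
  fixes F :: "((real ^ 'd::finite) \<times> real) \<times> ((real ^ 'd) \<times> real) \<Rightarrow> ennreal"
  assumes [measurable]: "F \<in> borel_measurable borel"
  shows "(\<integral>\<^sup>+y. \<integral>\<^sup>+\<theta>. F (shift_point x y \<theta>, y) \<partial>angle_measure \<partial>\<mu>) =
         (\<integral>\<^sup>+y. \<integral>\<^sup>+\<theta>. F (y, shift_point (reflect x) y \<theta>) \<partial>angle_measure \<partial>\<mu>)"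
proof -
  obtain a s where x: "x = (a, s)" by (cases x)
  let ?W = "\<lambda>t. ennreal (t powr (2 * \<alpha> + 1)) * indicator {0<..} t"
  define k where "k = ennreal (1 / ((2 * pi) powr (real CARD('d) / 2) * 2 powr \<alpha> * Gamma (\<alpha> + 1)))"
  have w: "ennreal (weinstein_weight TYPE('d) t) * indicator {0<..} t = k * ?W t" for t
    using Gamma_pos(1)
        by (simp add: weinstein_weight_def k_def ennreal_mult[symmetric] less_imp_le
            mult.assoc[symmetric])
  let ?r = "\<lambda>t \<theta>. sqrt (s\<^sup>2 + t\<^sup>2 + 2 * s * t * cos \<theta>)"
  have conv: "(\<integral>\<^sup>+y. \<integral>\<^sup>+\<theta>. f y \<theta> \<partial>angle_measure \<partial>\<mu>) =
      (\<integral>\<^sup>+b. k * (\<integral>\<^sup>+t. \<integral>\<^sup>+\<theta>. f (b, t) \<theta> * ?W t \<partial>angle_measure \<partial>lborel) \<partial>lborel)"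
    if [measurable]: "case_prod f \<in> borel_measurable (borel \<Otimes>\<^sub>M borel)"
        for f :: "(real ^ 'd) \<times> real \<Rightarrow> real \<Rightarrow> ennreal"
  proof -
    have "(\<integral>\<^sup>+y. \<integral>\<^sup>+\<theta>. f y \<theta> \<partial>angle_measure \<partial>\<mu>) =
      (\<integral>\<^sup>+b. \<integral>\<^sup>+t. (\<integral>\<^sup>+\<theta>. f (b, t) \<theta> \<partial>angle_measure) * ennreal (weinstein_weight TYPE('d) t)
          * indicator {0<..} t \<partial>lborel \<partial>lborel)"
      by (rule nn_integral_weinstein) measurable
    also have "\<dots> = (\<integral>\<^sup>+b. k * (\<integral>\<^sup>+t. \<integral>\<^sup>+\<theta>. f (b, t) \<theta> * ?W t \<partial>angle_measure \<partial>lborel) \<partial>lborel)"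
    proof (rule nn_integral_cong)
      fix b
      have "(\<integral>\<^sup>+t. (\<integral>\<^sup>+\<theta>. f (b, t) \<theta> \<partial>angle_measure) * ennreal (weinstein_weight TYPE('d) t)
          * indicator {0<..} t \<partial>lborel)
        = (\<integral>\<^sup>+t. k * (\<integral>\<^sup>+\<theta>. f (b, t) \<theta> * ?W t \<partial>angle_measure) \<partial>lborel)"
      proof (rule nn_integral_cong)
        fix t
        have "(\<integral>\<^sup>+\<theta>. f (b, t) \<theta> * ?W t \<partial>angle_measure) = (\<integral>\<^sup>+\<theta>. f (b, t) \<theta> \<partial>angle_measure) * ?W t"
          by (rule nn_integral_multc) measurable
        then show "(\<integral>\<^sup>+\<theta>. f (b, t) \<theta> \<partial>angle_measure) * ennreal (weinstein_weight TYPE('d) t)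
            * indicator {0<..} t
          = k * (\<integral>\<^sup>+\<theta>. f (b, t) \<theta> * ?W t \<partial>angle_measure)"
          by (simp only: mult.assoc w) (simp only: mult_ac)
      qed
      also have "\<dots> = k * (\<integral>\<^sup>+t. \<integral>\<^sup>+\<theta>. f (b, t) \<theta> * ?W t \<partial>angle_measure \<partial>lborel)"
        by (rule nn_integral_cmult) measurable
      finally show "(\<integral>\<^sup>+t. (\<integral>\<^sup>+\<theta>. f (b, t) \<theta> \<partial>angle_measure) * ennreal (weinstein_weight TYPE('d)
          t) * indicator {0<..} t \<partial>lborel)
        = k * (\<integral>\<^sup>+t. \<integral>\<^sup>+\<theta>. f (b, t) \<theta> * ?W t \<partial>angle_measure \<partial>lborel)" .
    qed
    finally show ?thesis .
  qed
  have "(\<integral>\<^sup>+y. \<integral>\<^sup>+\<theta>. F (shift_point x y \<theta>, y) \<partial>angle_measure \<partial>\<mu>)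
     = (\<integral>\<^sup>+b. k * (\<integral>\<^sup>+t. \<integral>\<^sup>+\<theta>. F ((a + b, ?r t \<theta>), (b, t)) * ?W t \<partial>angle_measure \<partial>lborel) \<partial>lborel)"
    by (subst conv) (simp_all add: x shift_point_def)
  also have "\<dots>
      = (\<integral>\<^sup>+b. k * (\<integral>\<^sup>+t. \<integral>\<^sup>+\<theta>. F ((a + b, t), (b, ?r t \<theta>)) * ?W t \<partial>angle_measure \<partial>lborel) \<partial>lborel)"
  proof (rule nn_integral_cong, rule arg_cong[of _ _ "(*) k"])
    fix b
    show "(\<integral>\<^sup>+t. \<integral>\<^sup>+\<theta>. F ((a + b, ?r t \<theta>), (b, t)) * ?W t \<partial>angle_measure \<partial>lborel)
        = (\<integral>\<^sup>+t. \<integral>\<^sup>+\<theta>. F ((a + b, t), (b, ?r t \<theta>)) * ?W t \<partial>angle_measure \<partial>lborel)"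
      using nn_integral_angle_swap[of "\<lambda>p. F ((a + b, fst p), (b, snd p))" s] by simp
  qed
  \<comment> \<open>Replacing b by b - a in the unweighted variables turns the shift by a into one
    by -a. This is the origin of \<open>reflect x\<close>; the vertical variable needed no
    sign.\<close>
  also have "\<dots>
      = (\<integral>\<^sup>+b. k * (\<integral>\<^sup>+t. \<integral>\<^sup>+\<theta>. F ((b, t), (- a + b, ?r t \<theta>)) * ?W t \<partial>angle_measure \<partial>lborel)
          \<partial>lborel)"
    by (subst nn_integral_lborel_plus[of _ "a", symmetric]) simp_all
  also have "\<dots> = (\<integral>\<^sup>+y. \<integral>\<^sup>+\<theta>. F (y, shift_point (reflect x) y \<theta>) \<partial>angle_measure \<partial>\<mu>)"
    by (subst conv) (simp_all add: x shift_point_def reflect_def)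
  finally show ?thesis .
qed

end

section \<open>Gaussian integrals against exponentials and Bessel functions\<close>

lemma integral_gaussian_cis:
  fixes \<epsilon> \<xi> :: real
  assumes \<epsilon>: "0 < \<epsilon>"
  shows "integrable lborel (\<lambda>b. exp (- \<i> * complex_of_real (b * \<xi>)) * complex_of_real (exp (- \<epsilon>
      * b\<^sup>2 / 2)))" (is "integrable _ ?f")
    and "(LINT b|lborel. exp (- \<i> * complex_of_real (b * \<xi>)) * complex_of_real (exp (- \<epsilon>
        * b\<^sup>2 / 2))) =
      complex_of_real (sqrt (2 * pi / \<epsilon>) * exp (- \<xi>\<^sup>2 / (2 * \<epsilon>)))"
proof -
  \<comment> \<open>The integrand is a rescaled standard normal density times a character, so the
    value is the characteristic function of the normal law at -\<xi> / sqrt \<epsilon>.\<close>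
  let ?g = "\<lambda>b. std_normal_density b *\<^sub>R iexp ((- \<xi> / sqrt \<epsilon>) * b)"
  have g: "?f b = complex_of_real (sqrt (2 * pi)) * ?g (0 + sqrt \<epsilon> * b)" for b
    using \<epsilon> by (simp add: normal_density_def scaleR_conv_of_real power_mult_distrib mult_ac)
  have "integrable std_normal_distribution (\<lambda>b. iexp ((- \<xi> / sqrt \<epsilon>) * b))"
    by (rule prob_space.integrable_iexp[OF real_distribution.axioms(1)[OF real_dist_normal_dist]])
        simp_all
  then have int: "integrable lborel ?g"
    by (subst (asm) integrable_density) auto
  have "integrable lborel (\<lambda>b. ?g (0 + sqrt \<epsilon> * b))"
    using \<epsilon> by (intro lborel_integrable_real_affine int) auto
  then show "integrable lborel ?f" unfolding g by (intro integrable_mult_right) auto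
  have "integral\<^sup>L lborel ?g = char std_normal_distribution (- \<xi> / sqrt \<epsilon>)"
    unfolding char_def by (subst integral_density) auto
  also have "\<dots> = complex_of_real (exp (- \<xi>\<^sup>2 / (2 * \<epsilon>)))"
    using \<epsilon> by (simp add: char_std_normal_distribution power_divide mult.commute)
  finally have G: "integral\<^sup>L lborel ?g = complex_of_real (exp (- \<xi>\<^sup>2 / (2 * \<epsilon>)))" .
  have "integral\<^sup>L lborel ?g = \<bar>sqrt \<epsilon>\<bar> *\<^sub>R (LINT b|lborel. ?g (0 + sqrt \<epsilon> * b))"
    using \<epsilon> by (intro lborel_integral_real_affine) auto
  then have "(LINT b|lborel. ?g (0 + sqrt \<epsilon> * b))
      = complex_of_real (1 / sqrt \<epsilon>) * complex_of_real (exp (- \<xi>\<^sup>2 / (2 * \<epsilon>)))"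
    using \<epsilon> unfolding G by (simp add: scaleR_conv_of_real field_simps)
  then show "integral\<^sup>L lborel ?f = complex_of_real (sqrt (2 * pi / \<epsilon>) * exp (- \<xi>\<^sup>2 / (2 * \<epsilon>)))"
    unfolding g by (subst integral_mult_right_zero) (simp add: real_sqrt_divide)
qed

text \<open>Lebesgue measure is the image of a product measure along the basis, and the character as
  well as the Gaussian factor over the coordinates.\<close>

lemma integral_gaussian_cis_vec:
  fixes \<xi> :: "real ^ 'd::finite"
  assumes \<epsilon>: "0 < \<epsilon>"
  shows "(LINT b|lborel. exp (- \<i> * complex_of_real (b \<bullet> \<xi>)) * complex_of_real (exp (- \<epsilon>
      * (norm b)\<^sup>2 / 2))) =
      complex_of_real ((2 * pi / \<epsilon>) powr (real CARD('d) / 2) * exp (- (norm \<xi>)\<^sup>2 / (2 * \<epsilon>)))"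
proof -
  interpret product_sigma_finite "\<lambda>_::real ^ 'd. lborel :: real measure"
    by standard
  let ?h = "\<lambda>j b. exp (- \<i> * complex_of_real (b * (\<xi> \<bullet> j))) * complex_of_real (exp (- \<epsilon> * b\<^sup>2 / 2))"
  let ?F = "\<lambda>b :: real ^ 'd. exp (- \<i> * complex_of_real (b \<bullet> \<xi>)) * complex_of_real (exp (- \<epsilon>
      * (norm b)\<^sup>2 / 2))"
  let ?S = "\<lambda>f. \<Sum>j\<in>Basis. f j *\<^sub>R j :: real ^ 'd"
  have card: "card (Basis :: (real ^ 'd) set) = CARD('d)" by simp
  have F: "?F (?S f) = (\<Prod>j\<in>Basis. ?h j (f j))" for f
  proof -
    have 1: "?S f \<bullet> \<xi> = (\<Sum>j\<in>Basis. f j * (\<xi> \<bullet> j))"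
      by (simp only: inner_sum_left inner_scaleR_left inner_commute[of \<xi>])
    have 2: "(norm (?S f))\<^sup>2 = (\<Sum>j\<in>Basis. (f j)\<^sup>2)"
      unfolding power2_norm_eq_inner
      by (subst euclidean_inner, rule sum.cong[OF refl]) (simp only: inner_sum_left_Basis
          power2_eq_square)
    have 3: "exp (- \<i> * complex_of_real (\<Sum>j\<in>Basis. f j * (\<xi> \<bullet> j)))
        = (\<Prod>j\<in>Basis. exp (- \<i> * complex_of_real (f j * (\<xi> \<bullet> j))))"
      by (simp only: exp_sum[symmetric] finite_Basis of_real_sum sum_distrib_left)
    have 4: "complex_of_real (exp (- \<epsilon> * (\<Sum>j\<in>(Basis :: (real ^ 'd) set). (f j)\<^sup>2) / 2))
        = (\<Prod>j\<in>(Basis :: (real ^ 'd) set). complex_of_real (exp (- \<epsilon> * (f j)\<^sup>2 / 2)))"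
      by (simp only: of_real_prod[symmetric] exp_sum[symmetric] finite_Basis sum_distrib_left
          sum_divide_distrib)
    show ?thesis unfolding 1 2 3 4 prod.distrib ..
  qed
  have "(LINT b|lborel. ?F b) = (LINT f|(\<Pi>\<^sub>M j\<in>Basis. lborel). ?F (?S f))"
    unfolding lborel_eq[where 'a = "real ^ 'd"] by (rule integral_distr) measurable
  also have "\<dots> = (LINT f|(\<Pi>\<^sub>M j\<in>Basis. lborel). (\<Prod>j\<in>Basis. ?h j (f j)))"
    by (simp only: F)
  also have "\<dots> = (\<Prod>j\<in>(Basis :: (real ^ 'd) set). integral\<^sup>L lborel (?h j))"
    by (rule product_integral_prod) (use integral_gaussian_cis(1)[OF \<epsilon>] in auto)
  also have "\<dots> = (\<Prod>j\<in>(Basis :: (real ^ 'd) set). complex_of_real (sqrt (2 * pi / \<epsilon>) * exp (-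
      (\<xi> \<bullet> j)\<^sup>2 / (2 * \<epsilon>))))"
    by (simp only: integral_gaussian_cis(2)[OF \<epsilon>])
  also have "\<dots> = complex_of_real (sqrt (2 * pi / \<epsilon>) ^ CARD('d) * exp (\<Sum>j\<in>Basis. - (\<xi> \<bullet> j)\<^sup>2 / (2
      * \<epsilon>)))"
    by (simp only: of_real_prod[symmetric] prod.distrib prod_constant card exp_sum finite_Basis)
  also have "(\<Sum>j\<in>Basis. - (\<xi> \<bullet> j)\<^sup>2 / (2 * \<epsilon>)) = - (norm \<xi>)\<^sup>2 / (2 * \<epsilon>)"
    unfolding power2_norm_eq_inner
    by (subst euclidean_inner) (simp add: sum_divide_distrib[symmetric] sum_negf power2_eq_square)
  also have "sqrt (2 * pi / \<epsilon>) ^ CARD('d) = (2 * pi / \<epsilon>) powr (real CARD('d) / 2)"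
    using \<epsilon> by (simp add: powr_half_sqrt[symmetric] powr_realpow[symmetric] powr_powr)
  finally show ?thesis .
qed

lemma integral_lborel_product:
  fixes p :: "'a::euclidean_space \<Rightarrow> complex" and q :: "'b::euclidean_space \<Rightarrow> complex"
  assumes p: "integrable lborel p" and q: "integrable lborel q"
  shows "integrable lborel (\<lambda>x. p (fst x) * q (snd x))"
    and "(LINT x|lborel. p (fst x) * q (snd x)) = integral\<^sup>L lborel p * integral\<^sup>L lborel q"
proof -
  note [measurable] = borel_measurable_integrable[OF p] borel_measurable_integrable[OF q]
  have pq: "integrable (lborel \<Otimes>\<^sub>M lborel) (\<lambda>x. p (fst x) * q (snd x))"
  proof (rule lborel_pair.Fubini_integrable)
    show "AE b in lborel. integrable lborel (\<lambda>t. p (fst (b, t)) * q (snd (b, t)))"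
      using q by simp
    have "(LINT t|lborel. norm (p (fst (b, t)) * q (snd (b, t))))
        = norm (p b) * (LINT t|lborel. norm (q t))" for b
      by (simp only: fst_conv snd_conv norm_mult integral_mult_right_zero)
    then show "integrable lborel (\<lambda>b. LINT t|lborel. norm (p (fst (b, t)) * q (snd (b, t))))"
      using p by (simp only:) (intro integrable_mult_left integrable_norm)
  qed measurable
  then show "integrable lborel (\<lambda>x. p (fst x) * q (snd x))" by (simp only: lborel_prod)
  have "(LINT b|lborel. LINT t|lborel. p (fst (b, t)) * q (snd (b, t)))
      = (LINT x|lborel. p (fst x) * q (snd x))"
    using lborel_pair.integral_fst'[OF pq] by (simp only: lborel_prod)
  then show "(LINT x|lborel. p (fst x) * q (snd x)) = integral\<^sup>L lborel p * integral\<^sup>L lborel q"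
    by (simp only: fst_conv snd_conv integral_mult_right_zero integral_mult_left_zero)
qed

context weinstein_order
begin

lemma nn_integral_bessel_gaussian_term:
  assumes \<epsilon>: "0 < \<epsilon>"
  shows "(\<integral>\<^sup>+t. ennreal (t ^ (2 * k) * (t powr (2 * \<alpha> + 1) * exp (- \<epsilon> * t\<^sup>2 / 2)))
      * indicator {0<..} t \<partial>lborel)
    = ennreal (2 powr (real k + \<alpha>) * Gamma (\<alpha> + real k + 1) / \<epsilon> powr (\<alpha> + real k + 1))"
proof -
  have "(\<integral>\<^sup>+t. ennreal (t ^ (2 * k) * (t powr (2 * \<alpha> + 1) * exp (- \<epsilon> * t\<^sup>2 / 2)))
      * indicator {0<..} t \<partial>lborel)
    = (\<integral>\<^sup>+t. ennreal (t powr (2 * real k + 2 * \<alpha> + 1) * exp (- \<epsilon> * t\<^sup>2 / 2))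
        * indicator {0<..} t \<partial>lborel)"
  proof (rule nn_integral_cong)
    fix t :: real
    have "t ^ (2 * k) * t powr (2 * \<alpha> + 1) = t powr (2 * real k + 2 * \<alpha> + 1)" if "0 < t"
      using powr_realpow[OF that, of "2 * k"] by (simp add: powr_add add.assoc)
    then show "ennreal (t ^ (2 * k) * (t powr (2 * \<alpha> + 1) * exp (- \<epsilon> * t\<^sup>2 / 2)))
        * indicator {0<..} t
      = ennreal (t powr (2 * real k + 2 * \<alpha> + 1) * exp (- \<epsilon> * t\<^sup>2 / 2)) * indicator {0<..} t"
      by (cases "0 < t") (simp_all flip: mult.assoc)
  qed
  also have "\<dots> = ennreal (2 powr (real k + \<alpha>) * Gamma (\<alpha> + real k + 1) / \<epsilon> powr (\<alpha> + real k + 1))"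
  proof -
    have "(2 * real k + 2 * \<alpha> + 1 - 1) / 2 = real k + \<alpha>" "(2 * real k + 2 * \<alpha> + 1 + 1) / 2
        = \<alpha> + real k + 1"
    by (simp_all add: field_simps)
    moreover have "- 1 < 2 * real k + 2 * \<alpha> + 1" using order_gt by (simp add: field_simps)
    ultimately show ?thesis
      using nn_integral_powr_gaussian[of "2 * real k + 2 * \<alpha> + 1" \<epsilon>] \<epsilon> by (simp only:)
  qed
  finally show ?thesis .
qed

text \<open>The Bessel series is integrated term by term. The Gamma factor of the k-th moment
  cancels the one in \<open>bessel_coeff k\<close>, and the exponential series at -s^2 /
  (2\<epsilon>) remains.\<close>

lemma bessel_gaussian:
  assumes \<epsilon>: "0 < \<epsilon>"
  shows "integrable lborel (\<lambda>t. indicator {0<..} t * (t powr (2 * \<alpha> + 1) * exp (- \<epsilon> * t\<^sup>2 / 2)))"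
    and "(LINT t|lborel. normalized_bessel \<alpha> (t * s) * (indicator {0<..} t * (t powr (2 * \<alpha> + 1)
        * exp (- \<epsilon> * t\<^sup>2 / 2)))) =
      2 powr \<alpha> * Gamma (\<alpha> + 1) * \<epsilon> powr (- (\<alpha> + 1)) * exp (- s\<^sup>2 / (2 * \<epsilon>))"
proof -
  let ?w = "\<lambda>t. indicator {0<..} t * (t powr (2 * \<alpha> + 1) * exp (- \<epsilon> * t\<^sup>2 / 2))"
  let ?v = "\<lambda>k. 2 powr (real k + \<alpha>) * Gamma (\<alpha> + real k + 1) / \<epsilon> powr (\<alpha> + real k + 1)"
  have nn: "(\<integral>\<^sup>+t. ennreal (t ^ (2 * k) * ?w t) \<partial>lborel) = ennreal (?v k)" for k
    unfolding nn_integral_bessel_gaussian_term[OF \<epsilon>, symmetric]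
    by (intro nn_integral_cong) (auto simp: indicator_def)
  have v: "0 \<le> ?v k" for k using Gamma_pos(3)[of k] by (simp add: less_imp_le)
  have int: "integrable lborel (\<lambda>t. t ^ (2 * k) * ?w t)" for k
    using nn[of k] by (intro integrableI_nonneg) (auto simp: less_top[symmetric] top_unique)
  have lint: "(LINT t|lborel. t ^ (2 * k) * ?w t) = ?v k" for k
    using nn[of k] v by (subst integral_eq_nn_integral) auto
  show "integrable lborel ?w" using int[of 0] by simp
  have exp_term: "z ^ k / fact k = z ^ k /\<^sub>R fact k" for z :: real and k
    by (simp add: divide_inverse)
  let ?f = "\<lambda>k t. bessel_coeff k * s ^ (2 * k) * (t ^ (2 * k) * ?w t)"
  have term_eq: "bessel_coeff k * s ^ (2 * k) * ?v k =
      2 powr \<alpha> * Gamma (\<alpha> + 1) * \<epsilon> powr (- (\<alpha> + 1)) * ((- s\<^sup>2 / (2 * \<epsilon>)) ^ k / fact k)" for k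
  proof -
    have 1: "2 powr (real k + \<alpha>) = 2 ^ k * 2 powr \<alpha>" by (simp add: powr_add powr_realpow)
    have 2: "\<epsilon> powr (\<alpha> + real k + 1) = \<epsilon> ^ k * \<epsilon> powr (\<alpha> + 1)"
      using \<epsilon> by (simp add: powr_add powr_realpow)
    have 3: "(4::real) ^ k = 2 ^ k * 2 ^ k" by (simp add: power_mult_distrib[symmetric])
    have 4: "(- s\<^sup>2 / (2 * \<epsilon>)) ^ k = (- 1) ^ k * s ^ (2 * k) / (2 ^ k * \<epsilon> ^ k)"
    proof -
      have "- s\<^sup>2 / (2 * \<epsilon>) = (- 1) * s\<^sup>2 / (2 * \<epsilon>)" by simp
      then show ?thesis by (simp only: power_divide power_mult_distrib power_mult)
    qed
    have "Gamma (\<alpha> + real k + 1) \<noteq> 0" using Gamma_pos(3)[of k] by linarith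
    then show ?thesis using \<epsilon> unfolding bessel_coeff_def 1 2 3 4 powr_minus
        by (simp add: field_simps)
  qed
  have "(\<lambda>k. integral\<^sup>L lborel (?f k)) sums (LINT t|lborel. (\<Sum>k. ?f k t))"
  proof (rule sums_integral)
    show "integrable lborel (?f k)" for k by (intro integrable_mult_right int)
    show "AE t in lborel. summable (\<lambda>k. norm (?f k t))"
    proof (rule AE_I2)
      fix t
      have "summable (\<lambda>k. \<bar>bessel_coeff k * (t * s) ^ (2 * k)\<bar> * \<bar>?w t\<bar>)"
        by (intro summable_mult2 summable_abs_bessel_series)
      then show "summable (\<lambda>k. norm (?f k t))" by (simp add: abs_mult power_mult_distrib mult_ac)
    qed
    \<comment> \<open>Absolute values only remove the sign, so the norms form the exponential series
      at s^2 / (2\<epsilon>), which justifies the interchange.\<close>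
    have "(LINT t|lborel. norm (?f k t))
        = 2 powr \<alpha> * Gamma (\<alpha> + 1) * \<epsilon> powr (- (\<alpha> + 1)) * ((s\<^sup>2 / (2 * \<epsilon>)) ^ k / fact k)" for k
    proof -
      have "(LINT t|lborel. norm (?f k t))
          = (LINT t|lborel. \<bar>bessel_coeff k * s ^ (2 * k)\<bar> * (t ^ (2 * k) * ?w t))"
        by (intro Bochner_Integration.integral_cong refl) (simp add: abs_mult power_mult)
      also have "\<dots> = \<bar>bessel_coeff k * s ^ (2 * k) * ?v k\<bar>"
        by (simp only: integral_mult_right_zero lint abs_mult abs_of_nonneg[OF v])
      also have "\<dots> = 2 powr \<alpha> * Gamma (\<alpha> + 1) * \<epsilon> powr (- (\<alpha> + 1)) * ((s\<^sup>2 / (2 * \<epsilon>)) ^ k / fact k)"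
        using \<epsilon> Gamma_pos(1) unfolding term_eq by (simp add: abs_mult power_abs abs_of_pos)
      finally show ?thesis .
    qed
    moreover have "summable (\<lambda>k. 2 powr \<alpha> * Gamma (\<alpha> + 1) * \<epsilon> powr (- (\<alpha> + 1)) * ((s\<^sup>2 / (2
        * \<epsilon>)) ^ k / fact k))"
      unfolding exp_term by (intro summable_mult summable_exp_generic)
    ultimately show "summable (\<lambda>k. LINT t|lborel. norm (?f k t))" by simp
  qed
  moreover have "(\<Sum>k. ?f k t) = normalized_bessel \<alpha> (t * s) * ?w t" for t
  proof -
    have "(\<lambda>k. bessel_coeff k * (t * s) ^ (2 * k) * ?w t) sums (normalized_bessel \<alpha> (t * s) * ?w t)"
      by (intro sums_mult2 bessel_sums)
    then show ?thesis by (simp add: sums_iff power_mult_distrib mult_ac)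
  qed
  moreover have "integral\<^sup>L lborel (?f k)
      = 2 powr \<alpha> * Gamma (\<alpha> + 1) * \<epsilon> powr (- (\<alpha> + 1)) * ((- s\<^sup>2 / (2 * \<epsilon>)) ^ k / fact k)" for k
    by (simp only: integral_mult_right_zero lint term_eq)
  moreover have "(\<lambda>k. 2 powr \<alpha> * Gamma (\<alpha> + 1) * \<epsilon> powr (- (\<alpha> + 1)) * ((- s\<^sup>2 / (2
      * \<epsilon>)) ^ k / fact k)) sums
      (2 powr \<alpha> * Gamma (\<alpha> + 1) * \<epsilon> powr (- (\<alpha> + 1)) * exp (- s\<^sup>2 / (2 * \<epsilon>)))"
    unfolding exp_term by (intro sums_mult exp_converges)
  ultimately show "(LINT t|lborel. normalized_bessel \<alpha> (t * s) * ?w t) =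
      2 powr \<alpha> * Gamma (\<alpha> + 1) * \<epsilon> powr (- (\<alpha> + 1)) * exp (- s\<^sup>2 / (2 * \<epsilon>))"
    by (simp add: sums_iff)
qed

subsection \<open>The kernel and Gaussians\<close>

abbreviation kernel :: "(real ^ 'd::finite) \<times> real \<Rightarrow> (real ^ 'd) \<times> real \<Rightarrow> complex" where
  "kernel \<equiv> weinstein_kernel \<alpha>"

lemma norm_kernel_le: "norm (kernel \<xi> x) \<le> 1"
proof -
  have "norm (exp (- \<i> * complex_of_real r)) = 1" for r
    by (metis norm_exp_i_times of_real_minus mult_minus_left mult_minus_right)
  then show ?thesis
    using abs_normalized_bessel_le[of "snd x * snd \<xi>"]
    by (simp add: weinstein_kernel_def norm_mult)
qed

lemma kernel_commute: "kernel \<xi> x = kernel x \<xi>"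
  by (simp add: weinstein_kernel_def inner_commute mult.commute)

lemma cnj_kernel: "cnj (kernel \<xi> x) = kernel (reflect \<xi>) x"
  by (simp add: weinstein_kernel_def exp_cnj)

lemma kernel_reflect_commute: "kernel \<xi> (reflect x) = kernel (reflect \<xi>) x"
  by (simp add: weinstein_kernel_def)

lemma kernel_snd_minus: "kernel (b, - t) x = kernel (b, t) x"
  by (simp add: weinstein_kernel_def)

lemma continuous_on_kernel [continuous_intros]:
  "continuous_on A f \<Longrightarrow> continuous_on A g \<Longrightarrow> continuous_on A (\<lambda>x. kernel (f x) (g x))"
  unfolding weinstein_kernel_def by (intro continuous_intros) auto

lemma kernel_measurable [measurable (raw)]:
  assumes [measurable]: "f \<in> borel_measurable N" "g \<in> borel_measurable N"
  shows "(\<lambda>x. kernel (f x) (g x)) \<in> borel_measurable N"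
  unfolding weinstein_kernel_def by measurable

text \<open>Horizontally the shift is a sum, on which the exponential is multiplicative. Vertically
  this is \<open>bessel_product\<close> after scaling the triangle by the last coordinate of
  \<xi>.\<close>

lemma kernel_product:
  assumes "x \<in> half_space" "y \<in> half_space"
  shows "(LINT \<theta>|angle_measure. kernel \<xi> (shift_point x y \<theta>)) = kernel \<xi> x * kernel \<xi> y"
proof -
  have nn: "0 \<le> snd x" "0 \<le> snd y" using assms by (auto simp: half_space_def)
  \<comment> \<open>The product formula asks for nonnegative arguments; evenness of the Bessel
    function allows the absolute value.\<close>
  let ?l = "\<bar>snd \<xi>\<bar>"
  have abs: "normalized_bessel \<alpha> (t * snd \<xi>) = normalized_bessel \<alpha> (t * ?l)" for t
    by (cases "0 \<le> snd \<xi>") simp_all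
  have "(snd x * ?l)\<^sup>2 + (snd y * ?l)\<^sup>2 + 2 * (snd x * ?l) * (snd y * ?l) * cos \<theta> =
     ((snd x)\<^sup>2 + (snd y)\<^sup>2 + 2 * snd x * snd y * cos \<theta>) * ?l\<^sup>2" for \<theta>
    by (simp add: power2_eq_square algebra_simps)
  then have "sqrt ((snd x * ?l)\<^sup>2 + (snd y * ?l)\<^sup>2 + 2 * (snd x * ?l) * (snd y * ?l) * cos \<theta>)
    = sqrt ((snd x)\<^sup>2 + (snd y)\<^sup>2 + 2 * snd x * snd y * cos \<theta>) * ?l" for \<theta>
    by (simp only: real_sqrt_mult) simp
  then have *: "normalized_bessel \<alpha> (snd x * ?l) * normalized_bessel \<alpha> (snd y * ?l) =
     (LINT \<theta>|angle_measure. normalized_bessel \<alpha> (sqrt ((snd x)\<^sup>2 + (snd y)\<^sup>2 + 2 * snd x * snd y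
         * cos \<theta>) * ?l))"
    using bessel_product[of "snd x * ?l" "snd y * ?l"] nn by simp
  have "(LINT \<theta>|angle_measure. kernel \<xi> (shift_point x y \<theta>)) =
     exp (- \<i> * complex_of_real ((fst x + fst y) \<bullet> fst \<xi>)) *
       complex_of_real (LINT \<theta>|angle_measure. normalized_bessel \<alpha> (sqrt ((snd x)\<^sup>2 + (snd y)\<^sup>2 + 2
           * snd x * snd y * cos \<theta>) * ?l))"
    unfolding weinstein_kernel_def shift_point_def fst_conv snd_conv abs
    by (simp only: integral_mult_right_zero integral_complex_of_real)
  also have "\<dots> = kernel \<xi> x * kernel \<xi> y"
    unfolding *[symmetric] weinstein_kernel_def abs
    by (simp add: inner_add_left distrib_left exp_add exp_diff exp_minus divide_inverse mult_ac)
  finally show ?thesis .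
qed

text \<open>The parameter is an inverse variance. For small \<epsilon>,
  \<open>gauss \<epsilon>\<close> is a wide cutoff tending to 1, while
  \<open>gauss (1 / \<epsilon>)\<close> concentrates at the origin.\<close>

definition gauss :: "real \<Rightarrow> (real ^ 'd::finite) \<times> real \<Rightarrow> real" where
  "gauss \<epsilon> x = exp (- \<epsilon> * (norm x)\<^sup>2 / 2)"

lemma gauss_pos [simp]: "0 < gauss \<epsilon> x" and gauss_nonneg [simp]: "0 \<le> gauss \<epsilon> x"
  by (simp_all add: gauss_def)

lemma gauss_le_1: "0 \<le> \<epsilon> \<Longrightarrow> gauss \<epsilon> x \<le> 1"
  by (simp add: gauss_def)

lemma gauss_reflect [simp]: "gauss \<epsilon> (reflect x) = gauss \<epsilon> x"
  by (simp add: gauss_def)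

lemma continuous_on_gauss [continuous_intros]:
  "continuous_on A f \<Longrightarrow> continuous_on A (\<lambda>x. gauss \<epsilon> (f x))"
  unfolding gauss_def by (intro continuous_intros) auto

lemma gauss_measurable [measurable]: "gauss \<epsilon> \<in> borel_measurable borel"
  by (intro borel_measurable_continuous_onI continuous_intros)

lemma gauss_eq: "gauss \<epsilon> (b, t) = exp (- \<epsilon> * (norm b)\<^sup>2 / 2) * exp (- \<epsilon> * t\<^sup>2 / 2)"
proof -
  have "- \<epsilon> * ((norm b)\<^sup>2 + t\<^sup>2) / 2 = - \<epsilon> * (norm b)\<^sup>2 / 2 + - \<epsilon> * t\<^sup>2 / 2"
    by (simp add: field_simps)
  then show ?thesis by (simp only: gauss_def norm_prod_def fst_conv snd_conv exp_add[symmetric])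
      simp
qed

lemma lebesgue_integral_weinstein:
  fixes f :: "(real ^ 'd::finite) \<times> real \<Rightarrow> complex"
  assumes [measurable]: "f \<in> borel_measurable borel"
  shows "integrable \<mu> f
      \<longleftrightarrow> integrable lborel (\<lambda>x. (indicator {0<..} (snd x) * weinstein_weight TYPE('d)
          (snd x)) *\<^sub>R f x)"
    and "(LINT x|\<mu>. f x) = (LINT x|lborel. (indicator {0<..} (snd x) * weinstein_weight TYPE('d)
        (snd x)) *\<^sub>R f x)"
proof -
  have ind: "indicator half_space x = (indicator {0<..} (snd x) :: real)"
      for x :: "(real ^ 'd) \<times> real"
    by (simp add: indicator_def half_space_def)
  show "integrable \<mu> f
      \<longleftrightarrow> integrable lborel (\<lambda>x. (indicator {0<..} (snd x) * weinstein_weight TYPE('d)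
          (snd x)) *\<^sub>R f x)"
    unfolding weinstein_eq_density
    by (subst integrable_density) (auto intro!: measurable_restrict_space1 simp:
        integrable_restrict_space ind)
  show "(LINT x|\<mu>. f x) = (LINT x|lborel. (indicator {0<..} (snd x) * weinstein_weight TYPE('d)
      (snd x)) *\<^sub>R f x)"
    unfolding weinstein_eq_density
    by (subst integral_density) (auto intro!: measurable_restrict_space1 simp:
        integral_restrict_space ind)
qed

text \<open>The integral separates into a horizontal Fourier integral and a vertical Bessel
  integral. Their constants cancel the normalisation of the measure, so that \<open>gauss 1\<close>
  is its own transform.\<close>

theorem gauss_transform:
  fixes \<xi> :: "(real ^ 'd::finite) \<times> real"
  assumes \<epsilon>: "0 < \<epsilon>"
  shows "integrable \<mu> (\<lambda>x :: (real ^ 'd) \<times> real. gauss \<epsilon> x)"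
    and "(LINT x|\<mu>. complex_of_real (gauss \<epsilon> x) * kernel \<xi> x) =
      complex_of_real (\<epsilon> powr (- hom_dim TYPE('d) / 2) * gauss (1 / \<epsilon>) \<xi>)"
proof -
  let ?w = "\<lambda>t. indicator {0<..} t * weinstein_weight TYPE('d) t"
  let ?K = "(2 * pi) powr (real CARD('d) / 2) * 2 powr \<alpha> * Gamma (\<alpha> + 1)"
  let ?p = "\<lambda>(\<xi> :: (real ^ 'd) \<times> real) b. exp (- \<i> * complex_of_real (b \<bullet> fst \<xi>))
      * complex_of_real (exp (- \<epsilon> * (norm b)\<^sup>2 / 2))"
  let ?u = "\<lambda>t. indicator {0<..} t * (t powr (2 * \<alpha> + 1) * exp (- \<epsilon> * t\<^sup>2 / 2))"
  let ?q = "\<lambda>(\<xi> :: (real ^ 'd) \<times> real) t. complex_of_real (normalized_bessel \<alpha> (t * snd \<xi>)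
      * (?u t / ?K))"
  have split: "?w (snd x) *\<^sub>R (complex_of_real (gauss \<epsilon> x) * kernel \<xi> x)
      = ?p \<xi> (fst x) * ?q \<xi> (snd x)" for \<xi> x :: "(real ^ 'd) \<times> real"
    by (cases x) (simp add: weinstein_kernel_def gauss_eq weinstein_weight_def scaleR_conv_of_real)
  have p: "integrable lborel (?p \<xi>)" for \<xi> :: "(real ^ 'd) \<times> real"
  \<comment> \<open>A function that is not integrable has Bochner integral 0, whereas the value
    already computed is nonzero.\<close>
  proof (rule ccontr)
    assume "\<not> integrable lborel (?p \<xi>)"
    then have "integral\<^sup>L lborel (?p \<xi>) = 0" by (rule not_integrable_integral_eq)
    then show False unfolding integral_gaussian_cis_vec[OF \<epsilon>] using \<epsilon> by simp
  qed
  have q: "integrable lborel (?q \<xi>)" for \<xi> :: "(real ^ 'd) \<times> real"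
  proof (rule Bochner_Integration.integrable_bound)
    show "integrable lborel (\<lambda>t. ?u t / ?K)" using bessel_gaussian(1)[OF \<epsilon>] by simp
    show "AE t in lborel. norm (?q \<xi> t) \<le> norm (?u t / ?K)"
      unfolding norm_of_real abs_mult real_norm_def
      by (intro AE_I2 mult_left_le_one_le abs_normalized_bessel_le) auto
  qed measurable
  have "integrable lborel (\<lambda>x. ?w (snd x) *\<^sub>R (complex_of_real (gauss \<epsilon> x) * kernel (0 ::
      (real ^ 'd) \<times> real) x))"
    unfolding split by (rule integral_lborel_product(1)[OF p q])
  moreover have "kernel (0 :: (real ^ 'd) \<times> real) x = 1" for x
    using bessel_sums[of 0] angle.prob_space
        by (simp add: weinstein_kernel_def normalized_bessel_eq)
  ultimately have "integrable lborel (\<lambda>x :: (real ^ 'd) \<times> real. ?w (snd x) *\<^sub>R complex_of_real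
      (gauss \<epsilon> x))" by simp
  then have "integrable \<mu> (\<lambda>x :: (real ^ 'd) \<times> real. complex_of_real (gauss \<epsilon> x))"
    by (subst lebesgue_integral_weinstein) auto
  then show "integrable \<mu> (\<lambda>x :: (real ^ 'd) \<times> real. gauss \<epsilon> x)"
      by (simp only: complex_of_real_integrable_eq)
  have "(LINT x|\<mu>. complex_of_real (gauss \<epsilon> x) * kernel \<xi> x)
      = (LINT x|lborel. ?p \<xi> (fst x) * ?q \<xi> (snd x))"
    unfolding split[symmetric] by (rule lebesgue_integral_weinstein(2)) measurable
  also have "\<dots> = integral\<^sup>L lborel (?p \<xi>) * integral\<^sup>L lborel (?q \<xi>)"
    by (rule integral_lborel_product(2)[OF p q])
  also have "integral\<^sup>L lborel (?q \<xi>) = complex_of_real (2 powr \<alpha> * Gamma (\<alpha> + 1) * \<epsilon> powr (- (\<alpha>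
      + 1)) * exp (- (snd \<xi>)\<^sup>2 / (2 * \<epsilon>)) / ?K)"
    unfolding bessel_gaussian(2)[OF \<epsilon>, of "snd \<xi>", symmetric] integral_complex_of_real by simp
  also have "integral\<^sup>L lborel (?p \<xi>) = complex_of_real ((2 * pi / \<epsilon>) powr (real CARD('d) / 2)
      * exp (- (norm (fst \<xi>))\<^sup>2 / (2 * \<epsilon>)))"
    by (rule integral_gaussian_cis_vec[OF \<epsilon>])
  also have "complex_of_real ((2 * pi / \<epsilon>) powr (real CARD('d) / 2) * exp (- (norm (fst \<xi>))\<^sup>2 / (2
      * \<epsilon>))) *
     complex_of_real (2 powr \<alpha> * Gamma (\<alpha> + 1) * \<epsilon> powr (- (\<alpha> + 1)) * exp (- (snd \<xi>)\<^sup>2 / (2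
         * \<epsilon>)) / ?K)
    = complex_of_real (\<epsilon> powr (- hom_dim TYPE('d) / 2) * gauss (1 / \<epsilon>) \<xi>)"
  proof -
    have 1: "\<epsilon> powr (- hom_dim TYPE('d) / 2) = \<epsilon> powr (- (\<alpha> + 1)) / \<epsilon> powr (real CARD('d) / 2)"
      by (simp add: hom_dim_def powr_diff[symmetric]) (simp add: field_simps)
    have 2: "gauss (1 / \<epsilon>) \<xi> = exp (- (norm (fst \<xi>))\<^sup>2 / (2 * \<epsilon>)) * exp (- (snd \<xi>)\<^sup>2 / (2 * \<epsilon>))"
      using gauss_eq[of "1 / \<epsilon>" "fst \<xi>" "snd \<xi>"] by (simp add: mult.commute)
    have 3: "(2 * pi / \<epsilon>) powr (real CARD('d) / 2)
        = (2 * pi) powr (real CARD('d) / 2) / \<epsilon> powr (real CARD('d) / 2)"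
      using \<epsilon> by (simp add: powr_divide)
    show ?thesis unfolding 1 2 3 using Gamma_pos(1)
      by (simp only: of_real_mult[symmetric], intro arg_cong[of _ _ complex_of_real])
          (simp add: field_simps)
  qed
  finally show "(LINT x|\<mu>. complex_of_real (gauss \<epsilon> x) * kernel \<xi> x) =
      complex_of_real (\<epsilon> powr (- hom_dim TYPE('d) / 2) * gauss (1 / \<epsilon>) \<xi>)" .
qed

subsection \<open>Square integrable functions\<close>

text \<open>The squared norm, kept without the root so that bounds on integrands pass directly to
  it. The root is restored only in the final limit.\<close>

definition sqnorm :: "((real ^ 'd::finite) \<times> real \<Rightarrow> complex) \<Rightarrow> real" where
  "sqnorm f = (LINT x|\<mu>. (cmod (f x))\<^sup>2)"

lemma sqnorm_nonneg [simp]: "0 \<le> sqnorm f"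
  by (simp add: sqnorm_def)

lemma L2_norm_eq: "L2_norm \<alpha> f = sqrt (sqnorm f)"
  by (simp add: L2_norm_def sqnorm_def)

lemma L2_measurable: "f \<in> L2 \<alpha> \<Longrightarrow> f \<in> borel_measurable \<mu>"
  and L2_integrable: "f \<in> L2 \<alpha> \<Longrightarrow> integrable \<mu> (\<lambda>x. (cmod (f x))\<^sup>2)"
  by (simp_all add: L2_def)

lemma nn_integral_sqnorm: "f \<in> L2 \<alpha> \<Longrightarrow> (\<integral>\<^sup>+x. ennreal ((cmod (f x))\<^sup>2) \<partial>\<mu>) = ennreal (sqnorm f)"
  unfolding sqnorm_def by (intro nn_integral_eq_integral L2_integrable) auto

text \<open>Membership comes first: a bound on the Bochner integral would not show it, since that
  integral is 0 for functions that are not integrable.\<close>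

lemma L2I_nn_integral:
  assumes "f \<in> borel_measurable \<mu>" "(\<integral>\<^sup>+x. ennreal ((cmod (f x))\<^sup>2) \<partial>\<mu>) \<le> ennreal c" "0 \<le> c"
  shows "f \<in> L2 \<alpha>" "sqnorm f \<le> c"
proof -
  have "(\<integral>\<^sup>+x. ennreal ((cmod (f x))\<^sup>2) \<partial>\<mu>) < \<infinity>"
    using assms(2) by (rule le_less_trans) simp
  then show f: "f \<in> L2 \<alpha>"
    using assms(1) by (auto simp: L2_def intro!: integrableI_nonneg)
  show "sqnorm f \<le> c" using assms nn_integral_sqnorm[OF f] by simp
qed

lemma L2_bound:
  assumes "f \<in> borel_measurable \<mu>" "integrable \<mu> h" "AE x in \<mu>. (cmod (f x))\<^sup>2 \<le> h x"
  shows "f \<in> L2 \<alpha>"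
  using assms by (auto simp: L2_def intro!: Bochner_Integration.integrable_bound[OF assms(2)]
      elim!: eventually_mono)

lemma cmod_diff_sq_le: "(cmod (a - b))\<^sup>2 \<le> 2 * (cmod a)\<^sup>2 + 2 * (cmod b)\<^sup>2"
proof -
  have "(cmod (a - b))\<^sup>2 \<le> (cmod a + cmod b)\<^sup>2"
    by (intro power_mono norm_triangle_ineq4) auto
  also have "\<dots> \<le> 2 * (cmod a)\<^sup>2 + 2 * (cmod b)\<^sup>2"
    using zero_le_power2[of "cmod a - cmod b"] by (simp add: power2_eq_square algebra_simps)
  finally show ?thesis .
qed

lemma L2_diff:
  assumes "f \<in> L2 \<alpha>" "g \<in> L2 \<alpha>"
  shows "(\<lambda>x. f x - g x) \<in> L2 \<alpha>"
    and "sqnorm (\<lambda>x. f x - g x) \<le> 2 * sqnorm f + 2 * sqnorm g"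
proof -
  note [measurable] = L2_measurable[OF assms(1)] L2_measurable[OF assms(2)]
  note int = L2_integrable[OF assms(1)] L2_integrable[OF assms(2)]
  show fg: "(\<lambda>x. f x - g x) \<in> L2 \<alpha>"
    by (rule L2_bound[where h = "\<lambda>x. 2 * (cmod (f x))\<^sup>2 + 2 * (cmod (g x))\<^sup>2"])
       (use int in \<open>auto simp: cmod_diff_sq_le\<close>)
  have "sqnorm (\<lambda>x. f x - g x) \<le> (LINT x|\<mu>. 2 * (cmod (f x))\<^sup>2 + 2 * (cmod (g x))\<^sup>2)"
    unfolding sqnorm_def using int by (intro integral_mono L2_integrable fg cmod_diff_sq_le) auto
  also have "\<dots> = 2 * sqnorm f + 2 * sqnorm g"
    unfolding sqnorm_def using int by simp
  finally show "sqnorm (\<lambda>x. f x - g x) \<le> 2 * sqnorm f + 2 * sqnorm g" .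
qed

lemma sqnorm_commute: "sqnorm (\<lambda>x. f x - g x) = sqnorm (\<lambda>x. g x - f x)"
  unfolding sqnorm_def by (simp add: norm_minus_commute)

text \<open>A triangle inequality for squares. The factor 2 is harmless where it is applied, namely
  to quantities that tend to zero or need only a fixed bound.\<close>

lemma sqnorm_triangle:
  assumes "f \<in> L2 \<alpha>" "g \<in> L2 \<alpha>" "h \<in> L2 \<alpha>"
  shows "sqnorm (\<lambda>x. f x - h x) \<le> 2 * sqnorm (\<lambda>x. f x - g x) + 2 * sqnorm (\<lambda>x. h x - g x)"
  using L2_diff(2)[OF L2_diff(1)[OF assms(1,2)] L2_diff(1)[OF assms(3,2)]] by simp

lemma L2_mult_bounded:
  assumes f: "f \<in> L2 \<alpha>" and g: "g \<in> borel_measurable \<mu>" "AE x in \<mu>. cmod (g x) \<le> C" and C: "0 \<le> C"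
  shows "(\<lambda>x. g x * f x) \<in> L2 \<alpha>" and "sqnorm (\<lambda>x. g x * f x) \<le> C\<^sup>2 * sqnorm f"
proof -
  note [measurable] = L2_measurable[OF f] g(1)
  have int: "integrable \<mu> (\<lambda>x. C\<^sup>2 * (cmod (f x))\<^sup>2)" using L2_integrable[OF f] by simp
  have le: "AE x in \<mu>. (cmod (g x * f x))\<^sup>2 \<le> C\<^sup>2 * (cmod (f x))\<^sup>2"
    using g(2) by eventually_elim (auto simp: norm_mult power_mult_distrib intro!: mult_right_mono
        power_mono)
  show gf: "(\<lambda>x. g x * f x) \<in> L2 \<alpha>" by (rule L2_bound[OF _ int le]) measurable
  have "sqnorm (\<lambda>x. g x * f x) \<le> (LINT x|\<mu>. C\<^sup>2 * (cmod (f x))\<^sup>2)"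
    unfolding sqnorm_def by (intro integral_mono_AE L2_integrable[OF gf] int le)
  then show "sqnorm (\<lambda>x. g x * f x) \<le> C\<^sup>2 * sqnorm f" by (simp add: sqnorm_def)
qed

lemma L2_cong_AE:
  assumes "f \<in> L2 \<alpha>" "g \<in> borel_measurable \<mu>" "AE x in \<mu>. g x = f x"
  shows "g \<in> L2 \<alpha>"
  by (rule L2_bound[OF assms(2) L2_integrable[OF assms(1)]]) (use assms(3) in eventually_elim, simp)

lemma sqnorm_cong_AE:
  assumes "f \<in> borel_measurable \<mu>" "g \<in> borel_measurable \<mu>" "AE x in \<mu>. f x = g x"
  shows "sqnorm f = sqnorm g"
  unfolding sqnorm_def using assms by (intro integral_cong_AE) auto

lemma L2_cnj: "f \<in> L2 \<alpha> \<Longrightarrow> (\<lambda>x. cnj (f x)) \<in> L2 \<alpha>"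
  by (auto simp: L2_def intro!: measurable_compose[OF _ borel_measurable_continuous_onI[OF
      continuous_on_cnj[OF continuous_on_id]]])

lemma L2_reflect:
  assumes f: "f \<in> L2 \<alpha>"
  shows "(\<lambda>x. f (reflect x)) \<in> L2 \<alpha>" and "sqnorm (\<lambda>x. f (reflect x)) = sqnorm f"
proof -
  note [measurable] = L2_measurable[OF f]
  have "integrable (distr \<mu> \<mu> reflect) (\<lambda>x. (cmod (f x))\<^sup>2)"
    unfolding distr_weinstein_reflect by (rule L2_integrable[OF f])
  then have "integrable \<mu> (\<lambda>x. (cmod (f (reflect x)))\<^sup>2)"
    by (subst (asm) integrable_distr_eq) auto
  then show "(\<lambda>x. f (reflect x)) \<in> L2 \<alpha>" unfolding L2_def by simp
  have "sqnorm f = (LINT x|distr \<mu> \<mu> reflect. (cmod (f x))\<^sup>2)"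
    unfolding sqnorm_def distr_weinstein_reflect ..
  also have "\<dots> = sqnorm (\<lambda>x. f (reflect x))"
    unfolding sqnorm_def by (intro integral_distr) measurable
  finally show "sqnorm (\<lambda>x. f (reflect x)) = sqnorm f" by simp
qed

lemma AE_weinstein_reflect:
  assumes "AE x in \<mu>. P x"
  shows "AE x in \<mu>. P (reflect x)"
proof -
  have "AE x in distr \<mu> \<mu> reflect. P x" unfolding distr_weinstein_reflect by (rule assms)
  then show ?thesis by (rule AE_distrD[OF measurable_reflect_weinstein])
qed

lemma integral_weinstein_reflect:
  fixes f :: "(real ^ 'd::finite) \<times> real \<Rightarrow> complex"
  assumes [measurable]: "f \<in> borel_measurable \<mu>"
  shows "(LINT x|\<mu>. f (reflect x)) = (LINT x|\<mu>. f x)"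
proof -
  have "(LINT x|\<mu>. f x) = (LINT x|distr \<mu> \<mu> reflect. f x)" unfolding distr_weinstein_reflect ..
  also have "\<dots> = (LINT x|\<mu>. f (reflect x))" by (intro integral_distr) measurable
  finally show ?thesis by simp
qed

lemma L2_mult_integrable:
  assumes f: "f \<in> L2 \<alpha>" and g: "g \<in> L2 \<alpha>"
  shows "integrable \<mu> (\<lambda>x. f x * g x)"
proof (rule Bochner_Integration.integrable_bound)
  show "integrable \<mu> (\<lambda>x. (cmod (f x))\<^sup>2 + (cmod (g x))\<^sup>2)"
    using L2_integrable[OF f] L2_integrable[OF g] by simp
  show "AE x in \<mu>. norm (f x * g x) \<le> norm ((cmod (f x))\<^sup>2 + (cmod (g x))\<^sup>2)"
  proof (rule AE_I2)
    fix x
    have "2 * (cmod (f x) * cmod (g x)) \<le> (cmod (f x))\<^sup>2 + (cmod (g x))\<^sup>2"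
      using zero_le_power2[of "cmod (f x) - cmod (g x)"]
          by (simp add: power2_eq_square algebra_simps)
    moreover have "0 \<le> cmod (f x) * cmod (g x)" by simp
    ultimately have "cmod (f x) * cmod (g x) \<le> (cmod (f x))\<^sup>2 + (cmod (g x))\<^sup>2" by linarith
    then show "norm (f x * g x) \<le> norm ((cmod (f x))\<^sup>2 + (cmod (g x))\<^sup>2)"
      by (simp add: norm_mult)
  qed
qed (intro borel_measurable_times L2_measurable f g)

text \<open>The weight \<open>c\<close> replaces the Cauchy--Schwarz inequality in limit arguments.\<close>

lemma L2_mult_bound:
  assumes f: "f \<in> L2 \<alpha>" and g: "g \<in> L2 \<alpha>" and c: "0 < c"
  shows "cmod (LINT x|\<mu>. f x * g x) \<le> c * sqnorm g + sqnorm f / c"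
proof -
  have "cmod (LINT x|\<mu>. f x * g x) \<le> (LINT x|\<mu>. cmod (f x * g x))"
    by (rule integral_norm_bound)
  also have "\<dots> \<le> (LINT x|\<mu>. c * (cmod (g x))\<^sup>2 + (cmod (f x))\<^sup>2 / c)"
  proof (intro integral_mono)
    fix x
    have "2 * (cmod (f x) * cmod (g x)) * c \<le> (c * cmod (g x))\<^sup>2 + (cmod (f x))\<^sup>2"
      using zero_le_power2[of "c * cmod (g x) - cmod (f x)"]
          by (simp add: power2_eq_square algebra_simps)
    moreover have "0 \<le> cmod (f x) * cmod (g x) * c" using c by simp
    ultimately have "cmod (f x) * cmod (g x) * c \<le> (c * cmod (g x))\<^sup>2 + (cmod (f x))\<^sup>2" by linarith
    then show "cmod (f x * g x) \<le> c * (cmod (g x))\<^sup>2 + (cmod (f x))\<^sup>2 / c"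
      using c by (simp add: norm_mult field_simps power2_eq_square)
  qed (use L2_mult_integrable[OF f g] L2_integrable[OF f] L2_integrable[OF g] in auto)
  also have "\<dots> = c * sqnorm g + sqnorm f / c"
    unfolding sqnorm_def using L2_integrable[OF f] L2_integrable[OF g] by simp
  finally show ?thesis .
qed

lemma L2_tendsto_iff:
  "L2_tendsto \<alpha> s f \<longleftrightarrow> f \<in> L2 \<alpha> \<and> (\<forall>n. s n \<in> L2 \<alpha>) \<and> (\<lambda>n. sqnorm (\<lambda>x. s n x - f x)) \<longlonglongrightarrow> 0"
proof -
  have "(\<lambda>n. sqrt (a n)) \<longlonglongrightarrow> 0 \<longleftrightarrow> a \<longlonglongrightarrow> 0" if "\<And>n. 0 \<le> a n" for a :: "nat \<Rightarrow> real"
  proof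
    assume "(\<lambda>n. sqrt (a n)) \<longlonglongrightarrow> 0"
    then have "(\<lambda>n. (sqrt (a n))\<^sup>2) \<longlonglongrightarrow> 0\<^sup>2" by (rule tendsto_power)
    then show "a \<longlonglongrightarrow> 0" using that by simp
  next
    assume "a \<longlonglongrightarrow> 0"
    then have "(\<lambda>n. sqrt (a n)) \<longlonglongrightarrow> sqrt 0" by (rule tendsto_real_sqrt)
    then show "(\<lambda>n. sqrt (a n)) \<longlonglongrightarrow> 0" by simp
  qed
  then show ?thesis by (simp add: L2_tendsto_def L2_norm_eq)
qed

text \<open>By Fatou's lemma the squared distance of the two limits is at most the lower limit of
  the squared distances of \<open>s n\<close> to \<open>f\<close>, which is zero.\<close>

lemma L2_tendsto_AE_unique:
  assumes s: "L2_tendsto \<alpha> s f" and g: "g \<in> borel_measurable \<mu>"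
    and lim: "AE x in \<mu>. (\<lambda>n. s n x) \<longlonglongrightarrow> g x"
  shows "AE x in \<mu>. f x = g x"
proof -
  have f: "f \<in> L2 \<alpha>" and sn: "\<And>n. s n \<in> L2 \<alpha>" and to0: "(\<lambda>n. sqnorm (\<lambda>x. s n x - f x)) \<longlonglongrightarrow> 0"
    using s by (auto simp: L2_tendsto_iff)
  note [measurable] = L2_measurable[OF f] L2_measurable[OF sn] g
  have "(\<integral>\<^sup>+x. ennreal ((cmod (g x - f x))\<^sup>2) \<partial>\<mu>)
      = (\<integral>\<^sup>+x. liminf (\<lambda>n. ennreal ((cmod (s n x - f x))\<^sup>2)) \<partial>\<mu>)"
  proof (rule nn_integral_cong_AE, use lim in eventually_elim)
    fix x assume "(\<lambda>n. s n x) \<longlonglongrightarrow> g x"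
    then have "(\<lambda>n. ennreal ((cmod (s n x - f x))\<^sup>2)) \<longlonglongrightarrow> ennreal ((cmod (g x - f x))\<^sup>2)"
      by (intro tendsto_intros)
    then show "ennreal ((cmod (g x - f x))\<^sup>2) = liminf (\<lambda>n. ennreal ((cmod (s n x - f x))\<^sup>2))"
      by (rule lim_imp_Liminf[OF trivial_limit_sequentially, symmetric])
  qed
  also have "\<dots> \<le> liminf (\<lambda>n. \<integral>\<^sup>+x. ennreal ((cmod (s n x - f x))\<^sup>2) \<partial>\<mu>)"
    by (rule nn_integral_liminf) measurable
  also have "\<dots> = liminf (\<lambda>n. ennreal (sqnorm (\<lambda>x. s n x - f x)))"
    by (simp add: nn_integral_sqnorm L2_diff f sn)
  also have "\<dots> = ennreal 0"
    by (rule lim_imp_Liminf[OF trivial_limit_sequentially tendsto_ennrealI[OF to0]])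
  finally have "(\<integral>\<^sup>+x. ennreal ((cmod (g x - f x))\<^sup>2) \<partial>\<mu>) = 0" by simp
  then have "AE x in \<mu>. ennreal ((cmod (g x - f x))\<^sup>2) = 0"
    by (subst (asm) nn_integral_0_iff_AE) auto
  then show ?thesis by eventually_elim simp
qed

lemma AE_eq_if_sqnorm_zero:
  assumes "f \<in> L2 \<alpha>" "g \<in> L2 \<alpha>" "sqnorm (\<lambda>x. f x - g x) = 0"
  shows "AE x in \<mu>. f x = g x"
proof -
  have "L2_tendsto \<alpha> (\<lambda>_. f) g" using assms by (simp add: L2_tendsto_iff)
  then have "AE x in \<mu>. g x = f x"
    by (rule L2_tendsto_AE_unique) (auto intro: L2_measurable assms)
  then show ?thesis by eventually_elim simp
qed

lemma L2_tendsto_sqnorm_le: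
  assumes "L2_tendsto \<alpha> s f" "L2_tendsto \<alpha> t g"
    and le: "\<And>n. sqnorm (\<lambda>x. s n x - t n x) \<le> c n" and c: "c \<longlonglongrightarrow> 0"
  shows "AE x in \<mu>. f x = g x"
proof (rule AE_eq_if_sqnorm_zero)
  show f: "f \<in> L2 \<alpha>" and g: "g \<in> L2 \<alpha>" using assms by (auto simp: L2_tendsto_iff)
  have s: "s n \<in> L2 \<alpha>" and t: "t n \<in> L2 \<alpha>" for n using assms by (auto simp: L2_tendsto_iff)
  let ?b = "\<lambda>n. 2 * (2 * c n + 2 * sqnorm (\<lambda>x. t n x - g x)) + 2 * sqnorm (\<lambda>x. s n x - f x)"
  have "sqnorm (\<lambda>x. f x - g x) \<le> ?b n" for n
  proof -
    have "sqnorm (\<lambda>x. f x - g x) \<le> 2 * sqnorm (\<lambda>x. f x - s n x) + 2 * sqnorm (\<lambda>x. g x - s n x)"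
      by (rule sqnorm_triangle[OF f s g])
    moreover have "sqnorm (\<lambda>x. g x - s n x)
        \<le> 2 * sqnorm (\<lambda>x. g x - t n x) + 2 * sqnorm (\<lambda>x. s n x - t n x)"
      by (rule sqnorm_triangle[OF g t s])
    moreover have "a \<le> 2 * (2 * z + 2 * d) + 2 * b"
      if "a \<le> 2 * b + 2 * y" "y \<le> 2 * d + 2 * e" "e \<le> z" for a b d e y z :: real
      using that by (simp add: algebra_simps)
    ultimately show ?thesis
      using le[of n] unfolding sqnorm_commute[of f "s n"] sqnorm_commute[of g "t n"] by blast
  qed
  moreover have "?b \<longlonglongrightarrow> 2 * (2 * 0 + 2 * 0) + 2 * 0"
    using assms c by (intro tendsto_intros) (auto simp: L2_tendsto_iff)
  ultimately have "sqnorm (\<lambda>x. f x - g x) \<le> 2 * (2 * 0 + 2 * 0) + 2 * 0"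
    by (intro LIMSEQ_le_const) auto
  then show "sqnorm (\<lambda>x. f x - g x) = 0" using sqnorm_nonneg[of "\<lambda>x. f x - g x"] by simp
qed

text \<open>This makes the choice in \<open>L2_extension\<close> harmless: two possible values along
  the same sequence differ on a null set only.\<close>

lemma L2_tendsto_unique:
  assumes "L2_tendsto \<alpha> s f" "L2_tendsto \<alpha> s g"
  shows "AE x in \<mu>. f x = g x"
  by (rule L2_tendsto_sqnorm_le[OF assms, where c = "\<lambda>_. 0"])
     (use assms in \<open>auto simp: L2_tendsto_iff sqnorm_def\<close>)

text \<open>Chosen representatives are exchanged for explicit functions in this way. Measurability
  must be assumed separately because agreement almost everywhere does not transfer it.\<close>

lemma L2_tendsto_cong_AE:
  assumes "L2_tendsto \<alpha> s f" "\<And>n. t n \<in> borel_measurable \<mu>" "\<And>n. AE x in \<mu>. t n x = s n x"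
    and "g \<in> borel_measurable \<mu>" "AE x in \<mu>. g x = f x"
  shows "L2_tendsto \<alpha> t g"
proof -
  have f: "f \<in> L2 \<alpha>" and s: "\<And>n. s n \<in> L2 \<alpha>" and lim: "(\<lambda>n. sqnorm (\<lambda>x. s n x - f x)) \<longlonglongrightarrow> 0"
    using assms(1) by (auto simp: L2_tendsto_iff)
  note [measurable] = L2_measurable[OF f] L2_measurable[OF s] assms(2,4)
  have "sqnorm (\<lambda>x. t n x - g x) = sqnorm (\<lambda>x. s n x - f x)" for n
    by (rule sqnorm_cong_AE) (measurable, use assms(3)[of n] assms(5) in eventually_elim, simp)
  with lim show ?thesis
    unfolding L2_tendsto_iff using L2_cong_AE[OF f assms(4,5)] L2_cong_AE[OF s assms(2,3)] by simp
qed

lemma L2_tendsto_integral_mult: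
  assumes "L2_tendsto \<alpha> s f" and h: "h \<in> L2 \<alpha>"
  shows "(\<lambda>n. LINT x|\<mu>. s n x * h x) \<longlonglongrightarrow> (LINT x|\<mu>. f x * h x)"
proof -
  have f: "f \<in> L2 \<alpha>" and s: "\<And>n. s n \<in> L2 \<alpha>" and lim: "(\<lambda>n. sqnorm (\<lambda>x. s n x - f x)) \<longlonglongrightarrow> 0"
    using assms(1) by (auto simp: L2_tendsto_iff)
  show ?thesis
  proof (rule LIMSEQ_I)
    fix e :: real assume e: "0 < e"
    \<comment> \<open>With this weight the term containing \<open>sqnorm h\<close> is at most e / 2,
      and the other one is below e / 2 once the distance of \<open>s n\<close> to \<open>f\<close>
      is below c e / 2. Adding 1 avoids division by zero when \<open>h\<close> vanishes.\<close>
    define c where "c = e / (2 * (sqnorm h + 1))"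
    have pos: "0 < sqnorm h + 1" by (simp add: add_nonneg_pos)
    have c: "0 < c" using e pos by (simp add: c_def)
    have "c * sqnorm h \<le> c * (sqnorm h + 1)" using c by simp
    also have "\<dots> = e / 2" using pos by (simp add: c_def field_simps)
    finally have ch: "c * sqnorm h \<le> e / 2" .
    have "eventually (\<lambda>n. sqnorm (\<lambda>x. s n x - f x) < c * e / 2) sequentially"
      using c e by (intro order_tendstoD(2)[OF lim]) auto
    then obtain N where N: "\<And>n. n \<ge> N \<Longrightarrow> sqnorm (\<lambda>x. s n x - f x) < c * e / 2"
      by (auto simp: eventually_sequentially)
    show "\<exists>N. \<forall>n\<ge>N. norm ((LINT x|\<mu>. s n x * h x) - (LINT x|\<mu>. f x * h x)) < e"
    proof (intro exI allI impI)
      fix n assume n: "N \<le> n"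
      have "(LINT x|\<mu>. s n x * h x) - (LINT x|\<mu>. f x * h x) = (LINT x|\<mu>. (s n x - f x) * h x)"
        by (simp add: left_diff_distrib Bochner_Integration.integral_diff L2_mult_integrable s f h)
      also have "cmod \<dots> \<le> c * sqnorm h + sqnorm (\<lambda>x. s n x - f x) / c"
        by (rule L2_mult_bound[OF L2_diff(1)[OF s f] h c])
      also have "sqnorm (\<lambda>x. s n x - f x) / c < e / 2"
        using N[OF n] c by (simp add: field_simps)
      finally show "norm ((LINT x|\<mu>. s n x * h x) - (LINT x|\<mu>. f x * h x)) < e" using ch by simp
    qed
  qed
qed

text \<open>Dominated convergence with majorant 4 |f|^2, the 4 coming from |a - b|^2 \<le> 2 |a|^2 +
  2 |b|^2. It serves for Gaussian cutoffs, for truncations to balls and for the Calderon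
  cutoffs.\<close>

lemma L2_tendsto_dominated:
  fixes f :: "(real ^ 'd::finite) \<times> real \<Rightarrow> complex"
  assumes f: "f \<in> L2 \<alpha>" and g: "\<And>n. g n \<in> borel_measurable \<mu>" "\<And>n x. x \<in> half_space \<Longrightarrow> cmod (g n x)
      \<le> 1"
    and lim: "\<And>x. x \<in> half_space \<Longrightarrow> (\<lambda>n. g n x) \<longlonglongrightarrow> 1"
  shows "L2_tendsto \<alpha> (\<lambda>n x. g n x * f x) f"
proof -
  note [measurable] = L2_measurable[OF f] g(1)
  have "(\<lambda>n. LINT x|\<mu>. (cmod (g n x * f x - f x))\<^sup>2)
      \<longlonglongrightarrow> (LINT x|(\<mu> :: ((real ^ 'd) \<times> real) measure). 0)"
  proof (rule integral_dominated_convergence[where w = "\<lambda>x. 4 * (cmod (f x))\<^sup>2"])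
    show "integrable \<mu> (\<lambda>x. 4 * (cmod (f x))\<^sup>2)" using L2_integrable[OF f] by simp
    show "AE x in \<mu>. (\<lambda>n. (cmod (g n x * f x - f x))\<^sup>2) \<longlonglongrightarrow> 0"
    proof (rule AE_I2)
      fix x assume "x \<in> space (\<mu> :: ((real ^ 'd) \<times> real) measure)"
      then have "(\<lambda>n. (cmod (g n x * f x - f x))\<^sup>2) \<longlonglongrightarrow> (cmod (1 * f x - f x))\<^sup>2"
        by (intro tendsto_intros lim) simp
      then show "(\<lambda>n. (cmod (g n x * f x - f x))\<^sup>2) \<longlonglongrightarrow> 0" by simp
    qed
    show "AE x in \<mu>. norm ((cmod (g n x * f x - f x))\<^sup>2) \<le> 4 * (cmod (f x))\<^sup>2" for n
    proof (rule AE_I2)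
      fix x assume "x \<in> space (\<mu> :: ((real ^ 'd) \<times> real) measure)"
      then have "(cmod (g n x * f x))\<^sup>2 \<le> (cmod (f x))\<^sup>2"
        using g(2)[of x n] by (auto simp: norm_mult intro!: power_mono mult_left_le_one_le)
      moreover have "norm ((cmod (g n x * f x - f x))\<^sup>2) = (cmod (g n x * f x - f x))\<^sup>2" by simp
      ultimately show "norm ((cmod (g n x * f x - f x))\<^sup>2) \<le> 4 * (cmod (f x))\<^sup>2"
        using cmod_diff_sq_le[of "g n x * f x" "f x"] by linarith
    qed
  qed measurable
  moreover have "(\<lambda>x. g n x * f x) \<in> L2 \<alpha>" for n
    by (rule L2_mult_bounded(1)[OF f g(1), of n 1]) (auto intro!: AE_I2 g(2))
  ultimately show ?thesis using f by (simp add: L2_tendsto_iff sqnorm_def)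
qed

lemma gauss_in_L2: "0 < \<epsilon> \<Longrightarrow> (\<lambda>x. complex_of_real (gauss \<epsilon> x)) \<in> L2 \<alpha>"
proof (rule L2_bound[where h = "gauss \<epsilon>"])
  assume \<epsilon>: "0 < \<epsilon>"
  show "integrable \<mu> (gauss \<epsilon>)" by (rule gauss_transform(1)[OF \<epsilon>])
  show "AE x in \<mu>. (cmod (complex_of_real (gauss \<epsilon> x)))\<^sup>2 \<le> gauss \<epsilon> x"
    using gauss_le_1[of \<epsilon>] \<epsilon> by (intro AE_I2) (simp add: power2_eq_square mult_left_le_one_le)
qed (intro borel_measurable_weinsteinI, measurable)

lemma gauss_tendsto_1: "(\<lambda>n. gauss (1 / real (Suc n)) x) \<longlonglongrightarrow> 1"
proof -
  have "(\<lambda>n. gauss (1 / real (Suc n)) x) \<longlonglongrightarrow> exp (- 0 * (norm x)\<^sup>2 / 2)"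
    unfolding gauss_def by (intro tendsto_intros LIMSEQ_Suc lim_1_over_n) auto
  then show ?thesis by simp
qed

lemma gauss_mult_integrable:
  "0 < \<epsilon> \<Longrightarrow> f \<in> L2 \<alpha> \<Longrightarrow> integrable \<mu> (\<lambda>x. complex_of_real (gauss \<epsilon> x) * f x)"
  by (intro L2_mult_integrable gauss_in_L2)

lemma gauss_approx:
  assumes "f \<in> L2 \<alpha>"
  shows "L2_tendsto \<alpha> (\<lambda>n x. complex_of_real (gauss (1 / real (Suc n)) x) * f x) f"
proof (rule L2_tendsto_dominated[OF assms])
  show "(\<lambda>x. complex_of_real (gauss (1 / real (Suc n)) x)) \<in> borel_measurable \<mu>" for n
    by (intro borel_measurable_weinsteinI) measurable
  show "cmod (complex_of_real (gauss (1 / real (Suc n)) x)) \<le> 1" for n and x :: "(real ^ 'd) \<times> real"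
    using gauss_le_1[of "1 / real (Suc n)" x] by simp
  show "(\<lambda>n. complex_of_real (gauss (1 / real (Suc n)) x)) \<longlonglongrightarrow> 1" for x :: "(real ^ 'd) \<times> real"
    using tendsto_of_real[OF gauss_tendsto_1[of x], where 'a = complex] by simp
qed

text \<open>Riesz-Fischer for sequences of geometric speed. Weighting the increments by 4^n against
  8^(-n) leaves a summable series of integrals, so almost everywhere the increments are eventually
  below 2^(-n) and the sequence converges pointwise. Fatou's lemma turns this into convergence in
  norm.\<close>

theorem L2_complete:
  fixes s :: "nat \<Rightarrow> (real ^ 'd::finite) \<times> real \<Rightarrow> complex"
  assumes s: "\<And>n. s n \<in> L2 \<alpha>" and fast: "\<And>n. sqnorm (\<lambda>x. s (Suc n) x - s n x) \<le> (1 / 8) ^ n"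
  shows "\<exists>g. L2_tendsto \<alpha> s g"
proof -
  note [measurable] = L2_measurable[OF s]
  let ?d = "\<lambda>n x. cmod (s (Suc n) x - s n x)"
  have d: "(\<lambda>x. s (Suc n) x - s n x) \<in> L2 \<alpha>" for n by (rule L2_diff[OF s s])
  have "(\<integral>\<^sup>+x. (\<Sum>n. ennreal (4 ^ n * (?d n x)\<^sup>2)) \<partial>\<mu>) = (\<Sum>n. \<integral>\<^sup>+x. ennreal (4 ^ n * (?d n x)\<^sup>2) \<partial>\<mu>)"
    by (rule nn_integral_suminf) measurable
  also have "\<dots> \<le> (\<Sum>n. ennreal ((1 / 2) ^ n))"
  proof (rule suminf_le)
    fix n
    have "(\<integral>\<^sup>+x. ennreal (4 ^ n * (?d n x)\<^sup>2) \<partial>\<mu>)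
        = ennreal (4 ^ n) * ennreal (sqnorm (\<lambda>x. s (Suc n) x - s n x))"
      unfolding nn_integral_sqnorm[OF d, symmetric]
      by (subst nn_integral_cmult[symmetric]) (auto simp: ennreal_mult)
    also have "\<dots> \<le> ennreal (4 ^ n * (1 / 8) ^ n)"
      using fast[of n] by (subst ennreal_mult[symmetric]) (auto intro!: ennreal_leI mult_left_mono)
    also have "(4 :: real) ^ n * (1 / 8) ^ n = (1 / 2) ^ n" by (simp flip: power_mult_distrib)
    finally show "(\<integral>\<^sup>+x. ennreal (4 ^ n * (?d n x)\<^sup>2) \<partial>\<mu>) \<le> ennreal ((1 / 2) ^ n)" .
  qed auto
  also have "\<dots> = ennreal (\<Sum>n. (1 / 2) ^ n)"
    by (rule suminf_ennreal2) (auto intro: summable_geometric)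
  also have "\<dots> < \<infinity>" by simp
  finally have "AE x in \<mu>. (\<Sum>n. ennreal (4 ^ n * (?d n x)\<^sup>2)) \<noteq> \<infinity>"
    by (intro nn_integral_PInf_AE) (auto simp: less_top)
  then have conv: "AE x in \<mu>. convergent (\<lambda>n. s n x)"
  proof eventually_elim
    fix x assume "(\<Sum>n. ennreal (4 ^ n * (?d n x)\<^sup>2)) \<noteq> \<infinity>"
    then have "summable (\<lambda>n. 4 ^ n * (?d n x)\<^sup>2)"
      by (intro summable_suminf_not_top) auto
    then have "(\<lambda>n. 4 ^ n * (?d n x)\<^sup>2) \<longlonglongrightarrow> 0" by (rule summable_LIMSEQ_zero)
    then have "eventually (\<lambda>n. 4 ^ n * (?d n x)\<^sup>2 < 1) sequentially"
      by (rule order_tendstoD(2)) simp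
    then obtain N where N: "\<And>n. n \<ge> N \<Longrightarrow> 4 ^ n * (?d n x)\<^sup>2 < 1"
      by (auto simp: eventually_sequentially)
    have "summable (\<lambda>n. s (Suc n) x - s n x)"
    proof (rule summable_comparison_test)
      have "norm (s (Suc n) x - s n x) \<le> (1 / 2) ^ n" if "N \<le> n" for n
      proof (rule power2_le_imp_le)
        have "(4 :: real) ^ n = (2 ^ n)\<^sup>2"
            by (simp add: power_mult[symmetric] mult.commute[of n] power_mult)
        then show "(norm (s (Suc n) x - s n x))\<^sup>2 \<le> ((1 / 2) ^ n)\<^sup>2"
          using N[OF that] by (simp add: power_divide field_simps)
      qed simp
      then show "\<exists>N. \<forall>n\<ge>N. norm (s (Suc n) x - s n x) \<le> (1 / 2) ^ n" by blast
    qed (simp add: summable_geometric)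
    then have "convergent (\<lambda>n. s 0 x + (\<Sum>i<n. s (Suc i) x - s i x))"
      by (intro convergent_add convergent_const) (simp add: summable_iff_convergent)
    moreover have "s 0 x + (\<Sum>i<n. s (Suc i) x - s i x) = s n x" for n
      using sum_lessThan_telescope[of "\<lambda>i. s i x" n] by simp
    ultimately show "convergent (\<lambda>n. s n x)" by (simp only:)
  qed
  define g where "g x = lim (\<lambda>n. s n x)" for x
  have [measurable]: "g \<in> borel_measurable \<mu>" unfolding g_def by measurable
  have lim: "AE x in \<mu>. (\<lambda>n. s n x) \<longlonglongrightarrow> g x"
    using conv by eventually_elim (simp add: g_def convergent_LIMSEQ_iff)
  \<comment> \<open>The constant 4 closes the induction on k: the step yields 2 * 4 / 8 + 2 = 3
    times 8^(-n).\<close>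
  have cauchy: "sqnorm (\<lambda>x. s (n + k) x - s n x) \<le> 4 * (1 / 8) ^ n" for n k
  proof (induction k arbitrary: n)
    case 0
    show ?case by (simp add: sqnorm_def)
  next
    case (Suc k)
    have "sqnorm (\<lambda>x. s (n + Suc k) x - s n x)
        \<le> 2 * sqnorm (\<lambda>x. s (n + Suc k) x - s (Suc n) x) + 2 * sqnorm (\<lambda>x. s n x - s (Suc n) x)"
      by (rule sqnorm_triangle[OF s s s])
    also have "\<dots> \<le> 2 * (4 * (1 / 8) ^ Suc n) + 2 * (1 / 8) ^ n"
      using Suc.IH[of "Suc n"] fast[of n] by (simp add: sqnorm_commute[of "s n" "s (Suc n)"])
    also have "\<dots> \<le> 4 * (1 / 8) ^ n" by simp
    finally show ?case .
  qed
  have gs: "(\<lambda>x. g x - s n x) \<in> L2 \<alpha>" "sqnorm (\<lambda>x. g x - s n x) \<le> 4 * (1 / 8) ^ n" for n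
  proof -
    have "(\<integral>\<^sup>+x. ennreal ((cmod (g x - s n x))\<^sup>2) \<partial>\<mu>)
        = (\<integral>\<^sup>+x. liminf (\<lambda>k. ennreal ((cmod (s (n + k) x - s n x))\<^sup>2)) \<partial>\<mu>)"
    proof (rule nn_integral_cong_AE, use lim in eventually_elim)
      fix x assume "(\<lambda>n. s n x) \<longlonglongrightarrow> g x"
      then have "(\<lambda>k. s (k + n) x) \<longlonglongrightarrow> g x" by (rule LIMSEQ_ignore_initial_segment)
      then have "(\<lambda>k. ennreal ((cmod (s (n + k) x - s n x))\<^sup>2)) \<longlonglongrightarrow> ennreal ((cmod (g x - s n x))\<^sup>2)"
        by (intro tendsto_intros) (simp add: add.commute)
      then show "ennreal ((cmod (g x - s n x))\<^sup>2)
          = liminf (\<lambda>k. ennreal ((cmod (s (n + k) x - s n x))\<^sup>2))"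
        by (rule lim_imp_Liminf[OF trivial_limit_sequentially, symmetric])
    qed
    also have "\<dots> \<le> liminf (\<lambda>k. \<integral>\<^sup>+x. ennreal ((cmod (s (n + k) x - s n x))\<^sup>2) \<partial>\<mu>)"
      by (rule nn_integral_liminf) measurable
    also have "\<dots> \<le> liminf (\<lambda>k :: nat. ennreal (4 * (1 / 8) ^ n))"
      by (intro Liminf_mono always_eventually allI) (simp only: nn_integral_sqnorm L2_diff s
          ennreal_leI cauchy)
    also have "\<dots> = ennreal (4 * (1 / 8) ^ n)" by (simp add: Liminf_const)
    finally have le: "(\<integral>\<^sup>+x. ennreal ((cmod (g x - s n x))\<^sup>2) \<partial>\<mu>) \<le> ennreal (4 * (1 / 8) ^ n)" .
    show "(\<lambda>x. g x - s n x) \<in> L2 \<alpha>" "sqnorm (\<lambda>x. g x - s n x) \<le> 4 * (1 / 8) ^ n"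
      by (rule L2I_nn_integral[OF _ le]; simp)+
  qed
  \<comment> \<open>Written with differences only, because \<open>L2_diff\<close> is the closure
    property at hand.\<close>
  have "(\<lambda>x. (g x - s 0 x) - (0 - s 0 x)) \<in> L2 \<alpha>"
    by (intro L2_diff gs s) (simp add: L2_def)
  then have "g \<in> L2 \<alpha>" by simp
  moreover have "(\<lambda>n. sqnorm (\<lambda>x. s n x - g x)) \<longlonglongrightarrow> 0"
  proof (rule tendsto_sandwich[OF _ _ tendsto_const])
    show "(\<lambda>n. 4 * (1 / 8) ^ n) \<longlonglongrightarrow> (0 :: real)"
      by (intro tendsto_mult_right_zero LIMSEQ_realpow_zero) auto
  qed (use gs(2) in \<open>auto simp: sqnorm_commute[where g = g]\<close>)
  ultimately show ?thesis using s by (auto simp: L2_tendsto_iff)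
qed

end

subsection \<open>The transform of integrable functions\<close>

text \<open>A bounded kernel leaves the product of two integrable functions jointly integrable. This
  covers the transform kernel, the heat kernel and the angular averages alike.\<close>

lemma Fubini_bounded_kernel:
  fixes f :: "'a \<Rightarrow> complex" and g :: "'b \<Rightarrow> complex"
  assumes "sigma_finite_measure M" "sigma_finite_measure N"
    and f: "integrable M f" and g: "integrable N g"
    and k: "case_prod k \<in> borel_measurable (M \<Otimes>\<^sub>M N)"
    and C: "\<And>x y. cmod (k x y) \<le> C"
  shows "(LINT y|N. g y * (LINT x|M. f x * k x y)) = (LINT x|M. f x * (LINT y|N. g y * k x y))"
proof -
  interpret pair_sigma_finite M N using assms(1,2) by (rule pair_sigma_finite.intro)
  have [measurable]: "f \<in> borel_measurable M" "g \<in> borel_measurable N"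
    using f g by auto
  note k [measurable]
  let ?h = "\<lambda>x y. f x * (g y * k x y)"
  have int: "integrable N (\<lambda>y. g y * k x y)" if "x \<in> space M" for x
  proof (rule Bochner_Integration.integrable_bound)
    show "integrable N (\<lambda>y. C * norm (g y))" using g by simp
    show "AE y in N. norm (g y * k x y) \<le> norm (C * norm (g y))"
    proof (rule AE_I2)
      fix y
      have "0 \<le> C" using order_trans[OF norm_ge_zero C] .
      moreover have "cmod (g y) * cmod (k x y) \<le> cmod (g y) * C" by (rule mult_left_mono[OF C]) simp
      ultimately show "norm (g y * k x y) \<le> norm (C * norm (g y))"
          by (simp add: norm_mult mult.commute)
    qed
  qed (use that in measurable)
  have "integrable (M \<Otimes>\<^sub>M N) (case_prod ?h)"
  proof (rule Fubini_integrable)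
    show "AE x in M. integrable N (\<lambda>y. case_prod ?h (x, y))"
      by (intro AE_I2) (simp add: int)
    show "integrable M (\<lambda>x. LINT y|N. norm (case_prod ?h (x, y)))"
    proof (rule Bochner_Integration.integrable_bound)
      show "integrable M (\<lambda>x. norm (f x) * (LINT y|N. C * norm (g y)))" using f by simp
      show "AE x in M. norm (LINT y|N. norm (case_prod ?h (x, y)))
          \<le> norm (norm (f x) * (LINT y|N. C * norm (g y)))"
      proof (rule AE_I2)
        fix x assume x: "x \<in> space M"
        have "(LINT y|N. norm (g y * k x y)) \<le> (LINT y|N. C * norm (g y))"
        proof (intro integral_mono integrable_norm int[OF x] integrable_mult_right g)
          fix y
          show "norm (g y * k x y) \<le> C * norm (g y)"
            using mult_right_mono[OF C[of x y], of "norm (g y)"]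
                by (simp add: norm_mult mult.commute)
        qed
        then have "norm (f x) * (LINT y|N. norm (g y * k x y))
            \<le> norm (f x) * (LINT y|N. C * norm (g y))"
          by (rule mult_left_mono) simp
        then show "norm (LINT y|N. norm (case_prod ?h (x, y)))
            \<le> norm (norm (f x) * (LINT y|N. C * norm (g y)))"
          using order_trans[OF norm_ge_zero C[of x undefined]]
              by (simp add: norm_mult[of "f x"] abs_mult)
      qed
    qed measurable
  qed measurable
  then have "(LINT y|N. LINT x|M. ?h x y) = (LINT x|M. LINT y|N. ?h x y)"
    by (rule Fubini_integral)
  moreover have "(LINT y|N. LINT x|M. ?h x y) = (LINT y|N. g y * (LINT x|M. f x * k x y))"
    by (intro Bochner_Integration.integral_cong refl, subst integral_mult_right_zero[symmetric])
       (simp add: mult.left_commute)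
  ultimately show ?thesis by simp
qed

text \<open>Integrability is not assumed: where it fails, the left side is the default value
  0.\<close>

lemma norm_integral_le_nn_integral:
  fixes f :: "'a \<Rightarrow> complex"
  shows "ennreal (norm (integral\<^sup>L M f)) \<le> (\<integral>\<^sup>+x. ennreal (norm (f x)) \<partial>M)"
  by (cases "integrable M f") (simp_all add: integral_norm_bound_ennreal not_integrable_integral_eq)

context weinstein_order
begin

abbreviation transform :: "((real ^ 'd::finite) \<times> real \<Rightarrow> complex) \<Rightarrow> (real ^ 'd) \<times> real \<Rightarrow> complex"
    where
  "transform \<equiv> weinstein_L1 \<alpha>"

lemma borel_measurable_pair_weinsteinI:
  assumes "h \<in> borel_measurable (borel \<Otimes>\<^sub>M borel)"
  shows "h \<in> borel_measurable (\<mu> \<Otimes>\<^sub>M \<mu>)"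
proof -
  have "(\<lambda>p. (fst p, snd p)) \<in> measurable (\<mu> \<Otimes>\<^sub>M \<mu>) (borel \<Otimes>\<^sub>M borel)"
    by (intro measurable_Pair measurable_compose[OF measurable_fst measurable_id_weinstein]
        measurable_compose[OF measurable_snd measurable_id_weinstein])
  from measurable_compose[OF this assms] show ?thesis by simp
qed

lemma kernel_measurable_weinstein [measurable]: "kernel \<xi> \<in> borel_measurable \<mu>"
  by (intro borel_measurable_weinsteinI) measurable

lemma gauss_measurable_weinstein [measurable]: "gauss \<epsilon> \<in> borel_measurable \<mu>"
  by (intro borel_measurable_weinsteinI) measurable

lemma integrable_mult_kernel:
  assumes "integrable \<mu> f"
  shows "integrable \<mu> (\<lambda>x. f x * kernel \<xi> x)"
proof (rule Bochner_Integration.integrable_bound[OF assms])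
  have [measurable]: "f \<in> borel_measurable \<mu>" using assms by simp
  show "(\<lambda>x. f x * kernel \<xi> x) \<in> borel_measurable \<mu>" by measurable
  show "AE x in \<mu>. norm (f x * kernel \<xi> x) \<le> norm (f x)"
    by (intro AE_I2) (simp add: norm_mult mult_left_le norm_kernel_le)
qed

lemma norm_transform_le:
  assumes "integrable \<mu> f"
  shows "cmod (transform f \<xi>) \<le> (LINT x|\<mu>. cmod (f x))"
proof -
  have "cmod (transform f \<xi>) \<le> (LINT x|\<mu>. cmod (f x * kernel \<xi> x))"
    unfolding weinstein_L1_def by (rule integral_norm_bound)
  also have "\<dots> \<le> (LINT x|\<mu>. cmod (f x))"
    by (intro integral_mono integrable_norm integrable_mult_kernel assms)
       (auto simp: norm_mult mult_left_le norm_kernel_le)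
  finally show ?thesis .
qed

lemma continuous_on_transform:
  fixes f :: "(real ^ 'd::finite) \<times> real \<Rightarrow> complex"
  assumes f: "integrable \<mu> f"
  shows "continuous_on A (transform f)"
proof -
  have [measurable]: "f \<in> borel_measurable \<mu>" using f by simp
  have "isCont (transform f) \<xi>" for \<xi>
    unfolding continuous_at_sequentially comp_def weinstein_L1_def
  proof (intro allI impI)
    fix s assume s: "s \<longlonglongrightarrow> \<xi>"
    show "(\<lambda>n. LINT x|\<mu>. f x * kernel (s n) x) \<longlonglongrightarrow> (LINT x|\<mu>. f x * kernel \<xi> x)"
    proof (rule integral_dominated_convergence[where w = "\<lambda>x. cmod (f x)"])
      have "isCont (\<lambda>\<xi>. kernel \<xi> x) \<xi>" for x :: "(real ^ 'd) \<times> real"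
      proof (rule continuous_on_interior)
        show "continuous_on UNIV (\<lambda>\<xi>. kernel \<xi> x)" by (intro continuous_intros)
      qed simp
      then have "(\<lambda>n. kernel (s n) x) \<longlonglongrightarrow> kernel \<xi> x" for x :: "(real ^ 'd) \<times> real"
        using s by (rule isCont_tendsto_compose)
      then show "AE x in \<mu>. (\<lambda>n. f x * kernel (s n) x) \<longlonglongrightarrow> f x * kernel \<xi> x"
        by (intro AE_I2 tendsto_intros)
      show "AE x in \<mu>. norm (f x * kernel (s n) x) \<le> cmod (f x)" for n
        by (intro AE_I2) (simp add: norm_mult mult_left_le norm_kernel_le)
      show "integrable \<mu> (\<lambda>x. cmod (f x))" using f by simp
    qed measurable
  qed
  then show ?thesis by (simp add: continuous_at_imp_continuous_on)
qed

lemma transform_borel: "integrable \<mu> f \<Longrightarrow> transform f \<in> borel_measurable borel"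
  by (intro borel_measurable_continuous_onI continuous_on_transform)

lemma transform_measurable: "integrable \<mu> f \<Longrightarrow> transform f \<in> borel_measurable \<mu>"
  by (intro borel_measurable_weinsteinI transform_borel)

lemma transform_diff:
  assumes "integrable \<mu> f" "integrable \<mu> g"
  shows "transform (\<lambda>x. f x - g x) \<xi> = transform f \<xi> - transform g \<xi>"
  unfolding weinstein_L1_def left_diff_distrib
  by (intro Bochner_Integration.integral_diff integrable_mult_kernel assms)

lemma transform_reflect:
  assumes "f \<in> borel_measurable \<mu>"
  shows "transform (\<lambda>x. f (reflect x)) \<xi> = transform f (reflect \<xi>)"
proof -
  note [measurable] = assms
  have "transform f (reflect \<xi>) = (LINT x|\<mu>. f (reflect x) * kernel (reflect \<xi>) (reflect x))"
    unfolding weinstein_L1_def by (rule integral_weinstein_reflect[symmetric]) measurable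
  then show ?thesis
    by (simp add: weinstein_L1_def kernel_reflect_commute)
qed

lemma transform_cnj: "transform (\<lambda>x. cnj (f x)) \<xi> = cnj (transform f (reflect \<xi>))"
  unfolding weinstein_L1_def Bochner_Integration.integral_cnj[symmetric] by (simp add: cnj_kernel)

lemma transform_snd_minus: "transform f (b, - t) = transform f (b, t)"
  by (simp add: weinstein_L1_def kernel_snd_minus)

lemma multiplication_formula_L1:
  assumes "integrable \<mu> f" "integrable \<mu> g"
  shows "(LINT \<xi>|\<mu>. transform f \<xi> * g \<xi>) = (LINT x|\<mu>. f x * transform g x)"
proof -
  have "(LINT \<xi>|\<mu>. g \<xi> * (LINT x|\<mu>. f x * kernel \<xi> x))
      = (LINT x|\<mu>. f x * (LINT \<xi>|\<mu>. g \<xi> * kernel \<xi> x))"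
  proof (rule Fubini_bounded_kernel[OF sigma_finite_weinstein sigma_finite_weinstein assms])
    show "(\<lambda>(x, \<xi>). kernel \<xi> x) \<in> borel_measurable (\<mu> \<Otimes>\<^sub>M \<mu>)"
      by (intro borel_measurable_pair_weinsteinI) measurable
  qed (rule norm_kernel_le)
  then show ?thesis
    by (simp add: weinstein_L1_def mult.commute[of "g _"] kernel_commute[of _ "x" for x])
qed

subsection \<open>The heat kernel\<close>

text \<open>The translate of a Gaussian of width sqrt \<epsilon>. Since \<open>shift_point\<close>
  adds the horizontal coordinates, the mass concentrates near y = \<open>reflect x\<close> rather
  than near x; this is why reflections accompany the kernel.\<close>

definition heat :: "real \<Rightarrow> (real ^ 'd::finite) \<times> real \<Rightarrow> (real ^ 'd) \<times> real \<Rightarrow> real" where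
  "heat \<epsilon> x y = (LINT \<theta>|angle_measure. \<epsilon> powr (- hom_dim TYPE('d) / 2) * gauss (1 / \<epsilon>)
      (shift_point x y \<theta>))"

lemma heat_nonneg [simp]: "0 \<le> heat \<epsilon> x y"
  unfolding heat_def by (intro integral_nonneg_AE AE_I2) simp

lemma heat_integrand_bound:
  "0 < \<epsilon> \<Longrightarrow> norm (\<epsilon> powr p * gauss (1 / \<epsilon>) z) \<le> \<epsilon> powr p"
  by (simp add: abs_mult mult_left_le gauss_le_1)

lemma heat_integrand_integrable:
  fixes x y :: "(real ^ 'd::finite) \<times> real"
  assumes "0 < \<epsilon>"
  shows "integrable angle_measure (\<lambda>\<theta>. \<epsilon> powr p * gauss (1 / \<epsilon>) (shift_point x y \<theta>))"
  by (rule angle_integrable_bounded[of _ "\<epsilon> powr p"])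
     (measurable, rule heat_integrand_bound[OF assms])

lemma heat_le:
  fixes x y :: "(real ^ 'd::finite) \<times> real"
  assumes "0 < \<epsilon>"
  shows "heat \<epsilon> x y \<le> \<epsilon> powr (- hom_dim TYPE('d) / 2)"
proof -
  have "heat \<epsilon> x y \<le> (LINT \<theta>|angle_measure. \<epsilon> powr (- hom_dim TYPE('d) / 2))"
    unfolding heat_def
    by (intro integral_mono heat_integrand_integrable assms)
       (use assms in \<open>auto simp: mult_left_le gauss_le_1 angle.emeasure_space_1\<close>)
  then show ?thesis using angle.prob_space by simp
qed

lemma heat_commute: "heat \<epsilon> x y = heat \<epsilon> y x"
  by (simp add: heat_def shift_point_commute[of x])

lemma heat_reflect: "heat \<epsilon> (reflect x) (reflect y) = heat \<epsilon> x y"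
  by (simp add: heat_def shift_point_reflect)

lemma heat_reflect_commute: "heat \<epsilon> (reflect x) y = heat \<epsilon> x (reflect y)"
  using heat_reflect[of \<epsilon> x "reflect y"] by simp

lemma heat_measurable [measurable (raw)]:
  assumes [measurable]: "f \<in> borel_measurable N" "g \<in> borel_measurable N"
  shows "(\<lambda>x. heat \<epsilon> (f x) (g x)) \<in> borel_measurable N"
  unfolding heat_def by measurable

text \<open>The swap of the shift removes \<open>x\<close> from the Gaussian. The remaining total
  mass is the transform of a Gaussian at the origin, where the kernel is 1.\<close>

lemma nn_integral_heat:
  fixes x :: "(real ^ 'd::finite) \<times> real"
  assumes \<epsilon>: "0 < \<epsilon>"
  shows "(\<integral>\<^sup>+y. ennreal (heat \<epsilon> x y) \<partial>\<mu>) = 1"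
proof -
  let ?c = "\<epsilon> powr (- hom_dim TYPE('d) / 2)"
  let ?g = "\<lambda>z :: (real ^ 'd) \<times> real. ?c * gauss (1 / \<epsilon>) z"
  have "(\<integral>\<^sup>+y. ennreal (heat \<epsilon> x y) \<partial>\<mu>)
      = (\<integral>\<^sup>+y. \<integral>\<^sup>+\<theta>. ennreal (?g (shift_point x y \<theta>)) \<partial>angle_measure \<partial>\<mu>)"
    unfolding heat_def
    by (intro nn_integral_cong nn_integral_eq_integral[symmetric] heat_integrand_integrable \<epsilon>) simp
  also have "\<dots> = (\<integral>\<^sup>+y. \<integral>\<^sup>+\<theta>. ennreal (?g y) \<partial>angle_measure \<partial>\<mu>)"
    using nn_integral_shift_swap[of "\<lambda>p. ennreal (?g (fst p))" x] by simp
  also have "\<dots> = (\<integral>\<^sup>+y. ennreal (?g y) \<partial>\<mu>)"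
    by (simp add: angle.emeasure_space_1[simplified])
  also have "\<dots> = ennreal (LINT y|\<mu>. ?g y)"
    using gauss_transform(1)[of "1 / \<epsilon>", where 'd = 'd] \<epsilon> by (intro nn_integral_eq_integral) auto
  also have "(LINT y|\<mu>. ?g y) = 1"
  proof -
    have k: "kernel (0 :: (real ^ 'd) \<times> real) y = 1" for y
      using angle.prob_space by (simp add: weinstein_kernel_def normalized_bessel_eq)
    have "complex_of_real (LINT y|\<mu>. gauss (1 / \<epsilon>) (y :: (real ^ 'd) \<times> real))
        = (LINT y|\<mu>. complex_of_real (gauss (1 / \<epsilon>) y) * kernel (0 :: (real ^ 'd) \<times> real) y)"
      by (simp add: k)
    also have "\<dots> = complex_of_real ((1 / \<epsilon>) powr (- hom_dim TYPE('d) / 2) * gauss (1 / (1 / \<epsilon>))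
        (0 :: (real ^ 'd) \<times> real))"
      using \<epsilon> by (intro gauss_transform(2)) simp
    finally have "(LINT y|\<mu>. gauss (1 / \<epsilon>) (y :: (real ^ 'd) \<times> real))
        = (1 / \<epsilon>) powr (- hom_dim TYPE('d) / 2)"
      by (simp add: gauss_def del: of_real_mult)
    then show ?thesis using \<epsilon> by (simp add: powr_divide powr_minus)
  qed
  finally show ?thesis by simp
qed

text \<open>By the product formula the two kernels are an angular average of one kernel. Exchanging
  this average with the Gaussian integral leaves transforms of Gaussians at the shift
  points.\<close>

lemma heat_eq:
  fixes x y :: "(real ^ 'd::finite) \<times> real"
  assumes \<epsilon>: "0 < \<epsilon>" and xy: "x \<in> half_space" "y \<in> half_space"
  shows "(LINT \<xi>|\<mu>. complex_of_real (gauss \<epsilon> \<xi>) * (kernel \<xi> x * kernel \<xi> y))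
      = complex_of_real (heat \<epsilon> x y)"
proof -
  have g: "integrable \<mu> (\<lambda>\<xi> :: (real ^ 'd) \<times> real. complex_of_real (gauss \<epsilon> \<xi>))"
    using gauss_transform(1)[OF \<epsilon>, where 'd = 'd] by simp
  have K: "(LINT \<xi>|\<mu>. complex_of_real (gauss \<epsilon> \<xi>) * kernel \<xi> z) =
      complex_of_real (\<epsilon> powr (- hom_dim TYPE('d) / 2) * gauss (1 / \<epsilon>) z)"
          for z :: "(real ^ 'd) \<times> real"
    using gauss_transform(2)[OF \<epsilon>, of z] by (simp add: kernel_commute[of _ z])
  have "(LINT \<xi>|\<mu>. complex_of_real (gauss \<epsilon> \<xi>) * (LINT \<theta>|angle_measure. 1 * kernel \<xi>
      (shift_point x y \<theta>)))
    = (LINT \<theta>|angle_measure. 1 * (LINT \<xi>|\<mu>. complex_of_real (gauss \<epsilon> \<xi>) * kernel \<xi>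
        (shift_point x y \<theta>)))"
  proof (rule Fubini_bounded_kernel[OF angle.sigma_finite_measure_axioms sigma_finite_weinstein _
      g])
    have "(\<lambda>p. (fst p, snd p)) \<in> measurable (angle_measure \<Otimes>\<^sub>M \<mu>) (borel \<Otimes>\<^sub>M (borel ::
        ((real ^ 'd) \<times> real) measure))"
      by (intro measurable_Pair measurable_compose[OF measurable_snd measurable_id_weinstein])
          measurable
    from measurable_compose[OF this, of "\<lambda>(\<theta>, \<xi>). kernel \<xi> (shift_point x y \<theta>)" borel]
    show "(\<lambda>(\<theta>, \<xi>). kernel \<xi> (shift_point x y \<theta>)) \<in> borel_measurable (angle_measure \<Otimes>\<^sub>M \<mu>)"
      by (simp add: case_prod_beta) 
  qed (auto intro: norm_kernel_le simp: angle.emeasure_space_1[simplified])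
  then show ?thesis
    using kernel_product[OF xy] by (simp only: K mult_1_left heat_def integral_complex_of_real)
qed

text \<open>The Gaussian between the two transforms makes the double integral absolutely convergent.
  Applying the transform twice without it has no such justification, as \<open>transform f\<close>
  need not be integrable.\<close>

lemma transform_gauss_transform:
  fixes f :: "(real ^ 'd::finite) \<times> real \<Rightarrow> complex"
  assumes \<epsilon>: "0 < \<epsilon>" and f: "integrable \<mu> f" and y: "y \<in> half_space"
  shows "transform (\<lambda>\<xi>. complex_of_real (gauss \<epsilon> \<xi>) * transform f \<xi>) y
      = (LINT x|\<mu>. f x * complex_of_real (heat \<epsilon> x y))"
proof -
  have g: "integrable \<mu> (\<lambda>\<xi> :: (real ^ 'd) \<times> real. complex_of_real (gauss \<epsilon> \<xi>) * kernel y \<xi>)"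
    using gauss_transform(1)[OF \<epsilon>, where 'd = 'd] by (intro integrable_mult_kernel) simp
  have "(LINT \<xi>|\<mu>. (complex_of_real (gauss \<epsilon> \<xi>) * kernel y \<xi>) * (LINT x|\<mu>. f x * kernel \<xi> x))
    = (LINT x|\<mu>. f x * (LINT \<xi>|\<mu>. (complex_of_real (gauss \<epsilon> \<xi>) * kernel y \<xi>) * kernel \<xi> x))"
  proof (rule Fubini_bounded_kernel[OF sigma_finite_weinstein sigma_finite_weinstein f g])
    show "(\<lambda>(x, \<xi>). kernel \<xi> x) \<in> borel_measurable (\<mu> \<Otimes>\<^sub>M \<mu>)"
      by (intro borel_measurable_pair_weinsteinI) measurable
  qed (rule norm_kernel_le)
  also have "\<dots> = (LINT x|\<mu>. f x * complex_of_real (heat \<epsilon> x y))"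
  proof (intro Bochner_Integration.integral_cong refl)
    fix x assume "x \<in> space (\<mu> :: ((real ^ 'd) \<times> real) measure)"
    then have x: "x \<in> half_space" by simp
    show "f x * (LINT \<xi>|\<mu>. (complex_of_real (gauss \<epsilon> \<xi>) * kernel y \<xi>) * kernel \<xi> x)
        = f x * complex_of_real (heat \<epsilon> x y)"
      unfolding heat_eq[OF \<epsilon> x y, symmetric]
      by (simp add: kernel_commute[of y] mult.assoc mult.commute[of "kernel _ y"])
  qed
  finally show ?thesis by (simp add: weinstein_L1_def mult_ac)
qed

text \<open>Schur's test: |f(x) f(y)| is at most half the sum of the squares, and the kernel has
  mass one in either variable, so each half contributes \<open>sqnorm f / 2\<close>.\<close>

lemma nn_integral_heat_both:
  assumes \<epsilon>: "0 < \<epsilon>" and f: "f \<in> L2 \<alpha>"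
  shows "(\<integral>\<^sup>+y. \<integral>\<^sup>+x. ennreal (cmod (f x) * cmod (f y) * heat \<epsilon> x (reflect y)) \<partial>\<mu> \<partial>\<mu>)
      \<le> ennreal (sqnorm f)"
proof -
  interpret pair_sigma_finite \<mu> \<mu> by (intro pair_sigma_finite.intro sigma_finite_weinstein)
  have f1: "f \<in> borel_measurable \<mu>" by (rule L2_measurable[OF f])
  note [measurable] = f1 
  have H [measurable]: "(\<lambda>p. heat \<epsilon> (fst p) (reflect (snd p))) \<in> borel_measurable (\<mu> \<Otimes>\<^sub>M \<mu>)"
    by (intro borel_measurable_pair_weinsteinI) measurable
  have [measurable]: "(\<lambda>y. heat \<epsilon> x (reflect y)) \<in> borel_measurable \<mu>" "(\<lambda>x. heat \<epsilon> x
      (reflect y)) \<in> borel_measurable \<mu>" for x y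
    by (intro borel_measurable_weinsteinI, measurable)+
  have mass: "(\<integral>\<^sup>+y. ennreal (heat \<epsilon> x (reflect y)) \<partial>\<mu>) = 1" for x
    using nn_integral_heat[OF \<epsilon>, of "reflect x"] by (simp add: heat_reflect_commute)
  have mass': "(\<integral>\<^sup>+x. ennreal (heat \<epsilon> x (reflect y)) \<partial>\<mu>) = 1" for y
    using nn_integral_heat[OF \<epsilon>, of "reflect y"] by (simp add: heat_commute)
  let ?s = "\<lambda>x. ennreal ((cmod (f x))\<^sup>2 / 2)"
  have half: "(\<integral>\<^sup>+x. ?s x \<partial>\<mu>) = ennreal (sqnorm f / 2)"
    using L2_integrable[OF f] by (subst nn_integral_eq_integral) (auto simp: sqnorm_def)
  have "(\<integral>\<^sup>+y. \<integral>\<^sup>+x. ennreal (cmod (f x) * cmod (f y) * heat \<epsilon> x (reflect y)) \<partial>\<mu> \<partial>\<mu>)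
     \<le> (\<integral>\<^sup>+y. \<integral>\<^sup>+x. ?s x * ennreal (heat \<epsilon> x (reflect y)) + ?s y * ennreal (heat \<epsilon> x
         (reflect y)) \<partial>\<mu> \<partial>\<mu>)"
  proof (intro nn_integral_mono)
    fix x y
    have "2 * (cmod (f x) * cmod (f y)) \<le> (cmod (f x))\<^sup>2 + (cmod (f y))\<^sup>2"
      using zero_le_power2[of "cmod (f x) - cmod (f y)"]
          by (simp add: power2_eq_square algebra_simps)
    then have "cmod (f x) * cmod (f y) \<le> (cmod (f x))\<^sup>2 / 2 + (cmod (f y))\<^sup>2 / 2" by simp
    then have "cmod (f x) * cmod (f y) * heat \<epsilon> x (reflect y)
        \<le> ((cmod (f x))\<^sup>2 / 2 + (cmod (f y))\<^sup>2 / 2) * heat \<epsilon> x (reflect y)"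
      by (rule mult_right_mono) simp
    then have "ennreal (cmod (f x) * cmod (f y) * heat \<epsilon> x (reflect y))
        \<le> ennreal (((cmod (f x))\<^sup>2 / 2 + (cmod (f y))\<^sup>2 / 2) * heat \<epsilon> x (reflect y))"
      by (rule ennreal_leI)
    also have "\<dots> = ?s x * ennreal (heat \<epsilon> x (reflect y)) + ?s y * ennreal (heat \<epsilon> x (reflect y))"
    proof -
      have "0 \<le> (cmod (f z))\<^sup>2 / 2" for z by simp
      then show ?thesis
        by (simp only: distrib_right ennreal_plus ennreal_mult heat_nonneg mult_nonneg_nonneg)
    qed
    finally show "ennreal (cmod (f x) * cmod (f y) * heat \<epsilon> x (reflect y))
        \<le> ?s x * ennreal (heat \<epsilon> x (reflect y)) + ?s y * ennreal (heat \<epsilon> x (reflect y))" .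
  qed
  also have "\<dots> = (\<integral>\<^sup>+y. (\<integral>\<^sup>+x. ?s x * ennreal (heat \<epsilon> x (reflect y)) \<partial>\<mu>) + (\<integral>\<^sup>+x. ?s y * ennreal
      (heat \<epsilon> x (reflect y)) \<partial>\<mu>) \<partial>\<mu>)"
    by (intro nn_integral_cong nn_integral_add) measurable
  also have "\<dots> = (\<integral>\<^sup>+y. (\<integral>\<^sup>+x. ?s x * ennreal (heat \<epsilon> x (reflect y)) \<partial>\<mu>) + ?s y \<partial>\<mu>)"
    by (simp add: nn_integral_cmult mass')
  also have "\<dots> = (\<integral>\<^sup>+y. \<integral>\<^sup>+x. ?s x * ennreal (heat \<epsilon> x (reflect y)) \<partial>\<mu> \<partial>\<mu>) + (\<integral>\<^sup>+y. ?s y \<partial>\<mu>)"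
  proof (rule nn_integral_add)
    have [measurable]: "(\<lambda>p. heat \<epsilon> (snd p) (reflect (fst p))) \<in> borel_measurable (\<mu> \<Otimes>\<^sub>M \<mu>)"
      by (intro borel_measurable_pair_weinsteinI) measurable
    have "(\<lambda>p. ?s (snd p) * ennreal (heat \<epsilon> (snd p) (reflect (fst p)))) \<in> borel_measurable
        (\<mu> \<Otimes>\<^sub>M \<mu>)"
      by measurable
    then show "(\<lambda>y. \<integral>\<^sup>+x. ?s x * ennreal (heat \<epsilon> x (reflect y)) \<partial>\<mu>) \<in> borel_measurable \<mu>"
      by (intro weinstein.borel_measurable_nn_integral) (simp add: case_prod_beta')
  qed measurable
  also have "(\<integral>\<^sup>+y. \<integral>\<^sup>+x. ?s x * ennreal (heat \<epsilon> x (reflect y)) \<partial>\<mu> \<partial>\<mu>)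
      = (\<integral>\<^sup>+x. \<integral>\<^sup>+y. ?s x * ennreal (heat \<epsilon> x (reflect y)) \<partial>\<mu> \<partial>\<mu>)"
  proof (rule Fubini')
    have "(\<lambda>p. ?s (fst p) * ennreal (heat \<epsilon> (fst p) (reflect (snd p)))) \<in> borel_measurable
        (\<mu> \<Otimes>\<^sub>M \<mu>)" by measurable
    then show "(\<lambda>(x, y). ?s x * ennreal (heat \<epsilon> x (reflect y))) \<in> borel_measurable (\<mu> \<Otimes>\<^sub>M \<mu>)"
      by (simp add: case_prod_beta)
  qed
  also have "\<dots> = (\<integral>\<^sup>+x. ?s x \<partial>\<mu>)"
    by (simp add: nn_integral_cmult mass)
  also have "(\<integral>\<^sup>+x. ?s x \<partial>\<mu>) + (\<integral>\<^sup>+x. ?s x \<partial>\<mu>) = ennreal (sqnorm f)"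
    unfolding half by (simp flip: ennreal_plus)
  finally show ?thesis .
qed

text \<open>The multiplication formula moves one transform onto the conjugate of \<open>?h\<close>,
  which turns the weighted squared norm into a quadratic form of \<open>f\<close> with the heat
  kernel. Schur's test bounds that form uniformly in \<epsilon>.\<close>

lemma gauss_transform_sqnorm_le:
  fixes f :: "(real ^ 'd::finite) \<times> real \<Rightarrow> complex"
  assumes \<epsilon>: "0 < \<epsilon>" and f: "integrable \<mu> f" "f \<in> L2 \<alpha>"
  shows "integrable \<mu> (\<lambda>\<xi>. gauss \<epsilon> \<xi> * (cmod (transform f \<xi>))\<^sup>2)"
    and "(LINT \<xi>|\<mu>. gauss \<epsilon> \<xi> * (cmod (transform f \<xi>))\<^sup>2) \<le> sqnorm f"
proof -
  let ?C = "LINT x|\<mu>. cmod (f x)"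
  note [measurable] = transform_measurable[OF f(1)]
  have f_m [measurable]: "f \<in> borel_measurable \<mu>" using f by simp
  have [measurable]: "(\<lambda>x. heat \<epsilon> x (reflect y)) \<in> borel_measurable \<mu>" for y :: "(real ^ 'd) \<times> real"
    by (intro borel_measurable_weinsteinI) measurable
  have C: "0 \<le> ?C" by simp
  let ?h = "\<lambda>\<xi>. complex_of_real (gauss \<epsilon> \<xi>) * transform f \<xi>"
  have g: "integrable \<mu> (gauss \<epsilon> :: (real ^ 'd) \<times> real \<Rightarrow> real)" by (rule gauss_transform(1)[OF \<epsilon>])
  have h: "integrable \<mu> ?h"
  proof (rule Bochner_Integration.integrable_bound)
    show "integrable \<mu> (\<lambda>\<xi> :: (real ^ 'd) \<times> real. ?C * gauss \<epsilon> \<xi>)" using g by simp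
    show "AE \<xi> in \<mu>. norm (?h \<xi>) \<le> norm (?C * gauss \<epsilon> \<xi>)"
      using norm_transform_le[OF f(1)] C
      by (intro AE_I2) (simp add: norm_mult mult.commute mult_right_mono)
  qed measurable
  have hc: "integrable \<mu> (\<lambda>\<xi>. cnj (?h \<xi>))" by (rule iffD2[OF complex_integrable_cnj h])
  show int: "integrable \<mu> (\<lambda>\<xi>. gauss \<epsilon> \<xi> * (cmod (transform f \<xi>))\<^sup>2)"
  proof (rule Bochner_Integration.integrable_bound)
    show "integrable \<mu> (\<lambda>\<xi> :: (real ^ 'd) \<times> real. ?C\<^sup>2 * gauss \<epsilon> \<xi>)" using g by simp
    show "AE \<xi> in \<mu>. norm (gauss \<epsilon> \<xi> * (cmod (transform f \<xi>))\<^sup>2) \<le> norm (?C\<^sup>2 * gauss \<epsilon> \<xi>)"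
      using norm_transform_le[OF f(1)] C
      by (intro AE_I2) (simp add: abs_mult mult.commute mult_right_mono power_mono)
  qed measurable
  have "complex_of_real (LINT \<xi>|\<mu>. gauss \<epsilon> \<xi> * (cmod (transform f \<xi>))\<^sup>2)
      = (LINT \<xi>|\<mu>. transform f \<xi> * cnj (?h \<xi>))"
    unfolding integral_complex_of_real[symmetric]
    by (intro Bochner_Integration.integral_cong refl)
       (simp only: of_real_mult complex_norm_square complex_cnj_mult complex_cnj_complex_of_real
           mult.left_commute)
  also have "\<dots> = (LINT y|\<mu>. f y * transform (\<lambda>\<xi>. cnj (?h \<xi>)) y)"
    by (rule multiplication_formula_L1[OF f(1) hc])
  also have "\<dots> = (LINT y|\<mu>. f y * cnj (LINT x|\<mu>. f x * complex_of_real (heat \<epsilon> x (reflect y))))"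
  proof (intro Bochner_Integration.integral_cong refl arg_cong2[of _ _ _ _ "(*)"])
    fix y assume "y \<in> space (\<mu> :: ((real ^ 'd) \<times> real) measure)"
    then have y: "reflect y \<in> half_space" by simp
    have "transform (\<lambda>\<xi>. cnj (?h \<xi>)) y = cnj (transform ?h (reflect y))"
      by (rule transform_cnj)
    then show "transform (\<lambda>\<xi>. cnj (?h \<xi>)) y
        = cnj (LINT x|\<mu>. f x * complex_of_real (heat \<epsilon> x (reflect y)))"
      by (simp only: transform_gauss_transform[OF \<epsilon> f(1) y])
  qed
  finally have eq: "complex_of_real (LINT \<xi>|\<mu>. gauss \<epsilon> \<xi> * (cmod (transform f \<xi>))\<^sup>2) = \<dots>" .
  have "ennreal (cmod (complex_of_real (LINT \<xi>|\<mu>. gauss \<epsilon> \<xi> * (cmod (transform f \<xi>))\<^sup>2)))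
     \<le> (\<integral>\<^sup>+y. \<integral>\<^sup>+x. ennreal (cmod (f x) * cmod (f y) * heat \<epsilon> x (reflect y)) \<partial>\<mu> \<partial>\<mu>)"
    unfolding eq
  proof (rule order_trans[OF norm_integral_le_nn_integral])
    have "ennreal (norm (f y * cnj (LINT x|\<mu>. f x * complex_of_real (heat \<epsilon> x (reflect y)))))
      \<le> (\<integral>\<^sup>+x. ennreal (cmod (f x) * cmod (f y) * heat \<epsilon> x (reflect y)) \<partial>\<mu>)" for y
    proof -
      have "ennreal (norm (f y * cnj (LINT x|\<mu>. f x * complex_of_real (heat \<epsilon> x (reflect y)))))
        = ennreal (cmod (f y)) * ennreal (cmod (LINT x|\<mu>. f x * complex_of_real (heat \<epsilon> x
            (reflect y))))"
        by (simp add: norm_mult ennreal_mult)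
      also have "\<dots> \<le> ennreal (cmod (f y)) * (\<integral>\<^sup>+x. ennreal (cmod (f x * complex_of_real (heat \<epsilon> x
          (reflect y)))) \<partial>\<mu>)"
        by (intro mult_left_mono norm_integral_le_nn_integral) simp
      also have "\<dots> = (\<integral>\<^sup>+x. ennreal (cmod (f y)) * ennreal (cmod (f x * complex_of_real (heat \<epsilon> x
          (reflect y)))) \<partial>\<mu>)"
        by (rule nn_integral_cmult[symmetric]) measurable
      also have "\<dots> = (\<integral>\<^sup>+x. ennreal (cmod (f x) * cmod (f y) * heat \<epsilon> x (reflect y)) \<partial>\<mu>)"
        by (intro nn_integral_cong) (simp add: norm_mult ennreal_mult[symmetric] mult_ac)
      finally show ?thesis .
    qed
    then show "(\<integral>\<^sup>+y. ennreal (norm (f y * cnj (LINT x|\<mu>. f x * complex_of_real (heat \<epsilon> x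
        (reflect y))))) \<partial>\<mu>)
      \<le> (\<integral>\<^sup>+y. \<integral>\<^sup>+x. ennreal (cmod (f x) * cmod (f y) * heat \<epsilon> x (reflect y)) \<partial>\<mu> \<partial>\<mu>)"
      by (rule nn_integral_mono)
  qed
  also have "\<dots> \<le> ennreal (sqnorm f)" by (rule nn_integral_heat_both[OF \<epsilon> f(2)])
  finally show "(LINT \<xi>|\<mu>. gauss \<epsilon> \<xi> * (cmod (transform f \<xi>))\<^sup>2) \<le> sqnorm f" by simp
qed

text \<open>The bound with Gaussian weight does not depend on \<epsilon>; Fatou's lemma removes the
  weight as \<epsilon> tends to 0.\<close>

theorem transform_L2:
  fixes f :: "(real ^ 'd::finite) \<times> real \<Rightarrow> complex"
  assumes f: "integrable \<mu> f" "f \<in> L2 \<alpha>"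
  shows "transform f \<in> L2 \<alpha>" and "sqnorm (transform f) \<le> sqnorm f"
proof -
  note [measurable] = transform_measurable[OF f(1)]
  let ?e = "\<lambda>n. 1 / real (Suc n)"
  have "(\<integral>\<^sup>+\<xi>. ennreal ((cmod (transform f \<xi>))\<^sup>2) \<partial>\<mu>)
      = (\<integral>\<^sup>+\<xi>. liminf (\<lambda>n. ennreal (gauss (?e n) \<xi> * (cmod (transform f \<xi>))\<^sup>2)) \<partial>\<mu>)"
  proof (rule nn_integral_cong)
    fix \<xi>
    have "(\<lambda>n. ennreal (gauss (?e n) \<xi> * (cmod (transform f \<xi>))\<^sup>2))
        \<longlonglongrightarrow> ennreal (1 * (cmod (transform f \<xi>))\<^sup>2)"
      by (intro tendsto_intros gauss_tendsto_1)
    then have "(\<lambda>n. ennreal (gauss (?e n) \<xi> * (cmod (transform f \<xi>))\<^sup>2))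
        \<longlonglongrightarrow> ennreal ((cmod (transform f \<xi>))\<^sup>2)"
      by (simp only: mult_1_left)
    then show "ennreal ((cmod (transform f \<xi>))\<^sup>2)
        = liminf (\<lambda>n. ennreal (gauss (?e n) \<xi> * (cmod (transform f \<xi>))\<^sup>2))"
      by (rule lim_imp_Liminf[OF trivial_limit_sequentially, symmetric])
  qed
  also have "\<dots> \<le> liminf (\<lambda>n. \<integral>\<^sup>+\<xi>. ennreal (gauss (?e n) \<xi> * (cmod (transform f \<xi>))\<^sup>2) \<partial>\<mu>)"
    by (rule nn_integral_liminf) measurable
  also have "\<dots> \<le> liminf (\<lambda>n :: nat. ennreal (sqnorm f))"
  proof (intro Liminf_mono always_eventually allI)
    fix n
    have e: "0 < ?e n" by simp
    have "(\<integral>\<^sup>+\<xi>. ennreal (gauss (?e n) \<xi> * (cmod (transform f \<xi>))\<^sup>2) \<partial>\<mu>)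
        = ennreal (LINT \<xi>|\<mu>. gauss (?e n) \<xi> * (cmod (transform f \<xi>))\<^sup>2)"
      by (intro nn_integral_eq_integral gauss_transform_sqnorm_le(1)[OF e f]) simp
    also have "\<dots> \<le> ennreal (sqnorm f)"
      by (intro ennreal_leI gauss_transform_sqnorm_le(2)[OF e f])
    finally show "(\<integral>\<^sup>+\<xi>. ennreal (gauss (?e n) \<xi> * (cmod (transform f \<xi>))\<^sup>2) \<partial>\<mu>)
        \<le> ennreal (sqnorm f)" .
  qed
  also have "\<dots> = ennreal (sqnorm f)" by (simp add: Liminf_const)
  finally have le: "(\<integral>\<^sup>+\<xi>. ennreal ((cmod (transform f \<xi>))\<^sup>2) \<partial>\<mu>) \<le> ennreal (sqnorm f)" .
  show "transform f \<in> L2 \<alpha>" "sqnorm (transform f) \<le> sqnorm f"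
    by (rule L2I_nn_integral[OF _ le]; simp)+
qed

subsection \<open>The transform of square integrable functions\<close>

abbreviation L12 :: "((real ^ 'd::finite) \<times> real \<Rightarrow> complex) set" where
  "L12 \<equiv> {f \<in> L2 \<alpha>. integrable \<mu> f}"

abbreviation wtransform :: "((real ^ 'd::finite) \<times> real \<Rightarrow> complex) \<Rightarrow> (real ^ 'd) \<times> real \<Rightarrow> complex"
    where
  "wtransform \<equiv> weinstein \<alpha>"

lemma transform_diff_sqnorm_le:
  assumes "f \<in> L12" "g \<in> L12"
  shows "sqnorm (\<lambda>x. transform f x - transform g x) \<le> sqnorm (\<lambda>x. f x - g x)"
proof -
  have "transform (\<lambda>x. f x - g x) = (\<lambda>x. transform f x - transform g x)"
    using assms by (intro ext transform_diff) auto
  then show ?thesis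
    using transform_L2(2)[of "\<lambda>x. f x - g x"] L2_diff(1)[of f g] assms by auto
qed

lemma gauss_mult_L12:
  assumes "0 < \<epsilon>" "f \<in> L2 \<alpha>"
  shows "(\<lambda>x. complex_of_real (gauss \<epsilon> x) * f x) \<in> L12"
proof -
  have "(\<lambda>x. complex_of_real (gauss \<epsilon> x) * f x) \<in> L2 \<alpha>"
    by (rule L2_mult_bounded(1)[where C = 1]) (use assms gauss_le_1[of \<epsilon>] in \<open>auto intro!: AE_I2\<close>)
  then show ?thesis using gauss_mult_integrable[OF assms] by simp
qed

lemma L2_tendsto_L2:
  assumes "L2_tendsto \<alpha> s f"
  shows "f \<in> L2 \<alpha>" "s n \<in> L2 \<alpha>" "(\<lambda>n. sqnorm (\<lambda>x. s n x - f x)) \<longlonglongrightarrow> 0"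
  using assms by (auto simp: L2_tendsto_iff)

text \<open>The choice in \<open>L2_extension\<close> means something only if a candidate exists.
  Gaussian cutoffs of \<open>f\<close> are integrable and converge to it, and the contraction
  property passes their speed on to the transforms.\<close>

lemma weinstein_witness:
  fixes f :: "(real ^ 'd::finite) \<times> real \<Rightarrow> complex"
  assumes f: "f \<in> L2 \<alpha>"
  shows "\<exists>g s. (\<forall>n. s n \<in> L12) \<and> L2_tendsto \<alpha> s f \<and> L2_tendsto \<alpha> (\<lambda>n. transform (s n)) g"
proof -
  let ?t = "\<lambda>n x. complex_of_real (gauss (1 / real (Suc n)) x) * f x"
  have t: "?t n \<in> L12" for n by (rule gauss_mult_L12[OF _ f]) simp
  have lim: "(\<lambda>n. sqnorm (\<lambda>x. ?t n x - f x)) \<longlonglongrightarrow> 0"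
    by (rule L2_tendsto_L2(3)[OF gauss_approx[OF f]])
  \<comment> \<open>A subsequence is taken at the speed which \<open>L2_complete\<close> asks for.
    The factor 1/4 absorbs the constants of the triangle inequality: (1/16 + 1/2) 8^(-n) stays below
    8^(-n).\<close>
  have "\<exists>k. sqnorm (\<lambda>x. ?t k x - f x) < (1 / 8) ^ n / 4" for n :: nat
  proof -
    have "eventually (\<lambda>k. sqnorm (\<lambda>x. ?t k x - f x) < (1 / 8) ^ n / 4) sequentially"
      by (intro order_tendstoD(2)[OF lim]) simp
    then show ?thesis by (auto simp: eventually_sequentially)
  qed
  then obtain r where r: "\<And>n :: nat. sqnorm (\<lambda>x. ?t (r n) x - f x) < (1 / 8) ^ n / 4"
    by metis
  define s where "s n = ?t (r n)" for n
  have s: "s n \<in> L12" for n unfolding s_def by (rule t)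
  have sf: "sqnorm (\<lambda>x. s n x - f x) \<le> (1 / 8) ^ n / 4" for n
    using r[of n] by (simp add: s_def less_imp_le)
  have "(\<lambda>n. sqnorm (\<lambda>x. s n x - f x)) \<longlonglongrightarrow> 0"
  proof (rule tendsto_sandwich[OF _ _ tendsto_const])
    have "(\<lambda>n. (1 / 4) * (1 / 8) ^ n) \<longlonglongrightarrow> (0 :: real)"
      by (intro tendsto_mult_right_zero LIMSEQ_realpow_zero) auto
    then show "(\<lambda>n. (1 / 8) ^ n / 4) \<longlonglongrightarrow> (0 :: real)" by simp
  qed (use sf in auto)
  then have sf': "L2_tendsto \<alpha> s f" using s f by (simp add: L2_tendsto_iff)
  have "\<exists>g. L2_tendsto \<alpha> (\<lambda>n. transform (s n)) g"
  proof (rule L2_complete)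
    show "transform (s n) \<in> L2 \<alpha>" for n using s[of n] by (intro transform_L2) auto
    fix n
    have "sqnorm (\<lambda>x. transform (s (Suc n)) x - transform (s n) x)
        \<le> sqnorm (\<lambda>x. s (Suc n) x - s n x)"
      by (rule transform_diff_sqnorm_le[OF s s])
    also have "\<dots> \<le> 2 * sqnorm (\<lambda>x. s (Suc n) x - f x) + 2 * sqnorm (\<lambda>x. s n x - f x)"
      by (rule sqnorm_triangle) (use s f in auto)
    also have "\<dots> \<le> 2 * ((1 / 8) ^ Suc n / 4) + 2 * ((1 / 8) ^ n / 4)"
      by (intro add_mono mult_left_mono sf) auto
    also have "\<dots> \<le> (1 / 8) ^ n" by simp
    finally show "sqnorm (\<lambda>x. transform (s (Suc n)) x - transform (s n) x) \<le> (1 / 8) ^ n" .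
  qed
  then show ?thesis using s sf' by blast
qed

text \<open>The only direct access to the chosen representative; the other properties of
  \<open>wtransform\<close> are derived from such a sequence.\<close>

lemma weinstein_spec:
  assumes "f \<in> L2 \<alpha>"
  shows "\<exists>s. (\<forall>n. s n \<in> L12) \<and> L2_tendsto \<alpha> s f \<and> L2_tendsto \<alpha> (\<lambda>n. transform (s n)) (wtransform f)"
  unfolding weinstein_def L2_extension_def by (rule someI_ex[OF weinstein_witness[OF assms]])

lemma weinstein_in_L2: "f \<in> L2 \<alpha> \<Longrightarrow> wtransform f \<in> L2 \<alpha>"
  using weinstein_spec L2_tendsto_L2(1) by blast

text \<open>
  The factor 16 (in place of 1) avoids the triangle inequality for \<open>L2_norm\<close>;
  only boundedness is used.
\<close>

lemma weinstein_sqnorm_le: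
  assumes f: "f \<in> L2 \<alpha>" and g: "g \<in> L2 \<alpha>"
  shows "sqnorm (\<lambda>x. wtransform f x - wtransform g x) \<le> 16 * sqnorm (\<lambda>x. f x - g x)"
proof -
  obtain s where s: "\<And>n. s n \<in> L12" and sf: "L2_tendsto \<alpha> s f"
    and Fs: "L2_tendsto \<alpha> (\<lambda>n. transform (s n)) (wtransform f)"
    using weinstein_spec[OF f] by blast
  obtain t where t: "\<And>n. t n \<in> L12" and tg: "L2_tendsto \<alpha> t g"
    and Ft: "L2_tendsto \<alpha> (\<lambda>n. transform (t n)) (wtransform g)"
    using weinstein_spec[OF g] by blast
  note mem = weinstein_in_L2[OF f] weinstein_in_L2[OF g] L2_tendsto_L2(2)[OF sf]
      L2_tendsto_L2(2)[OF tg]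
    L2_tendsto_L2(2)[OF Fs] L2_tendsto_L2(2)[OF Ft] f g
  let ?b = "\<lambda>n. 2 * sqnorm (\<lambda>x. transform (s n) x - wtransform f x)
    + 2 * (2 * sqnorm (\<lambda>x. transform (t n) x - wtransform g x)
    + 2 * (2 * sqnorm (\<lambda>x. s n x - f x) + 2 * (2 * sqnorm (\<lambda>x. t n x - g x) + 2 * sqnorm (\<lambda>x. f x
        - g x))))"
  have "sqnorm (\<lambda>x. wtransform f x - wtransform g x) \<le> ?b n" for n
  proof -
    have 1: "sqnorm (\<lambda>x. wtransform f x - wtransform g x)
        \<le> 2 * sqnorm (\<lambda>x. wtransform f x - transform (s n) x)
        + 2 * sqnorm (\<lambda>x. wtransform g x - transform (s n) x)"
      by (rule sqnorm_triangle) (use mem in auto)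
    have 2: "sqnorm (\<lambda>x. wtransform g x - transform (s n) x)
        \<le> 2 * sqnorm (\<lambda>x. wtransform g x - transform (t n) x)
        + 2 * sqnorm (\<lambda>x. transform (s n) x - transform (t n) x)"
      by (rule sqnorm_triangle) (use mem in auto)
    have 3: "sqnorm (\<lambda>x. transform (s n) x - transform (t n) x) \<le> sqnorm (\<lambda>x. s n x - t n x)"
      by (rule transform_diff_sqnorm_le[OF s t])
    have 4: "sqnorm (\<lambda>x. s n x - t n x)
        \<le> 2 * sqnorm (\<lambda>x. s n x - f x) + 2 * sqnorm (\<lambda>x. t n x - f x)"
      by (rule sqnorm_triangle) (use mem in auto)
    have 5: "sqnorm (\<lambda>x. t n x - f x) \<le> 2 * sqnorm (\<lambda>x. t n x - g x) + 2 * sqnorm (\<lambda>x. f x - g x)"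
      by (rule sqnorm_triangle) (use mem in auto)
    have "a \<le> 2 * b + 2 * (2 * d + 2 * (2 * h + 2 * (2 * k + 2 * l)))"
      if "a \<le> 2 * b + 2 * c" "c \<le> 2 * d + 2 * e" "e \<le> i" "i \<le> 2 * h + 2 * j" "j \<le> 2 * k + 2 * l"
      for a b c d e h i j k l :: real
      using that by (simp add: algebra_simps)
    from this[OF 1 2 3 4 5] show ?thesis
      by (simp only: sqnorm_commute[of "wtransform f" "transform (s n)"] sqnorm_commute[of
          "wtransform g" "transform (t n)"])
  qed
  note le = this
  have lim: "?b \<longlonglongrightarrow> 2 * 0 + 2 * (2 * 0 + 2 * (2 * 0 + 2 * (2 * 0 + 2 * sqnorm (\<lambda>x. f x - g x))))"
    by (intro tendsto_intros L2_tendsto_L2(3)[OF sf] L2_tendsto_L2(3)[OF tg] L2_tendsto_L2(3)[OF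
        Fs] L2_tendsto_L2(3)[OF Ft])
  have "sqnorm (\<lambda>x. wtransform f x - wtransform g x)
      \<le> 2 * 0 + 2 * (2 * 0 + 2 * (2 * 0 + 2 * (2 * 0 + 2 * sqnorm (\<lambda>x. f x - g x))))"
    by (rule LIMSEQ_le_const[OF lim exI[of _ 0]]) (use le in blast)
  then show ?thesis by simp
qed

lemma weinstein_tendsto:
  assumes "L2_tendsto \<alpha> s f"
  shows "L2_tendsto \<alpha> (\<lambda>n. wtransform (s n)) (wtransform f)"
proof -
  note mem = L2_tendsto_L2[OF assms]
  have "(\<lambda>n. sqnorm (\<lambda>x. wtransform (s n) x - wtransform f x)) \<longlonglongrightarrow> 0"
  proof (rule tendsto_sandwich[OF _ _ tendsto_const])
    show "(\<lambda>n. 16 * sqnorm (\<lambda>x. s n x - f x)) \<longlonglongrightarrow> 0"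
      by (intro tendsto_mult_right_zero mem)
    show "eventually (\<lambda>n. sqnorm (\<lambda>x. wtransform (s n) x - wtransform f x)
        \<le> 16 * sqnorm (\<lambda>x. s n x - f x)) sequentially"
      by (intro always_eventually allI weinstein_sqnorm_le mem)
  qed simp
  then show ?thesis using mem by (simp add: L2_tendsto_iff weinstein_in_L2)
qed

text \<open>The constant sequence \<open>f\<close> and the chosen approximating sequence have
  transforms with the same limit, since the integral transform contracts differences.\<close>

lemma weinstein_eq_transform:
  assumes f: "f \<in> L12"
  shows "AE x in \<mu>. wtransform f x = transform f x"
proof -
  from f have f2: "f \<in> L2 \<alpha>" and f1: "integrable \<mu> f" by auto
  obtain s where s: "\<And>n. s n \<in> L12" and sf: "L2_tendsto \<alpha> s f"
    and Fs: "L2_tendsto \<alpha> (\<lambda>n. transform (s n)) (wtransform f)"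
    using weinstein_spec[OF f2] by blast
  have "(\<lambda>n. sqnorm (\<lambda>x. transform (s n) x - transform f x)) \<longlonglongrightarrow> 0"
    by (rule tendsto_sandwich[OF _ _ tendsto_const L2_tendsto_L2(3)[OF sf]])
       (auto intro!: always_eventually transform_diff_sqnorm_le s f)
  then have "L2_tendsto \<alpha> (\<lambda>n. transform (s n)) (transform f)"
    using L2_tendsto_L2(2)[OF Fs] transform_L2(1)[OF f1 f2] by (simp add: L2_tendsto_iff)
  from L2_tendsto_unique[OF Fs this] show ?thesis .
qed

lemma L2_tendsto_reflect:
  assumes "L2_tendsto \<alpha> s f"
  shows "L2_tendsto \<alpha> (\<lambda>n x. s n (reflect x)) (\<lambda>x. f (reflect x))"
proof -
  note mem = L2_tendsto_L2[OF assms]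
  have "sqnorm (\<lambda>x. s n (reflect x) - f (reflect x)) = sqnorm (\<lambda>x. s n x - f x)" for n
    using L2_reflect(2)[OF L2_diff(1)[OF mem(2,1)]] by simp
  then show ?thesis using mem by (simp add: L2_tendsto_iff L2_reflect)
qed

text \<open>On integrable functions reflection commutes with the transform at every point. The
  extension retains this only up to null sets, through the uniqueness of limits.\<close>

lemma weinstein_reflect:
  assumes "f \<in> L2 \<alpha>"
  shows "AE x in \<mu>. wtransform (\<lambda>x. f (reflect x)) x = wtransform f (reflect x)"
proof -
  obtain s where s: "\<And>n. s n \<in> L12" and sf: "L2_tendsto \<alpha> s f"
    and Fs: "L2_tendsto \<alpha> (\<lambda>n. transform (s n)) (wtransform f)"
    using weinstein_spec[OF assms] by blast
  have sR: "(\<lambda>x. s n (reflect x)) \<in> L12" for n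
  proof -
    have "integrable (distr \<mu> \<mu> reflect) (s n)" unfolding distr_weinstein_reflect using s by simp
    then have "integrable \<mu> (\<lambda>x. s n (reflect x))"
      by (subst (asm) integrable_distr_eq) (use s in \<open>auto intro: L2_measurable\<close>)
    then show ?thesis using s[of n] L2_reflect(1)[of "s n"] by simp
  qed
  have "L2_tendsto \<alpha> (\<lambda>n. transform (\<lambda>x. s n (reflect x))) (wtransform (\<lambda>x. f (reflect x)))"
  proof (rule L2_tendsto_cong_AE[OF weinstein_tendsto[OF L2_tendsto_reflect[OF sf]]])
    show "AE x in \<mu>. transform (\<lambda>x. s n (reflect x)) x = wtransform (\<lambda>x. s n (reflect x)) x" for n
      using weinstein_eq_transform[OF sR[of n]] by eventually_elim simp
    show "transform (\<lambda>x. s n (reflect x)) \<in> borel_measurable \<mu>" for n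
      using sR[of n] by (intro transform_measurable) simp
  qed (use L2_measurable[OF weinstein_in_L2[OF L2_reflect(1)[OF assms]]] in auto)
  moreover have "transform (\<lambda>x. s n (reflect x)) = (\<lambda>x. transform (s n) (reflect x))" for n
    using s[of n] by (intro ext transform_reflect L2_measurable) simp
  ultimately have "L2_tendsto \<alpha> (\<lambda>n x. transform (s n) (reflect x)) (wtransform (\<lambda>x. f
      (reflect x)))" by simp
  from L2_tendsto_unique[OF this L2_tendsto_reflect[OF Fs]] show ?thesis .
qed

text \<open>Two successive limits in the pairing: the first argument is released while the second
  stays in the dense class, where both sides are still under control, and then the second argument
  is released.\<close>

theorem multiplication_formula:
  assumes f: "f \<in> L2 \<alpha>" and g: "g \<in> L2 \<alpha>"
  shows "(LINT x|\<mu>. wtransform f x * g x) = (LINT x|\<mu>. f x * wtransform g x)"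
proof -
  obtain s where s: "\<And>n. s n \<in> L12" and sf: "L2_tendsto \<alpha> s f"
    and Fs: "L2_tendsto \<alpha> (\<lambda>n. transform (s n)) (wtransform f)"
    using weinstein_spec[OF f] by blast
  obtain t where t: "\<And>n. t n \<in> L12" and tg: "L2_tendsto \<alpha> t g"
    and Ft: "L2_tendsto \<alpha> (\<lambda>n. transform (t n)) (wtransform g)"
    using weinstein_spec[OF g] by blast
  have eq: "(LINT x|\<mu>. wtransform f x * t m x) = (LINT x|\<mu>. f x * transform (t m) x)" for m
  proof (rule LIMSEQ_unique)
    show "(\<lambda>n. LINT x|\<mu>. transform (s n) x * t m x) \<longlonglongrightarrow> (LINT x|\<mu>. wtransform f x * t m x)"
      by (rule L2_tendsto_integral_mult[OF Fs]) (use t in auto)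
    have "(LINT x|\<mu>. transform (s n) x * t m x) = (LINT x|\<mu>. s n x * transform (t m) x)" for n
      using s[of n] t[of m] by (intro multiplication_formula_L1) auto
    then show "(\<lambda>n. LINT x|\<mu>. transform (s n) x * t m x) \<longlonglongrightarrow> (LINT x|\<mu>. f x * transform (t m) x)"
      using L2_tendsto_integral_mult[OF sf, of "transform (t m)"] L2_tendsto_L2(2)[OF Ft] by simp
  qed
  show ?thesis
  proof (rule LIMSEQ_unique)
    show "(\<lambda>m. LINT x|\<mu>. wtransform f x * t m x) \<longlonglongrightarrow> (LINT x|\<mu>. wtransform f x * g x)"
      using L2_tendsto_integral_mult[OF tg weinstein_in_L2[OF f]] by (simp only: mult.commute)
    show "(\<lambda>m. LINT x|\<mu>. wtransform f x * t m x) \<longlonglongrightarrow> (LINT x|\<mu>. f x * wtransform g x)"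
      unfolding eq using L2_tendsto_integral_mult[OF Ft f] by (simp only: mult.commute)
  qed
qed

subsection \<open>Inversion\<close>

lemma measurable_weinstein_angle:
  assumes "h \<in> borel_measurable (borel \<Otimes>\<^sub>M borel)"
  shows "h \<in> borel_measurable (\<mu> \<Otimes>\<^sub>M angle_measure)"
proof -
  have "(\<lambda>p. (fst p, snd p)) \<in> measurable (\<mu> \<Otimes>\<^sub>M angle_measure) (borel \<Otimes>\<^sub>M borel)"
    by (intro measurable_Pair measurable_compose[OF measurable_fst measurable_id_weinstein])
        measurable
  from measurable_compose[OF this assms] show ?thesis by simp
qed

text \<open>Stated for image measures, the swap extends from nonnegative functions to integrable
  complex ones.\<close>

lemma distr_shift_swap:
  fixes x :: "(real ^ 'd::finite) \<times> real"
  shows "distr (\<mu> \<Otimes>\<^sub>M angle_measure) borel (\<lambda>(y, \<theta>). (shift_point x y \<theta>, y))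
       = distr (\<mu> \<Otimes>\<^sub>M angle_measure) borel (\<lambda>(y, \<theta>). (y, shift_point (reflect x) y \<theta>))"
proof (rule measure_eqI)
  have m1: "(\<lambda>(y, \<theta>). (shift_point x y \<theta>, y)) \<in> borel_measurable (\<mu> \<Otimes>\<^sub>M angle_measure)"
      for x :: "(real ^ 'd) \<times> real"
    by (rule measurable_weinstein_angle) measurable
  have m2: "(\<lambda>(y, \<theta>). (y, shift_point x y \<theta>)) \<in> borel_measurable (\<mu> \<Otimes>\<^sub>M angle_measure)"
      for x :: "(real ^ 'd) \<times> real"
    by (rule measurable_weinstein_angle) measurable
  fix A assume "A \<in> sets (distr (\<mu> \<Otimes>\<^sub>M angle_measure) borel (\<lambda>(y, \<theta>). (shift_point x y \<theta>, y)))"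
  then have [measurable]: "A \<in> sets borel" by simp
  have *: "emeasure (distr (\<mu> \<Otimes>\<^sub>M angle_measure) borel (case_prod h)) A
      = (\<integral>\<^sup>+y. \<integral>\<^sup>+\<theta>. indicator A (h y \<theta>) \<partial>angle_measure \<partial>\<mu>)"
    if h: "case_prod h \<in> borel_measurable (\<mu> \<Otimes>\<^sub>M angle_measure)"
        for h :: "_ \<Rightarrow> _ \<Rightarrow> ((real ^ 'd) \<times> real) \<times> ((real ^ 'd) \<times> real)"
  proof -
    note h[measurable]
    have "emeasure (distr (\<mu> \<Otimes>\<^sub>M angle_measure) borel (case_prod h)) A
      = (\<integral>\<^sup>+z. indicator A z \<partial>distr (\<mu> \<Otimes>\<^sub>M angle_measure) borel (case_prod h))" by simp
    also have "\<dots> = (\<integral>\<^sup>+p. indicator A (case_prod h p) \<partial>(\<mu> \<Otimes>\<^sub>M angle_measure))"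
      by (rule nn_integral_distr) measurable
    also have "\<dots> = (\<integral>\<^sup>+y. \<integral>\<^sup>+\<theta>. indicator A (case_prod h (y, \<theta>)) \<partial>angle_measure \<partial>\<mu>)"
      by (rule angle.nn_integral_fst[symmetric]) measurable
    finally show ?thesis by simp
  qed
  show "emeasure (distr (\<mu> \<Otimes>\<^sub>M angle_measure) borel (\<lambda>(y, \<theta>). (shift_point x y \<theta>, y))) A =
      emeasure (distr (\<mu> \<Otimes>\<^sub>M angle_measure) borel (\<lambda>(y, \<theta>). (y, shift_point (reflect x) y \<theta>))) A"
    unfolding *[OF m1] *[OF m2] by (rule nn_integral_shift_swap) measurable
qed simp

lemma integral_shift_swap:
  fixes F :: "((real ^ 'd::finite) \<times> real) \<times> ((real ^ 'd) \<times> real) \<Rightarrow> complex"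
  assumes F [measurable]: "F \<in> borel_measurable borel"
    and int: "integrable (\<mu> \<Otimes>\<^sub>M angle_measure) (\<lambda>(y, \<theta>). F (shift_point x y \<theta>, y))"
  shows "integrable (\<mu> \<Otimes>\<^sub>M angle_measure) (\<lambda>(y, \<theta>). F (y, shift_point (reflect x) y \<theta>))"
    and "(LINT y|\<mu>. LINT \<theta>|angle_measure. F (shift_point x y \<theta>, y)) =
         (LINT y|\<mu>. LINT \<theta>|angle_measure. F (y, shift_point (reflect x) y \<theta>))"
proof -
  interpret pair_sigma_finite "\<mu> :: ((real ^ 'd) \<times> real) measure" angle_measure
    by (intro pair_sigma_finite.intro sigma_finite_weinstein angle.sigma_finite_measure_axioms)
  let ?l = "\<lambda>(y, \<theta>). (shift_point x y \<theta>, y)" and ?r = "\<lambda>(y, \<theta>). (y, shift_point (reflect x) y \<theta>)"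
  have [measurable]: "?l \<in> borel_measurable (\<mu> \<Otimes>\<^sub>M angle_measure)"
    by (rule measurable_weinstein_angle) measurable
  have [measurable]: "?r \<in> borel_measurable (\<mu> \<Otimes>\<^sub>M angle_measure)"
    by (rule measurable_weinstein_angle) measurable
  have "integrable (distr (\<mu> \<Otimes>\<^sub>M angle_measure) borel ?l) F"
    using int by (subst integrable_distr_eq) (auto simp: case_prod_beta')
  then have "integrable (\<mu> \<Otimes>\<^sub>M angle_measure) (\<lambda>p. F (?r p))"
    unfolding distr_shift_swap by (subst (asm) integrable_distr_eq) auto
  then show int': "integrable (\<mu> \<Otimes>\<^sub>M angle_measure) (\<lambda>(y, \<theta>). F (y, shift_point (reflect x) y \<theta>))"
    by (simp add: case_prod_beta')
  have "(LINT p|(\<mu> \<Otimes>\<^sub>M angle_measure). F (?l p)) = (LINT p|(\<mu> \<Otimes>\<^sub>M angle_measure). F (?r p))"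
    using arg_cong[OF distr_shift_swap[of x], of "\<lambda>M. integral\<^sup>L M F"]
    by (simp add: integral_distr)
  then show "(LINT y|\<mu>. LINT \<theta>|angle_measure. F (shift_point x y \<theta>, y)) =
         (LINT y|\<mu>. LINT \<theta>|angle_measure. F (y, shift_point (reflect x) y \<theta>))"
    using integral_fst'[OF int] integral_fst'[OF int'] by (simp add: case_prod_beta')
qed

lemma integral_weinstein_scale:
  fixes F :: "(real ^ 'd::finite) \<times> real \<Rightarrow> complex"
  assumes [measurable]: "F \<in> borel_measurable \<mu>" and \<sigma>: "0 < \<sigma>"
  shows "(LINT x|\<mu>. F (\<sigma> *\<^sub>R x)) = complex_of_real (\<sigma> powr (- hom_dim TYPE('d))) * (LINT x|\<mu>. F x)"
proof -
  have "(LINT x|\<mu>. F (\<sigma> *\<^sub>R x)) = (LINT x|distr \<mu> \<mu> (\<lambda>x. \<sigma> *\<^sub>R x). F x)"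
    by (rule integral_distr[symmetric]) (use \<sigma> in measurable)
  also have "\<dots> = (LINT x|\<mu>. (\<sigma> powr (- hom_dim TYPE('d))) *\<^sub>R F x)"
    unfolding distr_weinstein_scale[OF \<sigma>] by (rule integral_density) auto
  finally show ?thesis by (simp add: scaleR_conv_of_real)
qed

lemma shift_point_zero: "x \<in> half_space \<Longrightarrow> shift_point x 0 \<theta> = x"
  by (cases x) (simp add: shift_point_def)

lemma continuous_on_shift_point [continuous_intros]:
  fixes A :: "'a::t2_space set"
  assumes "continuous_on A f" "continuous_on A g" "continuous_on A h"
  shows "continuous_on A (\<lambda>x. shift_point (f x) (g x) (h x))"
  unfolding shift_point_def using assms by (intro continuous_intros)

text \<open>Swapping the shift moves it from the Gaussian onto \<open>h\<close>, and dilating by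
  sqrt \<epsilon> makes the Gaussian independent of \<epsilon>. Afterwards \<epsilon> occurs only in
  the argument of \<open>h\<close>, ready for dominated convergence.\<close>

lemma heat_average_eq:
  fixes h :: "(real ^ 'd::finite) \<times> real \<Rightarrow> complex"
  assumes \<epsilon>: "0 < \<epsilon>" and h [measurable]: "h \<in> borel_measurable borel" and B: "\<And>x. cmod (h x) \<le> B"
  shows "(LINT y|\<mu>. h y * complex_of_real (heat \<epsilon> x y)) =
    (LINT z|\<mu>. complex_of_real (gauss 1 z) * (LINT \<theta>|angle_measure. h (shift_point (reflect x)
        (sqrt \<epsilon> *\<^sub>R z) \<theta>)))"
proof -
  interpret pair_sigma_finite "\<mu> :: ((real ^ 'd) \<times> real) measure" angle_measure
    by (intro pair_sigma_finite.intro sigma_finite_weinstein angle.sigma_finite_measure_axioms)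
  let ?c = "\<epsilon> powr (- hom_dim TYPE('d) / 2)"
  let ?g = "\<lambda>z :: (real ^ 'd) \<times> real. ?c * gauss (1 / \<epsilon>) z"
  let ?F = "\<lambda>p. complex_of_real (?g (fst p)) * h (snd p)"
  have B0: "0 \<le> B" using order_trans[OF norm_ge_zero B] .
  have meas: "(\<lambda>(y, \<theta>). ?F (shift_point x y \<theta>, y)) \<in> borel_measurable (\<mu> \<Otimes>\<^sub>M angle_measure)"
    by (intro measurable_weinstein_angle) measurable
  have "(\<integral>\<^sup>+p. ennreal (cmod ((\<lambda>(y, \<theta>). ?F (shift_point x y \<theta>, y)) p)) \<partial>(\<mu> \<Otimes>\<^sub>M angle_measure))
     = (\<integral>\<^sup>+y. \<integral>\<^sup>+\<theta>. ennreal (cmod (?F (shift_point x y \<theta>, y))) \<partial>angle_measure \<partial>\<mu>)"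
  proof -
    have "(\<lambda>p. ennreal (cmod ((\<lambda>(y, \<theta>). ?F (shift_point x y \<theta>, y)) p))) \<in> borel_measurable
        (\<mu> \<Otimes>\<^sub>M angle_measure)"
      by (rule measurable_compose[OF meas]) measurable
    from angle.nn_integral_fst[OF this, symmetric] show ?thesis by (simp only: prod.case)
  qed
  also have "\<dots> \<le> (\<integral>\<^sup>+y. \<integral>\<^sup>+\<theta>. ennreal B * ennreal (?g (shift_point x y \<theta>)) \<partial>angle_measure \<partial>\<mu>)"
  proof (intro nn_integral_mono)
    fix y :: "(real ^ 'd) \<times> real" and \<theta>
    have g: "0 \<le> ?g (shift_point x y \<theta>)" by simp
    have "cmod (?F (shift_point x y \<theta>, y)) = ?g (shift_point x y \<theta>) * cmod (h y)"
      using g by (simp only: fst_conv snd_conv norm_mult norm_of_real abs_of_nonneg)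
    also have "\<dots> \<le> ?g (shift_point x y \<theta>) * B" by (rule mult_left_mono[OF B g])
    finally have "ennreal (cmod (?F (shift_point x y \<theta>, y))) \<le> ennreal (B * ?g (shift_point x y \<theta>))"
      by (intro ennreal_leI) (simp only: mult.commute)
    then show "ennreal (cmod (?F (shift_point x y \<theta>, y)))
        \<le> ennreal B * ennreal (?g (shift_point x y \<theta>))"
      by (simp only: ennreal_mult'[OF B0])
  qed
  also have "\<dots> = (\<integral>\<^sup>+y. ennreal B * ennreal (heat \<epsilon> x y) \<partial>\<mu>)"
  proof (rule nn_integral_cong)
    fix y :: "(real ^ 'd) \<times> real"
    have "(\<integral>\<^sup>+\<theta>. ennreal (?g (shift_point x y \<theta>)) \<partial>angle_measure) = ennreal (heat \<epsilon> x y)"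
      unfolding heat_def by (intro nn_integral_eq_integral heat_integrand_integrable \<epsilon>) simp
    then show "(\<integral>\<^sup>+\<theta>. ennreal B * ennreal (?g (shift_point x y \<theta>)) \<partial>angle_measure)
        = ennreal B * ennreal (heat \<epsilon> x y)"
      by (subst nn_integral_cmult) auto
  qed
  also have "\<dots> = ennreal B"
    using nn_integral_heat[OF \<epsilon>, of x]
        by (subst nn_integral_cmult) (auto intro!: borel_measurable_weinsteinI)
  finally have "(\<integral>\<^sup>+p. ennreal (cmod ((\<lambda>(y, \<theta>). ?F (shift_point x y \<theta>, y)) p)) \<partial>(\<mu> \<Otimes>\<^sub>M
      angle_measure)) < \<infinity>"
    by (rule le_less_trans) simp
  then have int: "integrable (\<mu> \<Otimes>\<^sub>M angle_measure) (\<lambda>(y, \<theta>). ?F (shift_point x y \<theta>, y))"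
    by (rule integrableI_bounded[OF meas])
  have "(LINT y|\<mu>. h y * complex_of_real (heat \<epsilon> x y))
      = (LINT y|\<mu>. LINT \<theta>|angle_measure. ?F (shift_point x y \<theta>, y))"
    unfolding heat_def
    by (intro Bochner_Integration.integral_cong refl)
       (simp only: fst_conv snd_conv integral_mult_left_zero integral_complex_of_real, rule
           mult.commute)
  also have "\<dots> = (LINT y|\<mu>. LINT \<theta>|angle_measure. ?F (y, shift_point (reflect x) y \<theta>))"
    by (rule integral_shift_swap(2)[OF _ int]) measurable
  also have "\<dots> = (LINT y|\<mu>. complex_of_real ?c * (complex_of_real (gauss (1 / \<epsilon>) y)
      * (LINT \<theta>|angle_measure. h (shift_point (reflect x) y \<theta>))))"
    by (simp only: fst_conv snd_conv integral_mult_right_zero of_real_mult mult.assoc)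
  also have "\<dots> = complex_of_real ?c * (LINT y|\<mu>. complex_of_real (gauss (1 / \<epsilon>) y)
      * (LINT \<theta>|angle_measure. h (shift_point (reflect x) y \<theta>)))"
    by (rule integral_mult_right_zero)
  \<comment> \<open>The height of the Gaussian is exactly the factor by which the measure scales
    under dilation by sqrt \<epsilon>, so the two cancel.\<close>
  also have "?c = sqrt \<epsilon> powr (- hom_dim TYPE('d))"
    using \<epsilon> by (simp add: powr_half_sqrt[symmetric] powr_powr)
  also have "complex_of_real (sqrt \<epsilon> powr (- hom_dim TYPE('d))) * (LINT y|\<mu>. complex_of_real
      (gauss (1 / \<epsilon>) y) * (LINT \<theta>|angle_measure. h (shift_point (reflect x) y \<theta>)))
    = (LINT z|\<mu>. complex_of_real (gauss (1 / \<epsilon>) (sqrt \<epsilon> *\<^sub>R z)) * (LINT \<theta>|angle_measure. h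
        (shift_point (reflect x) (sqrt \<epsilon> *\<^sub>R z) \<theta>)))"
  proof (rule integral_weinstein_scale[symmetric])
    show "(\<lambda>y. complex_of_real (gauss (1 / \<epsilon>) y) * (LINT \<theta>|angle_measure. h (shift_point
        (reflect x) y \<theta>))) \<in> borel_measurable \<mu>"
      by (rule borel_measurable_weinsteinI) measurable
  qed (use \<epsilon> in simp)
  also have "\<dots> = (LINT z|\<mu>. complex_of_real (gauss 1 z) * (LINT \<theta>|angle_measure. h (shift_point
      (reflect x) (sqrt \<epsilon> *\<^sub>R z) \<theta>)))"
    using \<epsilon> by (intro Bochner_Integration.integral_cong refl) (simp add: gauss_def
        power_mult_distrib)
  finally show ?thesis .
qed

lemma gauss_integral_1: "(LINT z|\<mu>. complex_of_real (gauss 1 (z :: (real ^ 'd::finite) \<times> real)))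
    = 1"
proof -
  have "kernel (0 :: (real ^ 'd) \<times> real) y = 1" for y
    using angle.prob_space by (simp add: weinstein_kernel_def normalized_bessel_eq)
  then show ?thesis
    using gauss_transform(2)[of 1 "0 :: (real ^ 'd) \<times> real"] by (simp add: gauss_def)
qed

text \<open>As \<epsilon> tends to 0, the shift of \<open>reflect x\<close> by sqrt \<epsilon> z
  tends to the shift by 0, which fixes points of the half space. Dominated convergence is applied in
  the angle and then in z, where \<open>gauss 1\<close> has mass one.\<close>

lemma heat_average_tendsto:
  fixes h :: "(real ^ 'd::finite) \<times> real \<Rightarrow> complex"
  assumes h: "continuous_on UNIV h" and B: "\<And>x. cmod (h x) \<le> B" and x: "x \<in> half_space"
    and e: "\<And>n. 0 < e n" "e \<longlonglongrightarrow> 0"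
  shows "(\<lambda>n. LINT y|\<mu>. h y * complex_of_real (heat (e n) x y)) \<longlonglongrightarrow> h (reflect x)"
proof -
  have [measurable]: "h \<in> borel_measurable borel" by (rule borel_measurable_continuous_onI[OF h])
  have B0: "0 \<le> B" using order_trans[OF norm_ge_zero B] .
  let ?z = "\<lambda>n z. sqrt (e n) *\<^sub>R z"
  have inner: "(\<lambda>n. LINT \<theta>|angle_measure. h (shift_point (reflect x) (?z n z) \<theta>)) \<longlonglongrightarrow> h (reflect x)"
      for z
  proof -
    have "(\<lambda>n. LINT \<theta>|angle_measure. h (shift_point (reflect x) (?z n z) \<theta>))
        \<longlonglongrightarrow> (LINT \<theta>|angle_measure. h (reflect x))"
    proof (rule integral_dominated_convergence[where w = "\<lambda>_. B"])
      show "AE \<theta> in angle_measure. (\<lambda>n. h (shift_point (reflect x) (?z n z) \<theta>)) \<longlonglongrightarrow> h (reflect x)"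
      proof (rule AE_I2)
        fix \<theta>
        have "(\<lambda>n. ?z n z) \<longlonglongrightarrow> sqrt 0 *\<^sub>R z" by (intro tendsto_intros e)
        then have z: "(\<lambda>n. ?z n z) \<longlonglongrightarrow> 0" by simp
        have "continuous_on UNIV (\<lambda>w. h (shift_point (reflect x) w \<theta>))"
          by (rule continuous_on_compose2[OF h]) (auto intro!: continuous_intros)
        then have "isCont (\<lambda>w. h (shift_point (reflect x) w \<theta>)) 0"
          by (rule continuous_on_interior) simp
        from isCont_tendsto_compose[OF this z]
        show "(\<lambda>n. h (shift_point (reflect x) (?z n z) \<theta>)) \<longlonglongrightarrow> h (reflect x)"
          using x by (simp add: shift_point_zero)
      qed
    qed (use B in \<open>auto simp: angle.emeasure_space_1\<close>)
    then show ?thesis using angle.prob_space by simp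
  qed
  have g: "integrable \<mu> (gauss 1 :: (real ^ 'd) \<times> real \<Rightarrow> real)" by (rule gauss_transform(1)) simp
  have "(\<lambda>n. LINT z|\<mu>. complex_of_real (gauss 1 z) * (LINT \<theta>|angle_measure. h (shift_point
      (reflect x) (?z n z) \<theta>)))
     \<longlonglongrightarrow> (LINT z|\<mu>. complex_of_real (gauss 1 (z :: (real ^ 'd) \<times> real)) * h (reflect x))"
  proof (rule integral_dominated_convergence[where w = "\<lambda>z. B * gauss 1 z"])
    show "integrable \<mu> (\<lambda>z :: (real ^ 'd) \<times> real. B * gauss 1 z)" using g by simp
    show "AE z in \<mu>. (\<lambda>n. complex_of_real (gauss 1 z) * (LINT \<theta>|angle_measure. h (shift_point
        (reflect x) (?z n z) \<theta>)))
      \<longlonglongrightarrow> complex_of_real (gauss 1 z) * h (reflect x)"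
      by (intro AE_I2 tendsto_intros inner)
    show "AE z in \<mu>. norm (complex_of_real (gauss 1 z) * (LINT \<theta>|angle_measure. h (shift_point
        (reflect x) (?z n z) \<theta>)))
      \<le> B * gauss 1 z" for n
    proof (rule AE_I2)
      fix z :: "(real ^ 'd) \<times> real"
      have "cmod (LINT \<theta>|angle_measure. h (shift_point (reflect x) (?z n z) \<theta>))
          \<le> (LINT \<theta>|angle_measure. B)"
      proof (rule order_trans[OF integral_norm_bound], rule integral_mono)
        show "integrable angle_measure (\<lambda>\<theta>. cmod (h (shift_point (reflect x) (?z n z) \<theta>)))"
          by (rule angle_integrable_bounded[of _ B]) (use B in auto)
      qed (use B in \<open>auto simp: angle.emeasure_space_1\<close>)
      also have "\<dots> = B" using angle.prob_space by simp
      finally show "norm (complex_of_real (gauss 1 z) * (LINT \<theta>|angle_measure. h (shift_point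
          (reflect x) (?z n z) \<theta>))) \<le> B * gauss 1 z"
        by (simp add: norm_mult mult.commute mult_right_mono)
    qed
    show "(\<lambda>z. complex_of_real (gauss 1 z) * (LINT \<theta>|angle_measure. h (shift_point (reflect x)
        (?z n z) \<theta>))) \<in> borel_measurable \<mu>" for n
      by (intro borel_measurable_weinsteinI) measurable
  qed (intro borel_measurable_weinsteinI, measurable)
  moreover have "(LINT z|\<mu>. complex_of_real (gauss 1 (z :: (real ^ 'd) \<times> real)) * h (reflect x))
      = h (reflect x)"
    by (simp only: integral_mult_left_zero gauss_integral_1 mult_1_left)
  ultimately show ?thesis
    by (simp only: heat_average_eq[OF e(1) _ B] \<open>h \<in> borel_measurable borel\<close>)
qed

section \<open>Vanishing tested on closed sets and on continuous functions\<close>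

lemma AE_zero_if_closed_integrals_zero:
  fixes v :: "(real ^ 'd::finite) \<times> real \<Rightarrow> complex"
  assumes v: "integrable \<mu> v"
    and zero: "\<And>C. closed C \<Longrightarrow> (LINT x|\<mu>. indicator C x *\<^sub>R v x) = 0"
  shows "AE x in \<mu>. v x = 0"
proof -
  have [measurable]: "v \<in> borel_measurable \<mu>" using v by simp
  have indm: "(indicator A :: _ \<Rightarrow> real) \<in> borel_measurable \<mu>" if "A \<in> sets borel"
      for A :: "((real ^ 'd) \<times> real) set"
    using that by (intro borel_measurable_weinsteinI borel_measurable_indicator)
  have vi: "integrable \<mu> (\<lambda>x. indicator A x *\<^sub>R v x)" if "A \<in> sets borel" for A
  proof (rule Bochner_Integration.integrable_bound[OF v])
    show "(\<lambda>x. indicator A x *\<^sub>R v x) \<in> borel_measurable \<mu>"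
      by (intro borel_measurable_scaleR indm that) measurable
  qed (auto simp: indicator_def intro!: AE_I2)
  have borel: "sets borel = sigma_sets UNIV (Collect closed :: ((real ^ 'd) \<times> real) set set)"
    unfolding borel_eq_closed by (rule sets_measure_of) simp
  \<comment> \<open>Dynkin's argument: the closed sets are stable under intersection and generate
    the Borel sets. Complements use that the whole space is closed, disjoint unions use dominated
    convergence with majorant |v|.\<close>
  have zero': "(LINT x|\<mu>. indicator A x *\<^sub>R v x) = 0" if "A \<in> sets borel" for A
  proof -
    have "Int_stable (Collect closed :: ((real ^ 'd) \<times> real) set set)"
        by (auto simp: Int_stable_def)
    moreover have "Collect closed \<subseteq> Pow (UNIV :: ((real ^ 'd) \<times> real) set)" by simp
    moreover have "A \<in> sigma_sets UNIV (Collect closed)" using that by (simp add: borel)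
    ultimately show ?thesis
    proof (induction A rule: sigma_sets_induct_disjoint)
      case (basic C)
      then show ?case by (simp add: zero)
    next
      case empty
      show ?case by simp
    next
      case (compl A)
      then have A: "A \<in> sets borel" by (simp add: borel)
      have "(LINT x|\<mu>. indicator (UNIV - A) x *\<^sub>R v x) = (LINT x|\<mu>. v x - indicator A x *\<^sub>R v x)"
        by (intro Bochner_Integration.integral_cong refl) (simp add: indicator_def)
      also have "\<dots> = (LINT x|\<mu>. indicator UNIV x *\<^sub>R v x) - (LINT x|\<mu>. indicator A x *\<^sub>R v x)"
        using v vi[OF A] by (simp add: Bochner_Integration.integral_diff)
      also have "\<dots> = 0" using compl zero[of UNIV] by simp
      finally show ?case .
    next
      case (union A)
      then have A: "A i \<in> sets borel" for i by (auto simp: borel)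
      let ?S = "\<lambda>n x. \<Sum>i<n. indicator (A i) x :: real"
      have sums: "(\<lambda>i. indicator (A i) x :: real) sums indicator (\<Union>i. A i) x" for x
        by (rule indicator_sums) (use union in \<open>auto simp: disjoint_family_on_def\<close>)
      have S: "0 \<le> ?S n x" "?S n x \<le> 1" for n x
      proof -
        have "?S n x \<le> (\<Sum>i. indicator (A i) x)"
          using sums[of x] by (intro sum_le_suminf) (auto simp: sums_iff)
        also have "\<dots> \<le> 1" using sums[of x] by (simp add: sums_iff)
        finally show "?S n x \<le> 1" .
      qed (simp add: sum_nonneg)
      have "(\<lambda>n. LINT x|\<mu>. ?S n x *\<^sub>R v x) \<longlonglongrightarrow> (LINT x|\<mu>. indicator (\<Union>i. A i) x *\<^sub>R v x)"
      proof (rule integral_dominated_convergence[where w = "\<lambda>x. norm (v x)"])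
        show "AE x in \<mu>. (\<lambda>n. ?S n x *\<^sub>R v x) \<longlonglongrightarrow> indicator (\<Union>i. A i) x *\<^sub>R v x"
          using sums by (intro AE_I2 tendsto_intros) (simp add: sums_def)
        show "AE x in \<mu>. norm (?S n x *\<^sub>R v x) \<le> norm (v x)" for n
        proof (rule AE_I2)
          fix x
          show "norm (?S n x *\<^sub>R v x) \<le> norm (v x)"
            unfolding norm_scaleR abs_of_nonneg[OF S(1)] by (intro mult_left_le_one_le S) simp
        qed
        show "(\<lambda>x. ?S n x *\<^sub>R v x) \<in> borel_measurable \<mu>" for n
          by (intro borel_measurable_scaleR borel_measurable_sum indm A) measurable
        show "(\<lambda>x. indicator (\<Union>i. A i) x *\<^sub>R v x) \<in> borel_measurable \<mu>"
          by (intro borel_measurable_scaleR indm sets.countable_UN) (use A in auto)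
      qed (use v in simp)
      moreover have "(LINT x|\<mu>. ?S n x *\<^sub>R v x) = 0" for n
      proof -
        have "(LINT x|\<mu>. ?S n x *\<^sub>R v x) = (\<Sum>i<n. LINT x|\<mu>. indicator (A i) x *\<^sub>R v x)"
          unfolding scaleR_sum_left by (intro Bochner_Integration.integral_sum vi A)
        then show ?thesis using union by simp
      qed
      ultimately show ?case by (simp add: LIMSEQ_const_iff)
    qed
  qed
  \<comment> \<open>Each of the four functionals is tested on the set where it is positive: there it
    is nonnegative with integral zero. Both signs of both parts together give v = 0.\<close>
  have part: "AE x in \<mu>. g (v x) \<le> 0" if g: "bounded_linear g" "g = Re \<or> g = Im \<or> g
      = (\<lambda>z. - Re z) \<or> g = (\<lambda>z. - Im z)" for g
  proof -
    have gm: "g \<in> borel_measurable borel"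
      by (intro borel_measurable_continuous_onI linear_continuous_on g)
    define A where "A = {x \<in> space \<mu>. g (v x) > 0}"
    have "A \<in> sets \<mu>" unfolding A_def using gm by measurable
    then have A: "A \<in> sets borel" by (rule sets_weinstein_borel)
    have "integrable \<mu> (\<lambda>x. g (indicator A x *\<^sub>R v x))"
        by (rule integrable_bounded_linear[OF g(1) vi[OF A]])
    moreover have "(LINT x|\<mu>. g (indicator A x *\<^sub>R v x)) = 0"
      using integral_bounded_linear[OF g(1) vi[OF A]] zero'[OF A]
          by (simp add: linear_simps[OF g(1)])
    moreover have "AE x in \<mu>. 0 \<le> g (indicator A x *\<^sub>R v x)"
      by (auto simp: A_def indicator_def linear_simps[OF g(1)])
    ultimately have "AE x in \<mu>. g (indicator A x *\<^sub>R v x) = 0"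
      using integral_nonneg_eq_0_iff_AE[of \<mu> "\<lambda>x. g (indicator A x *\<^sub>R v x)"] by blast
    then show ?thesis
    proof (rule AE_mp, intro AE_I2 impI)
      fix x assume "x \<in> space (\<mu> :: ((real ^ 'd) \<times> real) measure)" "g (indicator A x *\<^sub>R v x) = 0"
      then show "g (v x) \<le> 0" by (cases "g (v x) > 0") (auto simp: A_def)
    qed
  qed
  have "AE x in \<mu>. Re (v x) \<le> 0" "AE x in \<mu>. Im (v x) \<le> 0" "AE x in \<mu>. - Re (v x)
      \<le> 0" "AE x in \<mu>. - Im (v x) \<le> 0"
    using part[of Re] part[of Im] part[of "\<lambda>z. - Re z"] part[of "\<lambda>z. - Im z"]
    by (auto intro: bounded_linear_Re bounded_linear_Im bounded_linear_minus)
  then show ?thesis by eventually_elim (simp add: complex_eq_iff)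
qed

text \<open>A square integrable \<open>w\<close> need not be integrable, so it is multiplied by
  \<open>gauss 1\<close>, which has no zeros. The same Gaussian makes the continuous test functions
  integrable and square integrable.\<close>

lemma AE_zero_if_orthogonal_to_continuous:
  fixes w :: "(real ^ 'd::finite) \<times> real \<Rightarrow> complex"
  assumes w: "w \<in> L2 \<alpha>"
    and zero: "\<And>h B. continuous_on UNIV h \<Longrightarrow> (\<And>x. cmod (h x) \<le> B) \<Longrightarrow> h \<in> L12 \<Longrightarrow> (LINT x|\<mu>. w x * h x)
        = 0"
  shows "AE x in \<mu>. w x = 0"
proof -
  have [measurable]: "w \<in> borel_measurable \<mu>" by (rule L2_measurable[OF w])
  let ?v = "\<lambda>x. complex_of_real (gauss 1 x) * w x"
  have v: "integrable \<mu> ?v" by (rule gauss_mult_integrable[OF _ w]) simp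
  have "AE x in \<mu>. ?v x = 0"
  proof (rule AE_zero_if_closed_integrals_zero[OF v])
    fix C :: "((real ^ 'd) \<times> real) set"
    assume C: "closed C"
    show "(LINT x|\<mu>. indicator C x *\<^sub>R ?v x) = 0"
    \<comment> \<open>The ramps \<open>?k n\<close> are 1 on the closed set \<open>C\<close> and
      tend to 0 off it because the distance is positive there. For empty \<open>C\<close> this
      fails, since \<open>infdist x {}\<close> is 0, but then the integral vanishes
      trivially.\<close>
    proof (cases "C = {}")
      case False
      let ?k = "\<lambda>n x. max 0 (1 - real n * infdist x C)"
      let ?h = "\<lambda>n x. complex_of_real (gauss 1 x * ?k n x)"
      have k: "0 \<le> ?k n x" "?k n x \<le> 1" for n x
        using infdist_nonneg[of x C] by (auto simp: mult_nonneg_nonneg)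
      have kc: "continuous_on UNIV (?k n)" for n by (intro continuous_intros)
      have hc: "continuous_on UNIV (?h n)" for n by (intro continuous_intros kc)
      have hm: "?h n \<in> borel_measurable \<mu>" for n
        by (intro borel_measurable_weinsteinI borel_measurable_continuous_onI hc)
      have hb: "cmod (?h n x) \<le> gauss 1 x" for n x
        unfolding norm_of_real abs_of_nonneg[OF mult_nonneg_nonneg[OF gauss_nonneg k(1)]]
        by (rule mult_left_le[OF k(2) gauss_nonneg])
      have h1: "cmod (?h n x) \<le> 1" for n x using hb[of x n] gauss_le_1[of 1 x] by linarith
      have g: "integrable \<mu> (gauss 1 :: (real ^ 'd) \<times> real \<Rightarrow> real)"
          by (rule gauss_transform(1)) simp
      have hi: "integrable \<mu> (?h n)" for n
        by (rule Bochner_Integration.integrable_bound[OF g hm]) (use hb in \<open>auto intro!: AE_I2\<close>)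
      have "?h n \<in> L2 \<alpha>" for n
      proof (rule L2_bound[OF hm g], rule AE_I2)
        fix x
        have "cmod (?h n x) * cmod (?h n x) \<le> gauss 1 x * 1" by (rule mult_mono[OF hb h1]) simp_all
        then show "(cmod (?h n x))\<^sup>2 \<le> gauss 1 x" by (simp only: power2_eq_square mult_1_right)
      qed
      then have zero_n: "(LINT x|\<mu>. w x * ?h n x) = 0" for n
        using hi by (intro zero[OF hc h1]) auto
      have "(\<lambda>n. LINT x|\<mu>. w x * ?h n x) \<longlonglongrightarrow> (LINT x|\<mu>. indicator C x *\<^sub>R ?v x)"
      proof (rule integral_dominated_convergence[where w = "\<lambda>x. cmod (?v x)"])
        show "integrable \<mu> (\<lambda>x. cmod (?v x))" using v by simp
        show "AE x in \<mu>. (\<lambda>n. w x * ?h n x) \<longlonglongrightarrow> indicator C x *\<^sub>R ?v x"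
        proof (rule AE_I2)
          fix x
          have "(\<lambda>n. ?k n x) \<longlonglongrightarrow> indicator C x"
          proof (cases "x \<in> C")
            case True
            then show ?thesis by simp
          next
            case False
            then have d: "0 < infdist x C" using C \<open>C \<noteq> {}\<close> by (simp add: infdist_pos_not_in_closed)
            obtain N where N: "1 / infdist x C < real N" using reals_Archimedean2 by blast
            have "?k n x = 0" if "N \<le> n" for n
            proof -
              have "1 / infdist x C \<le> real n" using N that by linarith
              then have "1 \<le> real n * infdist x C" using d by (simp add: field_simps)
              then show ?thesis by simp
            qed
            then have "eventually (\<lambda>n. ?k n x = 0) sequentially"
                by (auto simp: eventually_sequentially)
            then show ?thesis using False by (simp add: tendsto_eventually)
          qed
          then have "(\<lambda>n. w x * complex_of_real (gauss 1 x * ?k n x))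
              \<longlonglongrightarrow> w x * complex_of_real (gauss 1 x * indicator C x)"
            by (intro tendsto_intros)
          then show "(\<lambda>n. w x * ?h n x) \<longlonglongrightarrow> indicator C x *\<^sub>R ?v x"
            by (simp add: scaleR_conv_of_real mult_ac)
        qed
        show "AE x in \<mu>. norm (w x * ?h n x) \<le> cmod (?v x)" for n
        proof (rule AE_I2)
          fix x
          show "norm (w x * ?h n x) \<le> cmod (?v x)"
            using mult_left_mono[OF hb[of x n], of "cmod (w x)"]
                by (simp add: norm_mult mult.commute)
        qed
        show "(\<lambda>x. indicator C x *\<^sub>R ?v x) \<in> borel_measurable \<mu>"
        proof -
          have "(indicator C :: _ \<Rightarrow> real) \<in> borel_measurable \<mu>"
            using C by (intro borel_measurable_weinsteinI) (auto intro: borel_closed)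
          then show ?thesis by measurable
        qed
        show "(\<lambda>x. w x * ?h n x) \<in> borel_measurable \<mu>" for n
          by (intro borel_measurable_times hm) measurable
      qed
      then have "(\<lambda>n. 0) \<longlonglongrightarrow> (LINT x|\<mu>. indicator C x *\<^sub>R ?v x)" by (simp only: zero_n)
      from LIMSEQ_unique[OF this tendsto_const] show ?thesis .
    qed simp
  qed
  then show ?thesis by eventually_elim (simp add: less_imp_neq[OF gauss_pos, symmetric])
qed

text \<open>The identity is tested against bounded continuous \<open>h\<close>. With a Gaussian
  inserted between the transforms, Fubini's theorem moves the heat kernel onto \<open>h\<close>,
  where the averages converge pointwise to \<open>h (reflect x)\<close>; for \<open>f\<close> alone
  no pointwise limit would be available.\<close>

lemma inversion_L12:
  fixes f :: "(real ^ 'd::finite) \<times> real \<Rightarrow> complex"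
  assumes f: "f \<in> L12"
  shows "AE x in \<mu>. wtransform (wtransform f) x = f (reflect x)"
proof -
  from f have f2: "f \<in> L2 \<alpha>" and f1: "integrable \<mu> f" by auto
  note [measurable] = L2_measurable[OF f2]
  let ?F = "transform f" and ?e = "\<lambda>n. 1 / real (Suc n)"
  let ?t = "\<lambda>n x. complex_of_real (gauss (?e n) x) * ?F x"
  have F2: "?F \<in> L2 \<alpha>" by (rule transform_L2(1)[OF f1 f2])
  have t: "?t n \<in> L12" for n by (rule gauss_mult_L12[OF _ F2]) simp
  have lim: "L2_tendsto \<alpha> (\<lambda>n. wtransform (?t n)) (wtransform ?F)"
    by (rule weinstein_tendsto[OF gauss_approx[OF F2]])
  have W2: "wtransform ?F \<in> L2 \<alpha>" by (rule weinstein_in_L2[OF F2])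
  have diff: "(\<lambda>x. wtransform ?F x - f (reflect x)) \<in> L2 \<alpha>"
    by (rule L2_diff(1)[OF W2 L2_reflect(1)[OF f2]])
  have "AE x in \<mu>. wtransform ?F x - f (reflect x) = 0"
  proof (rule AE_zero_if_orthogonal_to_continuous[OF diff])
    fix h :: "(real ^ 'd) \<times> real \<Rightarrow> complex" and B :: real
    assume hc: "continuous_on UNIV h" and hB: "\<And>x. cmod (h x) \<le> B" and h12: "h \<in> L12"
    then have h2: "h \<in> L2 \<alpha>" and h1: "integrable \<mu> h" by auto
    note [measurable] = L2_measurable[OF h2]
    \<comment> \<open>The cutoff makes the outer transform an actual integral, so the chosen
      representative may be replaced by it under the pairing.\<close>
    have step: "(LINT x|\<mu>. wtransform (?t n) x * h x)
        = (LINT x|\<mu>. f x * (LINT y|\<mu>. h y * complex_of_real (heat (?e n) x y)))" for n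
    proof -
      have e: "0 < ?e n" by simp
      have "(LINT x|\<mu>. wtransform (?t n) x * h x) = (LINT y|\<mu>. transform (?t n) y * h y)"
        using weinstein_eq_transform[OF t[of n]] L2_measurable[OF weinstein_in_L2, of
            "?t n"] t[of n]
        by (intro integral_cong_AE borel_measurable_times transform_measurable) auto
      also have "\<dots> = (LINT y|\<mu>. h y * (LINT x|\<mu>. f x * complex_of_real (heat (?e n) x y)))"
      proof (intro Bochner_Integration.integral_cong refl)
        fix y assume "y \<in> space (\<mu> :: ((real ^ 'd) \<times> real) measure)"
        then have "y \<in> half_space" by simp
        from transform_gauss_transform[OF e f1 this]
        show "transform (?t n) y * h y = h y * (LINT x|\<mu>. f x * complex_of_real (heat (?e n) x y))"
          by (simp only: mult.commute)
      qed
      also have "\<dots> = (LINT x|\<mu>. f x * (LINT y|\<mu>. h y * complex_of_real (heat (?e n) x y)))"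
      proof (rule Fubini_bounded_kernel[OF sigma_finite_weinstein sigma_finite_weinstein f1 h1])
        show "(\<lambda>(x, y). complex_of_real (heat (?e n) x y)) \<in> borel_measurable (\<mu> \<Otimes>\<^sub>M \<mu>)"
          by (intro borel_measurable_pair_weinsteinI) measurable
        show "cmod (complex_of_real (heat (?e n) x y)) \<le> ?e n powr (- hom_dim TYPE('d) / 2)"
            for x y :: "(real ^ 'd) \<times> real"
          using heat_le[OF e, of x y] by simp
      qed
      finally show ?thesis .
    qed
    have "(\<lambda>n. LINT x|\<mu>. f x * (LINT y|\<mu>. h y * complex_of_real (heat (?e n) x y)))
        \<longlonglongrightarrow> (LINT x|\<mu>. f x * h (reflect x))"
    proof (rule integral_dominated_convergence[where w = "\<lambda>x. B * cmod (f x)"])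
      show "integrable \<mu> (\<lambda>x. B * cmod (f x))" using f1 by simp
      show "AE x in \<mu>. (\<lambda>n. f x * (LINT y|\<mu>. h y * complex_of_real (heat (?e n) x y)))
          \<longlonglongrightarrow> f x * h (reflect x)"
      proof (rule AE_I2)
        fix x assume "x \<in> space (\<mu> :: ((real ^ 'd) \<times> real) measure)"
        then have x: "x \<in> half_space" by simp
        show "(\<lambda>n. f x * (LINT y|\<mu>. h y * complex_of_real (heat (?e n) x y))) \<longlonglongrightarrow> f x * h (reflect x)"
          by (intro tendsto_intros heat_average_tendsto[OF hc hB x] LIMSEQ_Suc lim_1_over_n) simp
      qed
      show "AE x in \<mu>. norm (f x * (LINT y|\<mu>. h y * complex_of_real (heat (?e n) x y)))
          \<le> B * cmod (f x)" for n
      proof (rule AE_I2)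
        fix x
        have e: "0 < ?e n" by simp
        have B0: "0 \<le> B" using order_trans[OF norm_ge_zero hB] .
        have "ennreal (cmod (LINT y|\<mu>. h y * complex_of_real (heat (?e n) x y)))
            \<le> (\<integral>\<^sup>+y. ennreal (cmod (h y * complex_of_real (heat (?e n) x y))) \<partial>\<mu>)"
          by (rule norm_integral_le_nn_integral)
        also have "\<dots> \<le> (\<integral>\<^sup>+y. ennreal B * ennreal (heat (?e n) x y) \<partial>\<mu>)"
          by (intro nn_integral_mono)
             (auto simp: norm_mult ennreal_mult'[OF B0, symmetric] intro!: ennreal_leI
                 mult_right_mono hB)
        also have "\<dots> = ennreal B * (\<integral>\<^sup>+y. ennreal (heat (?e n) x y) \<partial>\<mu>)"
          by (intro nn_integral_cmult borel_measurable_weinsteinI) measurable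
        also have "\<dots> = ennreal B" by (simp only: nn_integral_heat[OF e] mult_1_right)
        finally have "cmod (LINT y|\<mu>. h y * complex_of_real (heat (?e n) x y)) \<le> B" using B0 by simp
        from mult_left_mono[OF this, of "cmod (f x)"]
        show "norm (f x * (LINT y|\<mu>. h y * complex_of_real (heat (?e n) x y))) \<le> B * cmod (f x)"
          by (simp only: norm_mult mult.commute[of B] norm_ge_zero)
      qed
      show "(\<lambda>x. f x * h (reflect x)) \<in> borel_measurable \<mu>" by measurable
      have "(\<lambda>(x, y). complex_of_real (heat (?e n) x y)) \<in> borel_measurable (\<mu> \<Otimes>\<^sub>M (\<mu> ::
          ((real ^ 'd) \<times> real) measure))" for n
        by (intro borel_measurable_pair_weinsteinI) measurable
      then show "(\<lambda>x. f x * (LINT y|\<mu>. h y * complex_of_real (heat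
          (?e n) x y))) \<in> borel_measurable \<mu>" for n
        by measurable
    qed
    then have "(\<lambda>n. LINT x|\<mu>. wtransform (?t n) x * h x) \<longlonglongrightarrow> (LINT x|\<mu>. f x * h (reflect x))"
      by (simp only: step)
    from LIMSEQ_unique[OF L2_tendsto_integral_mult[OF lim h2] this]
    have "(LINT x|\<mu>. wtransform ?F x * h x) = (LINT x|\<mu>. f x * h (reflect x))" .
    also have "\<dots> = (LINT x|\<mu>. f (reflect x) * h x)"
      using integral_weinstein_reflect[of "\<lambda>x. f (reflect x) * h x"] by simp
    finally show "(LINT x|\<mu>. (wtransform ?F x - f (reflect x)) * h x) = 0"
      using L2_mult_integrable[OF W2 h2] L2_mult_integrable[OF L2_reflect(1)[OF f2] h2]
      by (simp add: left_diff_distrib Bochner_Integration.integral_diff)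
  qed
  \<comment> \<open>The inner \<open>wtransform f\<close> and the integral \<open>?F\<close> differ
    by a function of norm zero, which the bound on \<open>wtransform\<close> maps to one of norm
    zero.\<close>
  moreover have "AE x in \<mu>. wtransform (wtransform f) x = wtransform ?F x"
  proof (rule AE_eq_if_sqnorm_zero)
    have "sqnorm (\<lambda>x. wtransform f x - ?F x) = sqnorm (\<lambda>_ :: (real ^ 'd) \<times> real. 0)"
      by (rule sqnorm_cong_AE)
         (use weinstein_eq_transform[OF f] L2_measurable[OF weinstein_in_L2[OF f2]]
             transform_measurable[OF f1] in auto)
    then have "sqnorm (\<lambda>x. wtransform f x - ?F x) = 0" by (simp add: sqnorm_def)
    then show "sqnorm (\<lambda>x. wtransform (wtransform f) x - wtransform ?F x) = 0"
      using weinstein_sqnorm_le[OF weinstein_in_L2[OF f2] F2] sqnorm_nonneg[of "\<lambda>x. wtransform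
          (wtransform f) x - wtransform ?F x"] by linarith
  qed (use W2 f2 weinstein_in_L2 in auto)
  ultimately show ?thesis by eventually_elim simp
qed

theorem weinstein_inversion:
  assumes f: "f \<in> L2 \<alpha>"
  shows "AE x in \<mu>. wtransform (wtransform f) x = f (reflect x)"
proof -
  let ?s = "\<lambda>n x. complex_of_real (gauss (1 / real (Suc n)) x) * f x"
  have s: "?s n \<in> L12" for n by (rule gauss_mult_L12[OF _ f]) simp
  have lim: "L2_tendsto \<alpha> ?s f" by (rule gauss_approx[OF f])
  have "L2_tendsto \<alpha> (\<lambda>n x. ?s n (reflect x)) (wtransform (wtransform f))"
  proof (rule L2_tendsto_cong_AE[OF weinstein_tendsto[OF weinstein_tendsto[OF lim]]])
    show "AE x in \<mu>. ?s n (reflect x) = wtransform (wtransform (?s n)) x" for n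
      using inversion_L12[OF s[of n]] by eventually_elim simp
    show "(\<lambda>x. ?s n (reflect x)) \<in> borel_measurable \<mu>" for n
      by (rule L2_measurable[OF L2_tendsto_L2(2)[OF L2_tendsto_reflect[OF lim]]])
    show "wtransform (wtransform f) \<in> borel_measurable \<mu>"
      by (intro L2_measurable weinstein_in_L2 f)
  qed simp
  from L2_tendsto_unique[OF this L2_tendsto_reflect[OF lim]] show ?thesis .
qed

subsection \<open>Translation as a multiplier\<close>

lemma weinstein_cong_AE:
  fixes f g :: "(real ^ 'd::finite) \<times> real \<Rightarrow> complex"
  assumes "f \<in> L2 \<alpha>" "g \<in> borel_measurable \<mu>" "AE x in \<mu>. g x = f x"
  shows "AE x in \<mu>. wtransform g x = wtransform f x"
proof (rule AE_eq_if_sqnorm_zero)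
  have g: "g \<in> L2 \<alpha>" by (rule L2_cong_AE[OF assms])
  show "wtransform g \<in> L2 \<alpha>" "wtransform f \<in> L2 \<alpha>" using assms(1) g weinstein_in_L2 by auto
  have "sqnorm (\<lambda>x. g x - f x) = sqnorm (\<lambda>_ :: (real ^ 'd) \<times> real. 0)"
    by (rule sqnorm_cong_AE) (use assms L2_measurable[OF assms(1)] in auto)
  then have "sqnorm (\<lambda>x. g x - f x) = 0" by (simp add: sqnorm_def)
  then show "sqnorm (\<lambda>x. wtransform g x - wtransform f x) = 0"
    using weinstein_sqnorm_le[OF g assms(1)] sqnorm_nonneg[of "\<lambda>x. wtransform g x
        - wtransform f x"] by simp
qed

definition shift_average :: "(real ^ 'd::finite) \<times> real \<Rightarrow> ((real ^ 'd) \<times> real \<Rightarrow> complex) \<Rightarrow>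
    (real ^ 'd) \<times> real \<Rightarrow> complex" where
  "shift_average x f y = (LINT \<theta>|angle_measure. f (shift_point x y \<theta>))"

lemma translation_cont_eq:
  fixes f :: "(real ^ 'd::finite) \<times> real \<Rightarrow> complex"
  assumes [measurable]: "f \<in> borel_measurable borel"
  shows "translation_cont \<alpha> x f y = shift_average x f y"
proof -
  have "shift_average x f y = complex_of_real angle_const *
      (LINT \<theta>:{0..pi}|lborel. f (shift_point x y \<theta>) * complex_of_real (sin \<theta> powr (2 * \<alpha>)))"
    unfolding shift_average_def by (rule integral_angle) measurable
  then show ?thesis
    by (simp only: translation_cont_def angle_const_def shift_point_def)
qed

lemma shift_average_borel:
  fixes f :: "(real ^ 'd::finite) \<times> real \<Rightarrow> complex"
  assumes [measurable]: "f \<in> borel_measurable borel"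
  shows "shift_average x f \<in> borel_measurable borel"
  unfolding shift_average_def by measurable

text \<open>Swapping the shift moves it onto the kernel, where the product formula splits off the
  factor at \<open>reflect x\<close>. The bound \<open>B\<close> yields square integrability from
  integrability, as |a|^2 \<le> B |a|.\<close>

lemma shift_average_L12:
  fixes f :: "(real ^ 'd::finite) \<times> real \<Rightarrow> complex"
  assumes f [measurable]: "f \<in> borel_measurable borel" and int: "integrable \<mu> f"
    and B: "\<And>x. cmod (f x) \<le> B" and x: "x \<in> half_space"
  shows "shift_average x f \<in> L12"
    and "transform (shift_average x f) \<xi> = kernel \<xi> (reflect x) * transform f \<xi>"
proof -
  interpret pair_sigma_finite "\<mu> :: ((real ^ 'd) \<times> real) measure" angle_measure
    by (intro pair_sigma_finite.intro sigma_finite_weinstein angle.sigma_finite_measure_axioms)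
  let ?f = "\<lambda>(y, \<theta>). f (shift_point x y \<theta>)"
  have B0: "0 \<le> B" using order_trans[OF norm_ge_zero B] .
  have meas [measurable]: "?f \<in> borel_measurable (\<mu> \<Otimes>\<^sub>M angle_measure)"
    by (rule measurable_weinstein_angle) measurable
  have "(\<integral>\<^sup>+p. ennreal (cmod (?f p)) \<partial>(\<mu> \<Otimes>\<^sub>M angle_measure))
      = (\<integral>\<^sup>+y. \<integral>\<^sup>+\<theta>. ennreal (cmod (?f (y, \<theta>))) \<partial>angle_measure \<partial>\<mu>)"
    by (rule angle.nn_integral_fst[symmetric]) measurable
  also have "\<dots> = (\<integral>\<^sup>+y. \<integral>\<^sup>+\<theta>. ennreal (cmod (f y)) \<partial>angle_measure \<partial>\<mu>)"
    using nn_integral_shift_swap[of "\<lambda>p. ennreal (cmod (f (fst p)))" x] by simp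
  also have "\<dots> = (\<integral>\<^sup>+y. ennreal (cmod (f y)) \<partial>\<mu>)"
    by (simp add: angle.emeasure_space_1[simplified])
  also have "\<dots> < \<infinity>" using int by (simp add: integrable_iff_bounded)
  finally have pint: "integrable (\<mu> \<Otimes>\<^sub>M angle_measure) ?f"
    by (rule integrableI_bounded[OF meas])
  have s1: "integrable \<mu> (shift_average x f)"
    using integrable_fst'[OF pint] by (simp add: shift_average_def[abs_def])
  have sm [measurable]: "shift_average x f \<in> borel_measurable \<mu>"
    by (intro borel_measurable_weinsteinI shift_average_borel f)
  have sB: "cmod (shift_average x f y) \<le> B" for y
  proof -
    have "cmod (shift_average x f y) \<le> (LINT \<theta>|angle_measure. B)"
      unfolding shift_average_def
    proof (rule order_trans[OF integral_norm_bound], rule integral_mono)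
      show "integrable angle_measure (\<lambda>\<theta>. cmod (f (shift_point x y \<theta>)))"
        by (rule angle_integrable_bounded[of _ B]) (use B in auto)
    qed (use B in \<open>auto simp: angle.emeasure_space_1\<close>)
    then show ?thesis using angle.prob_space by simp
  qed
  have "shift_average x f \<in> L2 \<alpha>"
  proof (rule L2_bound[where h = "\<lambda>y. B * cmod (shift_average x f y)"])
    show "integrable \<mu> (\<lambda>y. B * cmod (shift_average x f y))" using s1 by simp
    show "AE y in \<mu>. (cmod (shift_average x f y))\<^sup>2 \<le> B * cmod (shift_average x f y)"
      using sB by (intro AE_I2) (simp add: power2_eq_square mult_right_mono)
  qed measurable
  then show "shift_average x f \<in> L12" using s1 by simp
  let ?F = "\<lambda>p. f (fst p) * kernel \<xi> (snd p)"
  have Fint: "integrable (\<mu> \<Otimes>\<^sub>M angle_measure) (\<lambda>(y, \<theta>). ?F (shift_point x y \<theta>, y))"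
  proof (rule Bochner_Integration.integrable_bound[OF pint])
    show "(\<lambda>(y, \<theta>). ?F (shift_point x y \<theta>, y)) \<in> borel_measurable (\<mu> \<Otimes>\<^sub>M angle_measure)"
      by (rule measurable_weinstein_angle) measurable
    show "AE p in \<mu> \<Otimes>\<^sub>M angle_measure. norm ((\<lambda>(y, \<theta>). ?F (shift_point x y \<theta>, y)) p) \<le> norm (?f p)"
      by (intro AE_I2) (auto simp: norm_mult mult_left_le norm_kernel_le)
  qed
  have "transform (shift_average x f) \<xi>
      = (LINT y|\<mu>. LINT \<theta>|angle_measure. ?F (shift_point x y \<theta>, y))"
    unfolding weinstein_L1_def shift_average_def by simp
  also have "\<dots> = (LINT y|\<mu>. LINT \<theta>|angle_measure. ?F (y, shift_point (reflect x) y \<theta>))"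
    by (rule integral_shift_swap(2)[OF _ Fint]) measurable
  also have "\<dots> = (LINT y|\<mu>. kernel \<xi> (reflect x) * (f y * kernel \<xi> y))"
  proof (intro Bochner_Integration.integral_cong refl)
    fix y assume "y \<in> space (\<mu> :: ((real ^ 'd) \<times> real) measure)"
    then have "y \<in> half_space" by simp
    with x have "(LINT \<theta>|angle_measure. kernel \<xi> (shift_point (reflect x) y \<theta>))
        = kernel \<xi> (reflect x) * kernel \<xi> y"
      by (intro kernel_product) simp_all
    then show "(LINT \<theta>|angle_measure. ?F (y, shift_point (reflect x) y \<theta>))
        = kernel \<xi> (reflect x) * (f y * kernel \<xi> y)"
      by simp
  qed
  also have "\<dots> = kernel \<xi> (reflect x) * transform f \<xi>"
    unfolding weinstein_L1_def by (rule integral_mult_right_zero)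
  finally show "transform (shift_average x f) \<xi> = kernel \<xi> (reflect x) * transform f \<xi>" .
qed

text \<open>The translation as it acts on the transform side; the outer reflection makes the second
  transform an inverse. Being continuous on all of \<open>L2\<close>, it is the candidate for the
  value of \<open>L2_extension\<close>.\<close>

definition multiplier_translation ::
  "(real ^ 'd::finite) \<times> real \<Rightarrow> ((real ^ 'd) \<times> real \<Rightarrow> complex) \<Rightarrow> (real ^ 'd) \<times> real \<Rightarrow> complex" where
  "multiplier_translation x f y
      = wtransform (\<lambda>\<xi>. kernel \<xi> (reflect x) * wtransform f \<xi>) (reflect y)"

lemma kernel_mult_L2:
  assumes "f \<in> L2 \<alpha>"
  shows "(\<lambda>\<xi>. kernel \<xi> x * f \<xi>) \<in> L2 \<alpha>" and "sqnorm (\<lambda>\<xi>. kernel \<xi> x * f \<xi>) \<le> sqnorm f"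
proof -
  have m: "(\<lambda>\<xi>. kernel \<xi> x) \<in> borel_measurable \<mu>" by (rule borel_measurable_weinsteinI) measurable
  have b: "AE \<xi> in \<mu>. cmod (kernel \<xi> x) \<le> 1" by (intro AE_I2 norm_kernel_le)
  show "(\<lambda>\<xi>. kernel \<xi> x * f \<xi>) \<in> L2 \<alpha>" by (rule L2_mult_bounded(1)[OF assms m b]) simp
  show "sqnorm (\<lambda>\<xi>. kernel \<xi> x * f \<xi>) \<le> sqnorm f" using L2_mult_bounded(2)[OF assms m b] by simp
qed

lemma kernel_mult_tendsto:
  assumes "L2_tendsto \<alpha> s f"
  shows "L2_tendsto \<alpha> (\<lambda>n \<xi>. kernel \<xi> x * s n \<xi>) (\<lambda>\<xi>. kernel \<xi> x * f \<xi>)"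
proof -
  note mem = L2_tendsto_L2[OF assms]
  have "sqnorm (\<lambda>\<xi>. kernel \<xi> x * s n \<xi> - kernel \<xi> x * f \<xi>) \<le> sqnorm (\<lambda>\<xi>. s n \<xi> - f \<xi>)" for n
    using kernel_mult_L2(2)[OF L2_diff(1)[OF mem(2,1)]] by (simp add: right_diff_distrib)
  then have "(\<lambda>n. sqnorm (\<lambda>\<xi>. kernel \<xi> x * s n \<xi> - kernel \<xi> x * f \<xi>)) \<longlonglongrightarrow> 0"
    by (intro tendsto_sandwich[OF _ _ tendsto_const mem(3)]) auto
  then show ?thesis using mem by (simp add: L2_tendsto_iff kernel_mult_L2)
qed

lemma multiplier_translation_tendsto:
  "L2_tendsto \<alpha> s f \<Longrightarrow> L2_tendsto \<alpha> (\<lambda>n. multiplier_translation x (s n)) (multiplier_translation x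
      f)"
  unfolding multiplier_translation_def
  by (intro L2_tendsto_reflect weinstein_tendsto kernel_mult_tendsto)

lemma multiplier_translation_L2: "f \<in> L2 \<alpha> \<Longrightarrow> multiplier_translation x f \<in> L2 \<alpha>"
  unfolding multiplier_translation_def
  by (intro L2_reflect weinstein_in_L2 kernel_mult_L2)

text \<open>The transform of the average is known from \<open>shift_average_L12\<close>; the
  inversion formula recovers the average itself, at the price of an exceptional null set.\<close>

lemma shift_average_bounded:
  fixes f :: "(real ^ 'd::finite) \<times> real \<Rightarrow> complex"
  assumes f: "f \<in> borel_measurable borel" "f \<in> L12" "\<And>x. cmod (f x) \<le> B" and x: "x \<in> half_space"
  shows "AE y in \<mu>. shift_average x f y = multiplier_translation x f y"
proof -
  from f have f1: "integrable \<mu> f" and f2: "f \<in> L2 \<alpha>" by auto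
  note av = shift_average_L12[OF f(1) f1 f(3) x]
  from av(1) have av2: "shift_average x f \<in> L2 \<alpha>" by auto
  let ?k = "\<lambda>\<xi>. kernel \<xi> (reflect x) * wtransform f \<xi>"
  have k2: "?k \<in> L2 \<alpha>" by (intro kernel_mult_L2 weinstein_in_L2 f2)
  have "AE \<xi> in \<mu>. wtransform (shift_average x f) \<xi> = ?k \<xi>"
    using weinstein_eq_transform[OF av(1)] weinstein_eq_transform[OF f(2)]
        by eventually_elim (simp add: av(2))
  from weinstein_cong_AE[OF k2 L2_measurable[OF weinstein_in_L2[OF av2]] this]
  have "AE y in \<mu>. wtransform (wtransform (shift_average x f)) y = wtransform ?k y" .
  with weinstein_inversion[OF av2] have "AE y in \<mu>. shift_average x f (reflect y) = wtransform ?k y"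
    by eventually_elim simp
  from AE_weinstein_reflect[OF this] show ?thesis
    by (simp add: multiplier_translation_def)
qed

text \<open>For fixed \<open>x\<close> and \<open>y\<close> all shift points lie in one ball, so
  truncating a function to a large ball leaves its average at \<open>y\<close> unchanged.\<close>

lemma norm_shift_point_le: "norm (shift_point x y \<theta>)
    \<le> norm (fst x) + norm (fst y) + (\<bar>snd x\<bar> + \<bar>snd y\<bar>)"
proof -
  have "2 * snd x * snd y * cos \<theta> \<le> \<bar>2 * snd x * snd y\<bar> * 1"
    by (rule order_trans[OF abs_ge_self]) (simp add: abs_mult mult_left_le)
  then have "(snd x)\<^sup>2 + (snd y)\<^sup>2 + 2 * snd x * snd y * cos \<theta> \<le> (\<bar>snd x\<bar> + \<bar>snd y\<bar>)\<^sup>2"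
    by (simp add: power2_sum abs_mult)
  then have *: "sqrt ((snd x)\<^sup>2 + (snd y)\<^sup>2 + 2 * snd x * snd y * cos \<theta>) \<le> \<bar>snd x\<bar> + \<bar>snd y\<bar>"
    by (intro real_le_lsqrt) auto
  have nn: "0 \<le> (snd x)\<^sup>2 + (snd y)\<^sup>2 + 2 * snd x * snd y * cos \<theta>"
  proof -
    have "(snd x)\<^sup>2 + (snd y)\<^sup>2 + 2 * snd x * snd y * cos \<theta>
        = (snd x + snd y * cos \<theta>)\<^sup>2 + (snd y)\<^sup>2 * (1 - (cos \<theta>)\<^sup>2)"
      by (simp add: power2_eq_square algebra_simps)
    also have "1 - (cos \<theta>)\<^sup>2 = (sin \<theta>)\<^sup>2" by (simp add: sin_squared_eq)
    finally show ?thesis by simp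
  qed
  have "norm (shift_point x y \<theta>) \<le> norm (fst x + fst y) + \<bar>sqrt ((snd x)\<^sup>2 + (snd y)\<^sup>2 + 2 * snd x
      * snd y * cos \<theta>)\<bar>"
    unfolding shift_point_def by (rule order_trans[OF norm_Pair_le]) simp
  also have "\<dots> \<le> (norm (fst x) + norm (fst y)) + (\<bar>snd x\<bar> + \<bar>snd y\<bar>)"
    using * nn by (intro add_mono norm_triangle_ineq) simp
  finally show ?thesis by simp
qed

text \<open>A continuous square integrable function may be unbounded and not integrable, so it is
  truncated to balls; the truncations are merely Borel. Their averages are eventually constant at
  each point and converge in \<open>L2\<close> to the multiplier operator, and the two limits must
  agree.\<close>

lemma shift_average_continuous:
  fixes f :: "(real ^ 'd::finite) \<times> real \<Rightarrow> complex"
  assumes f: "continuous_on UNIV f" "f \<in> L2 \<alpha>" and x: "x \<in> half_space"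
  shows "AE y in \<mu>. shift_average x f y = multiplier_translation x f y"
proof -
  have fb [measurable]: "f \<in> borel_measurable borel"
      by (rule borel_measurable_continuous_onI[OF f(1)])
  let ?i = "\<lambda>n (x :: (real ^ 'd) \<times> real). indicator (cball 0 (real n)) x :: complex"
  let ?s = "\<lambda>n x. ?i n x * f x"
  have ib: "?i n \<in> borel_measurable borel" for n
      by (intro borel_measurable_indicator borel_closed closed_cball)
  have sb: "?s n \<in> borel_measurable borel" for n by (intro borel_measurable_times ib fb)
  have im: "?i n \<in> borel_measurable \<mu>" for n by (rule borel_measurable_weinsteinI[OF ib])
  have lim: "L2_tendsto \<alpha> ?s f"
  proof (rule L2_tendsto_dominated[OF f(2) im])
    show "cmod (?i n z) \<le> 1" for n z by (simp add: indicator_def)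
    fix z :: "(real ^ 'd) \<times> real"
    obtain N where N: "norm z \<le> real N" using real_arch_simple by blast
    have "?i n z = 1" if "N \<le> n" for n
      using N that by (simp add: indicator_def)
    then have "eventually (\<lambda>n. ?i n z = 1) sequentially" by (auto simp: eventually_sequentially)
    then show "(\<lambda>n. ?i n z) \<longlonglongrightarrow> 1" by (rule tendsto_eventually)
  qed
  \<comment> \<open>On the ball of radius n the function exp (n^2 / 2) times \<open>gauss 1\<close>
    is at least 1, so a multiple of the Gaussian dominates the indicator.\<close>
  have i2: "?i n \<in> L2 \<alpha>" for n
  proof (rule L2_bound[OF im, where h = "\<lambda>z. exp ((real n)\<^sup>2 / 2) * gauss 1 z"])
    show "integrable \<mu> (\<lambda>z :: (real ^ 'd) \<times> real. exp ((real n)\<^sup>2 / 2) * gauss 1 z)"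
      using gauss_transform(1)[of 1, where 'd = 'd] by simp
    show "AE z in \<mu>. (cmod (?i n z))\<^sup>2 \<le> exp ((real n)\<^sup>2 / 2) * gauss 1 z"
    proof (rule AE_I2)
      fix z :: "(real ^ 'd) \<times> real"
      show "(cmod (?i n z))\<^sup>2 \<le> exp ((real n)\<^sup>2 / 2) * gauss 1 z"
      proof (cases "norm z \<le> real n")
        case True
        then have "(norm z)\<^sup>2 \<le> (real n)\<^sup>2" by (intro power_mono) auto
        then show ?thesis using True by (simp add: gauss_def indicator_def exp_add[symmetric])
      qed (simp add: indicator_def)
    qed
  qed
  have s12: "?s n \<in> L12" for n
    using L2_mult_integrable[OF i2 f(2)] L2_tendsto_L2(2)[OF lim] by simp
  have bounded: "\<exists>B. \<forall>z. cmod (?s n z) \<le> B" for n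
  proof -
    have "compact (f ` cball 0 (real n))"
      by (intro compact_continuous_image continuous_on_subset[OF f(1)]) auto
    then obtain B where B: "\<And>z. z \<in> cball 0 (real n) \<Longrightarrow> cmod (f z) \<le> B"
      using compact_imp_bounded bounded_iff by (metis imageI)
    have "cmod (?s n z) \<le> max B 0" for z
      using B[of z] by (auto simp: indicator_def)
    then show ?thesis by blast
  qed
  have eq: "AE y in \<mu>. shift_average x (?s n) y = multiplier_translation x (?s n) y" for n
    using bounded[of n] shift_average_bounded[OF sb s12 _ x, of n] by blast
  have conv: "L2_tendsto \<alpha> (\<lambda>n. shift_average x (?s n)) (multiplier_translation x f)"
    by (rule L2_tendsto_cong_AE[OF multiplier_translation_tendsto[OF lim]])
       (use eq in \<open>auto intro!: borel_measurable_weinsteinI[OF shift_average_borel]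
           L2_measurable[OF multiplier_translation_L2] f sb\<close>)
  have "AE y in \<mu>. multiplier_translation x f y = shift_average x f y"
  proof (rule L2_tendsto_AE_unique[OF conv])
    show "shift_average x f \<in> borel_measurable \<mu>"
        by (intro borel_measurable_weinsteinI shift_average_borel fb)
    show "AE y in \<mu>. (\<lambda>n. shift_average x (?s n) y) \<longlonglongrightarrow> shift_average x f y"
    proof (rule AE_I2)
      fix y :: "(real ^ 'd) \<times> real"
      obtain N where N: "norm (fst x) + norm (fst y) + (\<bar>snd x\<bar> + \<bar>snd y\<bar>)
          \<le> real N" using real_arch_simple by blast
      have "shift_average x (?s n) y = shift_average x f y" if "N \<le> n" for n
        unfolding shift_average_def
      proof (intro Bochner_Integration.integral_cong refl)
        fix \<theta>
        have "norm (shift_point x y \<theta>) \<le> real N" by (rule order_trans[OF norm_shift_point_le N])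
        also have "\<dots> \<le> real n" using that by simp
        finally show "?s n (shift_point x y \<theta>) = f (shift_point x y \<theta>)" by (simp add: indicator_def)
      qed
      then have "eventually (\<lambda>n. shift_average x (?s n) y = shift_average x f y) sequentially"
        by (auto simp: eventually_sequentially)
      then show "(\<lambda>n. shift_average x (?s n) y) \<longlonglongrightarrow> shift_average x f y" by (rule tendsto_eventually)
    qed
  qed
  then show ?thesis by eventually_elim simp
qed

section \<open>Extension of translations and convolution of inverse transforms\<close>

lemma continuous_dense:
  fixes f :: "(real ^ 'd::finite) \<times> real \<Rightarrow> complex"
  assumes f: "f \<in> L2 \<alpha>"
  shows "\<exists>s. (\<forall>n. s n \<in> {f \<in> L2 \<alpha>. continuous_on UNIV f \<and> (\<forall>y t. f (y, - t)
      = f (y, t))}) \<and> L2_tendsto \<alpha> s f"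
proof -
  \<comment> \<open>The cutoff is applied on the transform side: the inverse transform of an
    integrable function is continuous, and evenness in the last variable is inherited from the
    kernel.\<close>
  let ?g = "\<lambda>n \<xi>. complex_of_real (gauss (1 / real (Suc n)) \<xi>) * wtransform f \<xi>"
  let ?s = "\<lambda>n x. transform (?g n) (reflect x)"
  have W: "wtransform f \<in> L2 \<alpha>" by (rule weinstein_in_L2[OF f])
  have g: "?g n \<in> L12" for n by (rule gauss_mult_L12[OF _ W]) simp
  then have g1: "integrable \<mu> (?g n)" and g2: "?g n \<in> L2 \<alpha>" for n by auto
  have s2: "?s n \<in> L2 \<alpha>" for n by (intro L2_reflect transform_L2 g1 g2)
  have "L2_tendsto \<alpha> ?s f"
  proof (rule L2_tendsto_cong_AE[OF L2_tendsto_reflect[OF weinstein_tendsto[OF gauss_approx[OF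
      W]]]])
    show "AE x in \<mu>. ?s n x = wtransform (?g n) (reflect x)" for n
      using AE_weinstein_reflect[OF weinstein_eq_transform[OF g[of n]]] by eventually_elim simp
    show "AE x in \<mu>. f x = wtransform (wtransform f) (reflect x)"
      using AE_weinstein_reflect[OF weinstein_inversion[OF f]] by eventually_elim simp
  qed (intro L2_measurable s2 f)+
  moreover have "continuous_on UNIV (?s n)" for n
    by (rule continuous_on_compose2[OF continuous_on_transform[OF g1[of n], of UNIV]])
        (auto intro!: continuous_intros)
  moreover have "?s n (y, - t) = ?s n (y, t)" for n y t
    by (simp add: reflect_def transform_snd_minus)
  ultimately show ?thesis using s2 by (intro exI[of _ ?s]) blast
qed

text \<open>Every admissible approximating sequence leads to
  \<open>multiplier_translation x f\<close>, so the choice has a witness and whatever it picks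
  agrees with that function up to a null set.\<close>

theorem translation_eq:
  fixes f :: "(real ^ 'd::finite) \<times> real \<Rightarrow> complex"
  assumes f: "f \<in> L2 \<alpha>" and x: "x \<in> half_space"
  shows "translation \<alpha> x f \<in> L2 \<alpha>" and "AE y in \<mu>. translation \<alpha> x f y
      = multiplier_translation x f y"
proof -
  let ?D = "{f \<in> L2 \<alpha>. continuous_on UNIV f \<and> (\<forall>y t. f (y, - t)
      = f (y, t))} :: ((real ^ 'd) \<times> real \<Rightarrow> complex) set"
  have lim: "L2_tendsto \<alpha> (\<lambda>n. translation_cont \<alpha> x (s n)) (multiplier_translation x f)"
    if s: "\<And>n. s n \<in> ?D" and sf: "L2_tendsto \<alpha> s f" for s
  proof (rule L2_tendsto_cong_AE[OF multiplier_translation_tendsto[OF sf]])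
    have sb: "s n \<in> borel_measurable borel" for n using s[of n]
        by (intro borel_measurable_continuous_onI) auto
    have eq: "translation_cont \<alpha> x (s n) = shift_average x (s n)" for n
      by (rule ext) (rule translation_cont_eq[OF sb])
    show "translation_cont \<alpha> x (s n) \<in> borel_measurable \<mu>" for n
      unfolding eq by (intro borel_measurable_weinsteinI shift_average_borel sb)
    show "AE y in \<mu>. translation_cont \<alpha> x (s n) y = multiplier_translation x (s n) y" for n
      unfolding eq using s[of n] by (intro shift_average_continuous x) auto
  qed (auto intro: L2_measurable multiplier_translation_L2 f)
  obtain s0 where "\<And>n. s0 n \<in> ?D" "L2_tendsto \<alpha> s0 f" using continuous_dense[OF f] by blast
  then have "\<exists>g s. (\<forall>n. s n \<in> ?D) \<and> L2_tendsto \<alpha> s f \<and> L2_tendsto \<alpha> (\<lambda>n. translation_cont \<alpha> x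
      (s n)) g"
    using lim by blast
  from someI_ex[OF this]
  have "\<exists>s. (\<forall>n. s n \<in> ?D) \<and> L2_tendsto \<alpha> s f \<and> L2_tendsto \<alpha> (\<lambda>n. translation_cont \<alpha> x (s n))
      (translation \<alpha> x f)"
    unfolding translation_def L2_extension_def .
  then obtain s where s: "\<And>n. s n \<in> ?D" "L2_tendsto \<alpha> s f"
    "L2_tendsto \<alpha> (\<lambda>n. translation_cont \<alpha> x (s n)) (translation \<alpha> x f)" by blast
  show "translation \<alpha> x f \<in> L2 \<alpha>" by (rule L2_tendsto_L2(1)[OF s(3)])
  show "AE y in \<mu>. translation \<alpha> x f y = multiplier_translation x f y"
    by (rule L2_tendsto_unique[OF s(3) lim[OF s(1,2)]])
qed

text \<open>The reflection inside the convolution cancels the one in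
  \<open>multiplier_translation\<close>, so the integrand is a product of two transforms. The
  multiplication formula transfers one of them, inversion removes the double transform, and the
  character of the translation becomes the kernel at \<open>reflect x\<close>.\<close>

theorem weinstein_conv_eq:
  fixes p q :: "(real ^ 'd::finite) \<times> real \<Rightarrow> complex"
  assumes p: "p \<in> L2 \<alpha>" and q: "q \<in> L2 \<alpha>" and x: "x \<in> half_space"
  shows "weinstein_conv \<alpha> (weinstein_inv \<alpha> q) (weinstein_inv \<alpha> p) x
      = transform (\<lambda>\<xi>. p \<xi> * q \<xi>) (reflect x)"
proof -
  have inv: "weinstein_inv \<alpha> g = (\<lambda>\<xi>. wtransform g (reflect \<xi>))"
      for g :: "(real ^ 'd) \<times> real \<Rightarrow> complex"
    by (rule ext) (simp add: weinstein_inv_def)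
  let ?f = "weinstein_inv \<alpha> q" and ?pR = "\<lambda>y. p (reflect y)"
  have f: "?f \<in> L2 \<alpha>" unfolding inv by (intro L2_reflect weinstein_in_L2 q)
  have pR: "?pR \<in> L2 \<alpha>" by (rule L2_reflect(1)[OF p])
  have WW: "AE \<xi> in \<mu>. wtransform (wtransform g) (reflect \<xi>) = g \<xi>" if "g \<in> L2 \<alpha>"
      for g :: "(real ^ 'd) \<times> real \<Rightarrow> complex"
    using AE_weinstein_reflect[OF weinstein_inversion[OF that]] by eventually_elim simp
  have Wf: "AE \<xi> in \<mu>. wtransform ?f \<xi> = q \<xi>"
    unfolding inv using weinstein_reflect[OF weinstein_in_L2[OF q]] WW[OF q] by eventually_elim simp
  have WWp: "AE \<xi> in \<mu>. wtransform (wtransform ?pR) \<xi> = p \<xi>"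
    using weinstein_inversion[OF pR] by eventually_elim simp
  let ?k = "\<lambda>\<xi>. kernel \<xi> (reflect x) * wtransform ?f \<xi>"
  have k: "?k \<in> L2 \<alpha>" by (intro kernel_mult_L2 weinstein_in_L2 f)
  note tr = translation_eq[OF f x]
  note m = L2_measurable[OF weinstein_in_L2[OF k]] L2_measurable[OF weinstein_in_L2[OF pR]]
    L2_measurable[OF L2_reflect(1)[OF tr(1)]] L2_measurable[OF L2_reflect(1)[OF weinstein_in_L2[OF
        p]]]
    L2_measurable[OF k] L2_measurable[OF weinstein_in_L2[OF weinstein_in_L2[OF pR]]]
        L2_measurable[OF p] L2_measurable[OF q]
  note [measurable] = m
  have "weinstein_conv \<alpha> ?f (weinstein_inv \<alpha> p) x
      = (LINT y|\<mu>. translation \<alpha> x ?f (reflect y) * wtransform p (reflect y))"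
    by (simp add: weinstein_conv_def inv)
  also have "\<dots> = (LINT y|\<mu>. wtransform ?k y * wtransform ?pR y)"
  proof (rule integral_cong_AE)
    show "AE y in \<mu>. translation \<alpha> x ?f (reflect y) * wtransform p (reflect y)
        = wtransform ?k y * wtransform ?pR y"
      using AE_weinstein_reflect[OF tr(2)] weinstein_reflect[OF p]
      by eventually_elim (simp add: multiplier_translation_def)
  qed (intro borel_measurable_times m)+
  also have "\<dots> = (LINT \<xi>|\<mu>. ?k \<xi> * wtransform (wtransform ?pR) \<xi>)"
    by (rule multiplication_formula[OF k weinstein_in_L2[OF pR]])
  also have "\<dots> = (LINT \<xi>|\<mu>. (p \<xi> * q \<xi>) * kernel (reflect x) \<xi>)"
  proof (rule integral_cong_AE)
    show "AE \<xi> in \<mu>. ?k \<xi> * wtransform (wtransform ?pR) \<xi> = (p \<xi> * q \<xi>) * kernel (reflect x) \<xi>"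
      using Wf WWp by eventually_elim (simp add: kernel_commute[of "reflect x"])
  qed measurable
  finally show ?thesis by (simp add: weinstein_L1_def)
qed

subsection \<open>Calderon cutoffs\<close>

lemma dilate_L2:
  fixes m :: "(real ^ 'd::finite) \<times> real \<Rightarrow> complex"
  assumes m: "m \<in> L2 \<alpha>" and \<sigma>: "0 < \<sigma>"
  shows "dilate m \<sigma> \<in> L2 \<alpha>" and "sqnorm (dilate m \<sigma>) = \<sigma> powr (- hom_dim TYPE('d)) * sqnorm m"
proof -
  note [measurable] = L2_measurable[OF m] measurable_scale_weinstein[OF \<sigma>]
  have dm: "dilate m \<sigma> \<in> borel_measurable \<mu>" unfolding dilate_def[abs_def] by measurable
  have "(\<integral>\<^sup>+x. ennreal ((cmod (dilate m \<sigma> x))\<^sup>2) \<partial>\<mu>)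
      = (\<integral>\<^sup>+x. ennreal ((cmod (m x))\<^sup>2) \<partial>distr \<mu> \<mu> (\<lambda>x. \<sigma> *\<^sub>R x))"
    unfolding dilate_def by (rule nn_integral_distr[symmetric]) measurable
  also have "\<dots> = (\<integral>\<^sup>+x. ennreal (\<sigma> powr (- hom_dim TYPE('d))) * ennreal ((cmod (m x))\<^sup>2) \<partial>\<mu>)"
    unfolding distr_weinstein_scale[OF \<sigma>] by (rule nn_integral_density) measurable
  also have "\<dots> = ennreal (\<sigma> powr (- hom_dim TYPE('d)) * sqnorm m)"
    by (subst nn_integral_cmult) (auto simp: nn_integral_sqnorm[OF m] ennreal_mult)
  finally have eq: "(\<integral>\<^sup>+x. ennreal ((cmod (dilate m \<sigma> x))\<^sup>2) \<partial>\<mu>)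
      = ennreal (\<sigma> powr (- hom_dim TYPE('d)) * sqnorm m)" .
  show d: "dilate m \<sigma> \<in> L2 \<alpha>" by (rule L2I_nn_integral(1)[OF dm eq_refl[OF eq]]) simp
  show "sqnorm (dilate m \<sigma>) = \<sigma> powr (- hom_dim TYPE('d)) * sqnorm m"
    using nn_integral_sqnorm[OF d] eq by simp
qed

text \<open>The image of the measure under a dilation is a constant multiple of it, so null sets are
  preserved and the essential bound is the same at each scale.\<close>

lemma dilate_AE_bounded:
  fixes m :: "(real ^ 'd::finite) \<times> real \<Rightarrow> complex"
  assumes m: "m \<in> borel_measurable \<mu>" and C: "AE x in \<mu>. cmod (m x) \<le> C" and \<sigma>: "0 < \<sigma>"
  shows "AE x in \<mu>. cmod (dilate m \<sigma> x) \<le> C"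
proof -
  note [measurable] = m
  have "AE x in distr \<mu> \<mu> (\<lambda>x. \<sigma> *\<^sub>R x). cmod (m x) \<le> C"
    unfolding distr_weinstein_scale[OF \<sigma>] using C by (subst AE_density) (auto elim: eventually_mono)
  then have "AE x in \<mu>. cmod (m (\<sigma> *\<^sub>R x)) \<le> C"
    by (rule AE_distrD[OF measurable_scale_weinstein[OF \<sigma>]])
  then show ?thesis by (simp add: dilate_def)
qed

end

section \<open>Cutoffs under the admissibility condition\<close>

locale calderon_setup = weinstein_order \<alpha> for \<alpha> +
  fixes \<phi> m :: "(real ^ 'd::finite) \<times> real \<Rightarrow> complex" and C :: real
  assumes \<phi>: "\<phi> \<in> L2 \<alpha>" and m: "m \<in> L2 \<alpha>"
    and C: "0 \<le> C" "AE x in \<mu>. cmod (m x) \<le> C"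
    and admissible: "\<And>x. x \<in> half_space \<Longrightarrow> (LINT \<sigma>:{0<..}|lborel. (cmod (m (\<sigma> *\<^sub>R x)))\<^sup>2 / \<sigma>) = 1"
begin

text \<open>Values of \<open>m\<close> outside the half space are arbitrary and need not be measurable.\<close>

definition m0 :: "(real ^ 'd) \<times> real \<Rightarrow> complex" where
  "m0 x = (if x \<in> half_space then m x else 0)"

lemma m0_borel [measurable]: "m0 \<in> borel_measurable borel"
proof -
  have "m \<in> borel_measurable (restrict_space borel half_space)"
    using L2_measurable[OF m] measurable_cong_sets[OF sets_weinstein refl] by blast
  then have "(\<lambda>x. indicator half_space x *\<^sub>R m x) \<in> borel_measurable borel"
    by (subst (asm) borel_measurable_restrict_space_iff) auto
  moreover have "m0 = (\<lambda>x. indicator half_space x *\<^sub>R m x)"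
    by (rule ext) (simp add: m0_def)
  ultimately show ?thesis by simp
qed

lemma m0_scale: "x \<in> half_space \<Longrightarrow> 0 < \<sigma> \<Longrightarrow> m0 (\<sigma> *\<^sub>R x) = m (\<sigma> *\<^sub>R x)"
  by (simp add: m0_def half_space_def)

definition scale_density :: "real \<Rightarrow> (real ^ 'd) \<times> real \<Rightarrow> real" where
  "scale_density \<sigma> \<xi> = (cmod (m0 (\<sigma> *\<^sub>R \<xi>)))\<^sup>2 / \<sigma>"

text \<open>The part of the admissibility integral over the scales from \<gamma> to \<delta>. It
  will be the multiplier that takes \<phi> to its Calderon approximation.\<close>

definition cutoff :: "real \<Rightarrow> real \<Rightarrow> (real ^ 'd) \<times> real \<Rightarrow> real" where
  "cutoff \<gamma> \<delta> \<xi> = (LINT \<sigma>|lborel. indicator {\<gamma>..\<delta>} \<sigma> * scale_density \<sigma> \<xi>)"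

lemma scale_density_measurable [measurable]:
  assumes [measurable]: "f \<in> borel_measurable N" "g \<in> borel_measurable N"
  shows "(\<lambda>x. scale_density (f x) (g x)) \<in> borel_measurable N"
  unfolding scale_density_def by measurable

lemma scale_density_nonneg: "0 \<le> \<sigma> \<Longrightarrow> 0 \<le> scale_density \<sigma> \<xi>"
  by (simp add: scale_density_def)

lemma admissible_has_integral:
  assumes "\<xi> \<in> half_space"
  shows "integrable lborel (\<lambda>\<sigma>. indicator {0<..} \<sigma> * scale_density \<sigma> \<xi>)"
    and "(LINT \<sigma>|lborel. indicator {0<..} \<sigma> * scale_density \<sigma> \<xi>) = 1"
proof -
  have eq: "indicator {0<..} \<sigma> * scale_density \<sigma> \<xi>
      = indicator {0<..} \<sigma> *\<^sub>R ((cmod (m (\<sigma> *\<^sub>R \<xi>)))\<^sup>2 / \<sigma>)" for \<sigma>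
    using assms by (cases "0 < \<sigma>") (simp_all add: scale_density_def m0_scale)
  show 1: "(LINT \<sigma>|lborel. indicator {0<..} \<sigma> * scale_density \<sigma> \<xi>) = 1"
    unfolding eq using admissible[OF assms] by (simp add: set_lebesgue_integral_def)
  \<comment> \<open>The integral being 1 and not the default value 0, the integrand must be
    integrable.\<close>
  show "integrable lborel (\<lambda>\<sigma>. indicator {0<..} \<sigma> * scale_density \<sigma> \<xi>)"
    using 1 not_integrable_integral_eq by fastforce
qed

lemma cutoff_integrable:
  assumes "\<xi> \<in> half_space" "0 < \<gamma>"
  shows "integrable lborel (\<lambda>\<sigma>. indicator {\<gamma>..\<delta>} \<sigma> * scale_density \<sigma> \<xi>)"
proof (rule Bochner_Integration.integrable_bound[OF admissible_has_integral(1)[OF assms(1)]])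
  show "AE \<sigma> in lborel. norm (indicator {\<gamma>..\<delta>} \<sigma> * scale_density \<sigma> \<xi>)
      \<le> norm (indicator {0<..} \<sigma> * scale_density \<sigma> \<xi>)"
    using assms(2) by (intro AE_I2) (auto simp: indicator_def)
qed measurable

lemma cutoff_mono:
  assumes "\<xi> \<in> half_space" "0 < \<gamma>" "\<gamma> \<le> \<gamma>'" "\<delta>' \<le> \<delta>"
  shows "cutoff \<gamma>' \<delta>' \<xi> \<le> cutoff \<gamma> \<delta> \<xi>"
  unfolding cutoff_def
proof (rule integral_mono)
  show "indicator {\<gamma>'..\<delta>'} \<sigma> * scale_density \<sigma> \<xi> \<le> indicator {\<gamma>..\<delta>} \<sigma> * scale_density \<sigma> \<xi>" for \<sigma>
    using assms scale_density_nonneg[of \<sigma> \<xi>] by (auto simp: indicator_def)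
qed (use assms in \<open>auto intro!: cutoff_integrable\<close>)

lemma cutoff_bounds:
  assumes "\<xi> \<in> half_space" "0 < \<gamma>"
  shows "0 \<le> cutoff \<gamma> \<delta> \<xi>" "cutoff \<gamma> \<delta> \<xi> \<le> 1"
proof -
  show "0 \<le> cutoff \<gamma> \<delta> \<xi>"
    unfolding cutoff_def using assms scale_density_nonneg[of _ \<xi>]
    by (intro integral_nonneg_AE AE_I2) (auto simp: indicator_def)
  have "cutoff \<gamma> \<delta> \<xi> \<le> (LINT \<sigma>|lborel. indicator {0<..} \<sigma> * scale_density \<sigma> \<xi>)"
    unfolding cutoff_def
  proof (rule integral_mono)
    show "indicator {\<gamma>..\<delta>} \<sigma> * scale_density \<sigma> \<xi> \<le> indicator {0<..} \<sigma> * scale_density \<sigma> \<xi>" for \<sigma>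
      using assms scale_density_nonneg[of \<sigma> \<xi>] by (auto simp: indicator_def)
  qed (use assms in \<open>auto intro!: cutoff_integrable admissible_has_integral\<close>)
  then show "cutoff \<gamma> \<delta> \<xi> \<le> 1" using admissible_has_integral(2)[OF assms(1)] by simp
qed

lemma cutoff_measurable [measurable]: "cutoff \<gamma> \<delta> \<in> borel_measurable \<mu>"
  unfolding cutoff_def[abs_def] by (rule borel_measurable_weinsteinI) measurable

text \<open>The admissibility integrand dominates all truncations. One sequence of scales is enough
  because the cutoff is monotone in both limits of integration.\<close>

lemma cutoff_tendsto:
  assumes "\<xi> \<in> half_space"
  shows "(\<lambda>n. cutoff (1 / real (n + 2)) (real (n + 2)) \<xi>) \<longlonglongrightarrow> 1"
proof -
  let ?I = "\<lambda>n. {1 / real (n + 2)..real (n + 2)}"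
  have "(\<lambda>n. LINT \<sigma>|lborel. indicator (?I n) \<sigma> * scale_density \<sigma> \<xi>)
      \<longlonglongrightarrow> (LINT \<sigma>|lborel. indicator {0<..} \<sigma> * scale_density \<sigma> \<xi>)"
  proof (rule integral_dominated_convergence[where w
      = "\<lambda>\<sigma>. indicator {0<..} \<sigma> * scale_density \<sigma> \<xi>"])
    show "integrable lborel (\<lambda>\<sigma>. indicator {0<..} \<sigma> * scale_density \<sigma> \<xi>)"
      by (rule admissible_has_integral(1)[OF assms])
    show "AE \<sigma> in lborel. (\<lambda>n. indicator (?I n) \<sigma> * scale_density \<sigma> \<xi>)
        \<longlonglongrightarrow> indicator {0<..} \<sigma> * scale_density \<sigma> \<xi>"
    proof (rule AE_I2, rule tendsto_mult[OF _ tendsto_const])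
      fix \<sigma> :: real
      show "(\<lambda>n. indicator (?I n) \<sigma> :: real) \<longlonglongrightarrow> indicator {0<..} \<sigma>"
      proof (cases "0 < \<sigma>")
        case True
        obtain N where N: "max \<sigma> (1 / \<sigma>) \<le> real N" using real_arch_simple by blast
        have "(indicator (?I n) \<sigma> :: real) = indicator {0<..} \<sigma>" if "N \<le> n" for n
        proof -
          have "\<sigma> \<le> real (n + 2)" "1 / \<sigma> \<le> real (n + 2)" using N that by auto
          then show ?thesis using True by (simp add: field_simps)
        qed
        then have "eventually (\<lambda>n. (indicator (?I n) \<sigma> :: real) = indicator {0<..} \<sigma>) sequentially"
          by (auto simp: eventually_sequentially)
        then show ?thesis by (rule tendsto_eventually)
      next
        case False
        have "\<not> 1 / real (n + 2) \<le> \<sigma>" for n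
        proof -
          have "0 < 1 / real (n + 2)" by simp
          then show ?thesis using False by linarith
        qed
        then have "(indicator (?I n) \<sigma> :: real) = indicator {0<..} \<sigma>" for n using False
            by (simp add: indicator_def)
        then show ?thesis by simp
      qed
    qed
    show "AE \<sigma> in lborel. norm (indicator (?I n) \<sigma> * scale_density \<sigma> \<xi>)
        \<le> indicator {0<..} \<sigma> * scale_density \<sigma> \<xi>" for n
    proof (rule AE_I2)
      fix \<sigma> :: real
      have "0 < 1 / real (n + 2)" by simp
      then have "0 < \<sigma>" if "1 / real (n + 2) \<le> \<sigma>" using that by (rule less_le_trans)
      then show "norm (indicator (?I n) \<sigma> * scale_density \<sigma> \<xi>)
          \<le> indicator {0<..} \<sigma> * scale_density \<sigma> \<xi>"
        using scale_density_nonneg[of \<sigma> \<xi>] by (cases "\<sigma> \<in> ?I n") (auto simp: indicator_def)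
    qed
  qed measurable
  then show ?thesis unfolding cutoff_def admissible_has_integral(2)[OF assms] .
qed

lemma cutoff_L2:
  assumes "0 < \<gamma>" "f \<in> L2 \<alpha>"
  shows "(\<lambda>\<xi>. complex_of_real (cutoff \<gamma> \<delta> \<xi>) * f \<xi>) \<in> L2 \<alpha>"
  by (rule L2_mult_bounded(1)[OF assms(2), where C = 1])
     (use cutoff_bounds[OF _ assms(1)] in \<open>auto intro!: AE_I2\<close>)

text \<open>With \<open>cnj (dilate m \<sigma>)\<close> and \<open>dilate m \<sigma>\<close> times
  the transform of \<phi> as the two factors of \<open>weinstein_conv_eq\<close>, the product
  carries the squared modulus of the dilated multiplier.\<close>

lemma calderon_integrand_eq:
  assumes x: "x \<in> half_space" and \<sigma>: "0 < \<sigma>"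
  shows "calderon_integrand \<alpha> m \<phi> x \<sigma> =
    (LINT \<xi>|\<mu>. complex_of_real (scale_density \<sigma> \<xi>) * wtransform \<phi> \<xi> * kernel (reflect x) \<xi>)"
proof -
  have d: "dilate m \<sigma> \<in> L2 \<alpha>" by (rule dilate_L2(1)[OF m \<sigma>])
  \<comment> \<open>The two hypotheses on \<open>m\<close> act separately: square integrability
    admits the dilate itself, the essential bound admits its product with the transform of
    \<phi>.\<close>
  have q: "(\<lambda>\<xi>. dilate m \<sigma> \<xi> * wtransform \<phi> \<xi>) \<in> L2 \<alpha>"
    by (rule L2_mult_bounded(1)[OF weinstein_in_L2[OF \<phi>] L2_measurable[OF d] dilate_AE_bounded[OF
        L2_measurable[OF m] C(2) \<sigma>] C(1)])
  have "calderon_integrand \<alpha> m \<phi> x \<sigma> =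
     transform (\<lambda>\<xi>. cnj (dilate m \<sigma> \<xi>) * (dilate m \<sigma> \<xi> * wtransform \<phi> \<xi>))
         (reflect x) / complex_of_real \<sigma>"
    unfolding calderon_integrand_def weinstein_multiplier_def
    by (simp only: weinstein_conv_eq[OF L2_cnj[OF d] q x])
  also have "\<dots> = (LINT \<xi>|\<mu>. (cnj (dilate m \<sigma> \<xi>) * (dilate m \<sigma> \<xi> * wtransform \<phi> \<xi>)) * kernel
      (reflect x) \<xi> / complex_of_real \<sigma>)"
    unfolding weinstein_L1_def by (rule integral_divide_zero[symmetric])
  also have "\<dots> = (LINT \<xi>|\<mu>. complex_of_real (scale_density \<sigma> \<xi>) * wtransform \<phi> \<xi> * kernel
      (reflect x) \<xi>)"
  proof (intro Bochner_Integration.integral_cong refl)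
    fix \<xi> assume "\<xi> \<in> space (\<mu> :: ((real ^ 'd) \<times> real) measure)"
    then have "m0 (\<sigma> *\<^sub>R \<xi>) = m (\<sigma> *\<^sub>R \<xi>)" using \<sigma> by (simp add: m0_scale)
    then have "complex_of_real (scale_density \<sigma> \<xi>)
        = dilate m \<sigma> \<xi> * cnj (dilate m \<sigma> \<xi>) / complex_of_real \<sigma>"
      by (simp only: scale_density_def dilate_def of_real_divide complex_norm_square)
    then show "(cnj (dilate m \<sigma> \<xi>) * (dilate m \<sigma> \<xi> * wtransform \<phi> \<xi>)) * kernel
        (reflect x) \<xi> / complex_of_real \<sigma>
      = complex_of_real (scale_density \<sigma> \<xi>) * wtransform \<phi> \<xi> * kernel (reflect x) \<xi>"
      by simp
  qed
  finally show ?thesis .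
qed

text \<open>Exchanging the integrals over scale and frequency needs joint integrability. The
  interval is bounded, and for \<sigma> \<ge> \<gamma> the factor 1 / \<sigma> and the squared norm
  of the dilate, which scales by \<open>\<sigma> powr (- hom_dim TYPE('d))\<close>, are largest
  possible at \<gamma>.\<close>

lemma pair_integrable:
  assumes \<gamma>: "0 < \<gamma>"
  shows "integrable (lborel \<Otimes>\<^sub>M \<mu>) (\<lambda>(\<sigma>, \<xi>). complex_of_real (indicator {\<gamma>..\<delta>} \<sigma>
      * scale_density \<sigma> \<xi>) * wtransform \<phi> \<xi>)"
    (is "integrable _ ?E")
proof -
  let ?\<Phi> = "wtransform \<phi>" and ?Q = "hom_dim TYPE('d)"
  have \<Phi>: "?\<Phi> \<in> L2 \<alpha>" by (rule weinstein_in_L2[OF \<phi>])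
  note [measurable] = L2_measurable[OF \<Phi>]
  have "(\<lambda>p. (fst p, snd p)) \<in> measurable (lborel \<Otimes>\<^sub>M \<mu>) (borel \<Otimes>\<^sub>M (borel :: ((real ^ 'd) \<times> real)
      measure))"
    by (intro measurable_Pair measurable_compose[OF measurable_snd measurable_id_weinstein])
        measurable
  from measurable_compose[OF this, of "\<lambda>(\<sigma>, \<xi>). indicator {\<gamma>..\<delta>} \<sigma> * scale_density \<sigma> \<xi>" borel]
  have sd [measurable]: "(\<lambda>p. indicator {\<gamma>..\<delta>} (fst p) * scale_density (fst p)
      (snd p)) \<in> borel_measurable (lborel \<Otimes>\<^sub>M (\<mu> :: ((real ^ 'd) \<times> real) measure))"
    by (simp add: case_prod_beta')
  have meas: "?E \<in> borel_measurable (lborel \<Otimes>\<^sub>M \<mu>)"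
    unfolding case_prod_beta' by measurable
  let ?B = "C / 2 * (\<gamma> powr (- ?Q) * sqnorm m + sqnorm ?\<Phi>) / \<gamma>"
  have B0: "0 \<le> ?B" using C(1) \<gamma> by simp
  have Q: "0 < ?Q" using order_gt by (simp add: hom_dim_def add_pos_nonneg)
  have inner: "(\<integral>\<^sup>+\<xi>. ennreal (cmod (?E (\<sigma>, \<xi>))) \<partial>\<mu>) \<le> ennreal ?B * indicator {\<gamma>..\<delta>} \<sigma>" for \<sigma>
  proof (cases "\<sigma> \<in> {\<gamma>..\<delta>}")
    case True
    then have \<sigma>: "0 < \<sigma>" "\<gamma> \<le> \<sigma>" using \<gamma> by auto
    have d: "dilate m \<sigma> \<in> L2 \<alpha>" by (rule dilate_L2(1)[OF m \<sigma>(1)])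
    let ?h = "\<lambda>\<xi>. C / 2 * ((cmod (dilate m \<sigma> \<xi>))\<^sup>2 + (cmod (?\<Phi> \<xi>))\<^sup>2) / \<gamma>"
    have hi: "integrable \<mu> ?h" using L2_integrable[OF d] L2_integrable[OF \<Phi>] by simp
    have "(\<integral>\<^sup>+\<xi>. ennreal (cmod (?E (\<sigma>, \<xi>))) \<partial>\<mu>) \<le> (\<integral>\<^sup>+\<xi>. ennreal (?h \<xi>) \<partial>\<mu>)"
    proof (rule nn_integral_mono_AE)
      have "AE \<xi> in \<mu>. \<xi> \<in> (half_space :: ((real ^ 'd) \<times> real) set)" by (intro AE_I2) simp
      with dilate_AE_bounded[OF L2_measurable[OF m] C(2) \<sigma>(1)]
      show "AE \<xi> in \<mu>. ennreal (cmod (?E (\<sigma>, \<xi>))) \<le> ennreal (?h \<xi>)"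
      proof eventually_elim
        fix \<xi> :: "(real ^ 'd) \<times> real" assume b: "cmod (dilate m \<sigma> \<xi>) \<le> C" and \<xi>: "\<xi> \<in> half_space"
        let ?a = "cmod (dilate m \<sigma> \<xi>)" and ?p = "cmod (?\<Phi> \<xi>)"
        have "cmod (?E (\<sigma>, \<xi>)) = ?a\<^sup>2 * ?p / \<sigma>"
          using True \<sigma> \<xi> by (simp add: norm_mult scale_density_def m0_scale dilate_def abs_mult
              norm_divide norm_power)
        also have "\<dots> \<le> ?a\<^sup>2 * ?p / \<gamma>" using \<sigma> \<gamma> by (intro divide_left_mono) auto
        \<comment> \<open>One factor of modulus \<open>?a\<close> is absorbed by the essential bound
          \<open>C\<close>; the other is paired with \<open>?p\<close> by the inequality of the
          means.\<close>
        also have "?a\<^sup>2 * ?p \<le> C / 2 * (?a\<^sup>2 + ?p\<^sup>2)"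
        proof -
          have "?a * ?p \<le> (?a\<^sup>2 + ?p\<^sup>2) / 2"
            using zero_le_power2[of "?a - ?p"] by (simp add: power2_eq_square algebra_simps)
          then have "?a * (?a * ?p) \<le> C * ((?a\<^sup>2 + ?p\<^sup>2) / 2)"
            using b C(1) by (intro mult_mono) auto
          then show ?thesis by (simp add: power2_eq_square mult.assoc)
        qed
        finally have "cmod (?E (\<sigma>, \<xi>)) \<le> ?h \<xi>" using \<gamma> by (simp add: divide_right_mono)
        then show "ennreal (cmod (?E (\<sigma>, \<xi>))) \<le> ennreal (?h \<xi>)" by (rule ennreal_leI)
      qed
    qed
    also have "\<dots> = ennreal (LINT \<xi>|\<mu>. ?h \<xi>)"
      using C(1) \<gamma> by (intro nn_integral_eq_integral hi) auto
    also have "(LINT \<xi>|\<mu>. ?h \<xi>) = C / 2 * (sqnorm (dilate m \<sigma>) + sqnorm ?\<Phi>) / \<gamma>"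
      unfolding sqnorm_def using L2_integrable[OF d] L2_integrable[OF \<Phi>] by simp
    also have "\<dots> \<le> ?B"
    proof -
      have "\<sigma> powr (- ?Q) \<le> \<gamma> powr (- ?Q)" using \<sigma> \<gamma> Q by (intro powr_mono2') auto
      then have "sqnorm (dilate m \<sigma>) \<le> \<gamma> powr (- ?Q) * sqnorm m"
        unfolding dilate_L2(2)[OF m \<sigma>(1)] by (intro mult_right_mono) auto
      then show ?thesis using C(1) \<gamma> by (intro divide_right_mono mult_left_mono add_right_mono) auto
    qed
    finally show ?thesis using True by (simp add: ennreal_leI)
  qed simp
  have "(\<integral>\<^sup>+p. ennreal (cmod (?E p)) \<partial>(lborel \<Otimes>\<^sub>M \<mu>))
      = (\<integral>\<^sup>+\<sigma>. \<integral>\<^sup>+\<xi>. ennreal (cmod (?E (\<sigma>, \<xi>))) \<partial>\<mu> \<partial>lborel)"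
    by (rule weinstein.nn_integral_fst[symmetric]) (rule measurable_compose[OF meas], measurable)
  also have "\<dots> \<le> (\<integral>\<^sup>+\<sigma>. ennreal ?B * indicator {\<gamma>..\<delta>} \<sigma> \<partial>lborel)"
    by (intro nn_integral_mono inner)
  also have "\<dots> = ennreal ?B * emeasure lborel {\<gamma>..\<delta>}"
    by (rule nn_integral_cmult_indicator) simp
  also have "\<dots> < \<infinity>"
    using emeasure_compact_finite[of "{\<gamma>..\<delta>}"] by (simp add: ennreal_mult_less_top)
  finally show ?thesis by (rule integrableI_bounded[OF meas])
qed

text \<open>Fubini's theorem performs the integration over the scales first. Neither the transform
  of \<phi> nor the kernel depends on the scale, so only the density is integrated and becomes the
  cutoff.\<close>

theorem calderon_eq:
  assumes x: "x \<in> half_space" and \<gamma>: "0 < \<gamma>"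
  shows "set_integrable lborel {\<gamma>..\<delta>} (calderon_integrand \<alpha> m \<phi> x)"
    and "calderon \<alpha> m \<phi> \<gamma> \<delta> x = transform (\<lambda>\<xi>. complex_of_real (cutoff \<gamma> \<delta> \<xi>) * wtransform \<phi> \<xi>)
        (reflect x)"
    and "(\<lambda>\<xi>. complex_of_real (cutoff \<gamma> \<delta> \<xi>) * wtransform \<phi> \<xi>) \<in> L12"
proof -
  interpret pair_sigma_finite lborel "\<mu> :: ((real ^ 'd) \<times> real) measure"
    by (intro pair_sigma_finite.intro sigma_finite_weinstein sigma_finite_lborel)
  let ?\<Phi> = "wtransform \<phi>"
  let ?e = "\<lambda>\<sigma> \<xi>. complex_of_real (indicator {\<gamma>..\<delta>} \<sigma> * scale_density \<sigma> \<xi>) * ?\<Phi> \<xi>"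
  let ?E = "\<lambda>\<sigma> \<xi>. ?e \<sigma> \<xi> * kernel (reflect x) \<xi>"
  have e: "integrable (lborel \<Otimes>\<^sub>M \<mu>) (case_prod ?e)" by (rule pair_integrable[OF \<gamma>])
  have E: "integrable (lborel \<Otimes>\<^sub>M \<mu>) (case_prod ?E)"
  proof (rule Bochner_Integration.integrable_bound[OF e])
    note [measurable] = borel_measurable_integrable[OF e]
    have "(\<lambda>p. case_prod ?e p * kernel (reflect x) (snd p)) \<in> borel_measurable (lborel \<Otimes>\<^sub>M \<mu>)"
        by measurable
    then show "case_prod ?E \<in> borel_measurable (lborel \<Otimes>\<^sub>M \<mu>)" by (simp add: case_prod_beta')
    show "AE p in lborel \<Otimes>\<^sub>M \<mu>. norm (case_prod ?E p) \<le> norm (case_prod ?e p)"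
      by (intro AE_I2) (auto simp: norm_mult[of _ "kernel _ _"] mult_left_le norm_kernel_le)
  qed
  have J: "indicator {\<gamma>..\<delta>} \<sigma> *\<^sub>R calderon_integrand \<alpha> m \<phi> x \<sigma> = (LINT \<xi>|\<mu>. ?E \<sigma> \<xi>)" for \<sigma>
    using \<gamma> by (cases "\<sigma> \<in> {\<gamma>..\<delta>}") (simp_all add: calderon_integrand_eq[OF x])
  show "set_integrable lborel {\<gamma>..\<delta>} (calderon_integrand \<alpha> m \<phi> x)"
    unfolding set_integrable_def J using integrable_fst'[OF E] by simp
  have N: "(LINT \<sigma>|lborel. ?e \<sigma> \<xi>) = complex_of_real (cutoff \<gamma> \<delta> \<xi>) * ?\<Phi> \<xi>" for \<xi>
    by (simp only: cutoff_def integral_mult_left_zero integral_complex_of_real)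
  have "integrable \<mu> (\<lambda>\<xi>. LINT \<sigma>|lborel. ?e \<sigma> \<xi>)" by (rule integrable_snd[OF e])
  then show "(\<lambda>\<xi>. complex_of_real (cutoff \<gamma> \<delta> \<xi>) * ?\<Phi> \<xi>) \<in> L12"
    unfolding N using cutoff_L2[OF \<gamma> weinstein_in_L2[OF \<phi>]] by simp
  have "calderon \<alpha> m \<phi> \<gamma> \<delta> x = (LINT \<sigma>|lborel. LINT \<xi>|\<mu>. ?E \<sigma> \<xi>)"
    unfolding calderon_def set_lebesgue_integral_def J ..
  also have "\<dots> = (LINT \<xi>|\<mu>. LINT \<sigma>|lborel. ?E \<sigma> \<xi>)" by (rule Fubini_integral[OF E, symmetric])
  also have "\<dots> = (LINT \<xi>|\<mu>. (LINT \<sigma>|lborel. ?e \<sigma> \<xi>) * kernel (reflect x) \<xi>)"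
    by (simp only: integral_mult_left_zero)
  finally show "calderon \<alpha> m \<phi> \<gamma> \<delta> x
      = transform (\<lambda>\<xi>. complex_of_real (cutoff \<gamma> \<delta> \<xi>) * ?\<Phi> \<xi>) (reflect x)"
    unfolding N weinstein_L1_def .
qed

text \<open>Both the approximation and \<phi> are inverse transforms, of the cut off transform and
  of the full one. The bound for differences in \<open>weinstein_sqnorm_le\<close> therefore reduces
  the question to the multiplier.\<close>

lemma calderon_L2:
  assumes \<gamma>: "0 < \<gamma>"
  shows "calderon \<alpha> m \<phi> \<gamma> \<delta> \<in> L2 \<alpha>"
    and "sqnorm (\<lambda>x. calderon \<alpha> m \<phi> \<gamma> \<delta> x - \<phi> x)
      \<le> 16 * sqnorm (\<lambda>\<xi>. complex_of_real (cutoff \<gamma> \<delta> \<xi>) * wtransform \<phi> \<xi> - wtransform \<phi> \<xi>)"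
proof -
  let ?\<Phi> = "wtransform \<phi>" and ?N = "\<lambda>\<xi>. complex_of_real (cutoff \<gamma> \<delta> \<xi>) * wtransform \<phi> \<xi>"
  \<comment> \<open>Any point of the half space will do: the integrability obtained from
    \<open>calderon_eq\<close> does not refer to it.\<close>
  have "((0, 1) :: (real ^ 'd) \<times> real) \<in> half_space" by simp
  from calderon_eq(3)[OF this \<gamma>] have N: "?N \<in> L12" .
  then have N2: "?N \<in> L2 \<alpha>" and N1: "integrable \<mu> ?N" by auto
  have \<Phi>: "?\<Phi> \<in> L2 \<alpha>" by (rule weinstein_in_L2[OF \<phi>])
  have T: "(\<lambda>x. transform ?N (reflect x)) \<in> L2 \<alpha>" by (intro L2_reflect transform_L2 N1 N2)
  have meas: "calderon \<alpha> m \<phi> \<gamma> \<delta> \<in> borel_measurable \<mu>"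
    using L2_measurable[OF T] calderon_eq(2)[OF _ \<gamma>] by (subst measurable_cong) auto
  have eq: "AE x in \<mu>. calderon \<alpha> m \<phi> \<gamma> \<delta> x = transform ?N (reflect x)"
    using calderon_eq(2)[OF _ \<gamma>] by (intro AE_I2) simp
  show "calderon \<alpha> m \<phi> \<gamma> \<delta> \<in> L2 \<alpha>" by (rule L2_cong_AE[OF T meas eq])
  have WN: "AE x in \<mu>. transform ?N (reflect x) = wtransform ?N (reflect x)"
    using AE_weinstein_reflect[OF weinstein_eq_transform[OF N]] by eventually_elim simp
  have W\<Phi>: "AE x in \<mu>. \<phi> x = wtransform ?\<Phi> (reflect x)"
    using AE_weinstein_reflect[OF weinstein_inversion[OF \<phi>]] by eventually_elim simp
  have D: "(\<lambda>x. wtransform ?N x - wtransform ?\<Phi> x) \<in> L2 \<alpha>"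
    by (intro L2_diff weinstein_in_L2 N2 \<Phi>)
  have "sqnorm (\<lambda>x. calderon \<alpha> m \<phi> \<gamma> \<delta> x - \<phi> x)
      = sqnorm (\<lambda>x. wtransform ?N (reflect x) - wtransform ?\<Phi> (reflect x))"
  proof (rule sqnorm_cong_AE)
    show "AE x in \<mu>. calderon \<alpha> m \<phi> \<gamma> \<delta> x - \<phi> x
        = wtransform ?N (reflect x) - wtransform ?\<Phi> (reflect x)"
      using eq WN W\<Phi> by eventually_elim simp
    show "(\<lambda>x. calderon \<alpha> m \<phi> \<gamma> \<delta> x - \<phi> x) \<in> borel_measurable \<mu>"
      by (intro borel_measurable_diff meas L2_measurable[OF \<phi>])
    show "(\<lambda>x. wtransform ?N (reflect x) - wtransform ?\<Phi> (reflect x)) \<in> borel_measurable \<mu>"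
      by (rule L2_measurable[OF L2_reflect(1)[OF D]])
  qed
  also have "\<dots> = sqnorm (\<lambda>x. wtransform ?N x - wtransform ?\<Phi> x)" by (rule L2_reflect(2)[OF D])
  also have "\<dots> \<le> 16 * sqnorm (\<lambda>\<xi>. ?N \<xi> - ?\<Phi> \<xi>)" by (rule weinstein_sqnorm_le[OF N2 \<Phi>])
  finally show "sqnorm (\<lambda>x. calderon \<alpha> m \<phi> \<gamma> \<delta> x - \<phi> x) \<le> 16 * sqnorm (\<lambda>\<xi>. ?N \<xi> - ?\<Phi> \<xi>)" .
qed

text \<open>Enlarging the interval of scales raises the cutoff towards 1 from below, so the error 1
  - cutoff decreases pointwise while staying nonnegative.\<close>

lemma cutoff_sqnorm_mono:
  assumes "0 < \<gamma>" "\<gamma> \<le> \<gamma>'" "\<delta>' \<le> \<delta>" and f: "f \<in> L2 \<alpha>"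
  shows "sqnorm (\<lambda>\<xi>. complex_of_real (cutoff \<gamma> \<delta> \<xi>) * f \<xi> - f \<xi>)
       \<le> sqnorm (\<lambda>\<xi>. complex_of_real (cutoff \<gamma>' \<delta>' \<xi>) * f \<xi> - f \<xi>)"
proof -
  have \<gamma>': "0 < \<gamma>'" using assms by linarith
  have nrm: "(cmod (complex_of_real c * z - z))\<^sup>2 = (1 - c)\<^sup>2 * (cmod z)\<^sup>2" for c z
  proof -
    have "complex_of_real c * z - z = complex_of_real (c - 1) * z" by (simp add: left_diff_distrib)
    then show ?thesis by (simp add: norm_mult power_mult_distrib power2_commute del: of_real_diff)
  qed
  show ?thesis
    unfolding sqnorm_def
  proof (rule integral_mono)
    fix \<xi> assume "\<xi> \<in> space (\<mu> :: ((real ^ 'd) \<times> real) measure)"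
    then have \<xi>: "\<xi> \<in> half_space" by simp
    have "(1 - cutoff \<gamma> \<delta> \<xi>)\<^sup>2 \<le> (1 - cutoff \<gamma>' \<delta>' \<xi>)\<^sup>2"
      using cutoff_mono[OF \<xi> assms(1,2,3)] cutoff_bounds[OF \<xi> assms(1)] by (intro power_mono) auto
    then show "(cmod (complex_of_real (cutoff \<gamma> \<delta> \<xi>) * f \<xi> - f \<xi>))\<^sup>2
        \<le> (cmod (complex_of_real (cutoff \<gamma>' \<delta>' \<xi>) * f \<xi> - f \<xi>))\<^sup>2"
      unfolding nrm by (rule mult_right_mono) simp
  qed (intro L2_integrable L2_diff cutoff_L2 assms \<gamma>' f)+
qed

text \<open>The two parameters move independently, whereas dominated convergence gives a sequence.
  One member of the sequence is made small, and monotonicity passes its bound to every larger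
  interval of scales; the tolerance e / 16 compensates the factor of
  \<open>calderon_L2\<close>.\<close>

theorem calderon_tendsto:
  "((\<lambda>(\<gamma>, \<delta>). sqnorm (\<lambda>x. calderon \<alpha> m \<phi> \<gamma> \<delta> x - \<phi> x)) \<longlongrightarrow> 0) (at_right 0 \<times>\<^sub>F at_top)"
proof (rule tendstoI)
  fix e :: real assume e: "0 < e"
  let ?\<Phi> = "wtransform \<phi>"
  let ?D = "\<lambda>\<gamma> \<delta>. sqnorm (\<lambda>\<xi>. complex_of_real (cutoff \<gamma> \<delta> \<xi>) * ?\<Phi> \<xi> - ?\<Phi> \<xi>)"
  have \<Phi>: "?\<Phi> \<in> L2 \<alpha>" by (rule weinstein_in_L2[OF \<phi>])
  have "L2_tendsto \<alpha> (\<lambda>n \<xi>. complex_of_real (cutoff (1 / real (n + 2)) (real (n + 2)) \<xi>) * ?\<Phi> \<xi>) ?\<Phi>"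
  proof (rule L2_tendsto_dominated[OF \<Phi>])
    fix \<xi> :: "(real ^ 'd) \<times> real" assume \<xi>: "\<xi> \<in> half_space"
    show "cmod (complex_of_real (cutoff (1 / real (n + 2)) (real (n + 2)) \<xi>)) \<le> 1" for n
      using cutoff_bounds[OF \<xi>, of "1 / real (n + 2)" "real (n + 2)"] by simp
    show "(\<lambda>n. complex_of_real (cutoff (1 / real (n + 2)) (real (n + 2)) \<xi>)) \<longlonglongrightarrow> 1"
      using tendsto_of_real[OF cutoff_tendsto[OF \<xi>], where 'a = complex] by simp
  qed measurable
  from L2_tendsto_L2(3)[OF this]
  have "eventually (\<lambda>n. ?D (1 / real (n + 2)) (real (n + 2)) < e / 16) sequentially"
    by (rule order_tendstoD(2)) (use e in simp)
  then obtain n where n: "?D (1 / real (n + 2)) (real (n + 2)) < e / 16"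
    by (auto simp: eventually_sequentially)
  have "eventually (\<lambda>\<gamma>. \<gamma> \<in> {0<..<1 / real (n + 2)}) (at_right 0)"
    by (rule eventually_at_right_real) simp
  moreover have "eventually (\<lambda>\<delta>. real (n + 2) < \<delta>) at_top" by (rule eventually_gt_at_top)
  moreover have "dist (sqnorm (\<lambda>x. calderon \<alpha> m \<phi> \<gamma> \<delta> x - \<phi> x)) 0 < e"
    if "\<gamma> \<in> {0<..<1 / real (n + 2)}" "real (n + 2) < \<delta>" for \<gamma> \<delta>
  proof -
    from that have \<gamma>: "0 < \<gamma>" "\<gamma> \<le> 1 / real (n + 2)" by auto
    have "sqnorm (\<lambda>x. calderon \<alpha> m \<phi> \<gamma> \<delta> x - \<phi> x) \<le> 16 * ?D \<gamma> \<delta>" by (rule calderon_L2(2)[OF \<gamma>(1)])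
    moreover have "?D \<gamma> \<delta> \<le> ?D (1 / real (n + 2)) (real (n + 2))"
      by (rule cutoff_sqnorm_mono[OF \<gamma> _ \<Phi>]) (use that in simp)
    ultimately have "sqnorm (\<lambda>x. calderon \<alpha> m \<phi> \<gamma> \<delta> x - \<phi> x) < e" using n by linarith
    then show ?thesis by simp
  qed
  ultimately have "eventually (\<lambda>p. dist (sqnorm (\<lambda>x. calderon \<alpha> m \<phi> (fst p) (snd p) x - \<phi> x)) 0
      < e) (at_right 0 \<times>\<^sub>F at_top)"
    unfolding eventually_prod_filter
    by (intro exI[of _ "\<lambda>\<gamma>. \<gamma> \<in> {0<..<1 / real (n + 2)}"] exI[of _ "\<lambda>\<delta>. real (n + 2) < \<delta>"]) simp
  then show "eventually (\<lambda>p. dist (case p of (\<gamma>, \<delta>) \<Rightarrow> sqnorm (\<lambda>x. calderon \<alpha> m \<phi> \<gamma> \<delta> x - \<phi> x)) 0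
      < e) (at_right 0 \<times>\<^sub>F at_top)"
    by (simp add: case_prod_beta')
qed

end

text \<open>Integrability over the scales is asserted along with the limit, since otherwise the
  integral in \<open>calderon\<close> could be a default value; membership in \<open>L2\<close>
  guards \<open>L2_norm\<close> in the same way.\<close>

theorem theorem2p5:
  fixes \<alpha> :: real
    and \<phi> m :: "(real ^ 'd::finite) \<times> real \<Rightarrow> complex"
  assumes "\<alpha> > - 1 / 2"
    and "\<phi> \<in> L2 \<alpha>"
    and "m \<in> L2 \<alpha> \<inter> Linf \<alpha>"
    and "\<And>x. x \<in> half_space \<Longrightarrow> (LINT \<sigma>:{0<..}|lborel. (cmod (m (\<sigma> *\<^sub>R x)))\<^sup>2 / \<sigma>) = 1"
  shows "(\<forall>\<gamma> \<delta>. 0 < \<gamma> \<and> \<gamma> < \<delta> \<longrightarrow>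
            (\<forall>x\<in>half_space. set_integrable lborel {\<gamma>..\<delta>} (calderon_integrand \<alpha> m \<phi> x)) \<and>
            calderon \<alpha> m \<phi> \<gamma> \<delta> \<in> L2 \<alpha>) \<and>
         ((\<lambda>(\<gamma>, \<delta>). L2_norm \<alpha> (\<lambda>x. calderon \<alpha> m \<phi> \<gamma> \<delta> x - \<phi> x)) \<longlongrightarrow> 0)
           (at_right 0 \<times>\<^sub>F at_top)"
proof -
  from assms(3) obtain C0 where C0: "AE x in weinstein_measure \<alpha>. cmod (m x) \<le> C0"
    by (auto simp: Linf_def)
  \<comment> \<open>The essential bound from \<open>Linf\<close> carries no sign, and the estimates
    use a nonnegative one.\<close>
  interpret calderon_setup \<alpha> \<phi> m "max C0 0"
  proof
    show "AE x in weinstein_measure \<alpha>. cmod (m x) \<le> max C0 0" using C0 by eventually_elim simp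
  qed (use assms in auto)
  have "((\<lambda>p. sqrt (case p of (\<gamma>, \<delta>) \<Rightarrow> sqnorm (\<lambda>x. calderon \<alpha> m \<phi> \<gamma> \<delta> x - \<phi> x))) \<longlongrightarrow> sqrt 0) (at_right 0 \<times>\<^sub>F at_top)"
    by (rule tendsto_real_sqrt[OF calderon_tendsto])
  then show ?thesis
    using calderon_eq(1) calderon_L2(1) by (simp add: L2_norm_eq case_prod_beta')
qed

end
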